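(* Let $\alpha\in(-1,\infty)$ and $p\in[1,\infty]$. Let $F:\mathbb{T}\to\mathbb{C}$ be absolutely continuous on $\mathbb{T}$ with $\dot F\in \mathcal{L}^{p}(\mathbb{T})$, and let $f=\mathcal{K}_{\alpha}[F]$ in $\mathbb{D}$. Then the following three statements hold. (1) If $(\alpha,p)\in\Pi$, then $\|\partial_{\theta}f\|_{\mathcal{H}_{\mathcal{G}}^p(\mathbb{D})}\lesssim\|\dot{F}\|_{\mathcal{L}^{p}(\mathbb{T})}$. (2) If $(\alpha,p)\in\Pi_{1}$, then $$\|\partial_{r} f\|_{\mathcal{H}^{p}_{\mathcal{G}}(\mathbb{D})}+\|\partial_{z} f\|_{\mathcal{H}^{p}_{\mathcal{G}}(\mathbb{D})}+\|\partial_{\overline{z}} f\|_{\mathcal{H}^{p}_{\mathcal{G}}(\mathbb{D})}\lesssim \|F\|_{\mathcal{L}^{\infty}(\mathbb{T})}+\|\dot F\|_{\mathcal{L}^p(\mathbb{T})}.$$ In particular, if $\alpha=0$ and $p\in(1,\infty)$, then $$\|\partial_{r} f\|_{\mathcal{H}^{p}_{\mathcal{G}}(\mathbb{D})}+\|\partial_{z} f\|_{\mathcal{H}^{p}_{\mathcal{G}}(\mathbb{D})}+\|\partial_{\overline{z}} f\|_{\mathcal{H}^{p}_{\mathcal{G}}(\mathbb{D})}\lesssim \|\dot F\|_{\mathcal{L}^p(\mathbb{T})}.$$ (3) If $(\alpha,p)\in\Pi_{2}\cup\Pi_{3}$ and $f$ is a $(K,K')$-elliptic mapping in $\mathbb{D}$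 (for some constants $K\geq1$, $K'\geq0$), then $$\|\partial_{r} f\|_{\mathcal{H}^{p}_{\mathcal{G}}(\mathbb{D})}+\|\partial_{z} f\|_{\mathcal{H}^{p}_{\mathcal{G}}(\mathbb{D})}+\|\partial_{\overline{z}} f\|_{\mathcal{H}^{p}_{\mathcal{G}}(\mathbb{D})}\lesssim \|\dot F\|_{\mathcal{L}^p(\mathbb{T})}.$$
   Context: $\mathbb{D}=\{z\in\mathbb{C}:|z|<1\}$, $\mathbb{T}=\partial\mathbb{D}$. Poisson type integral: for $\alpha>-1$ and $F\in\mathcal{L}^1(\mathbb{T})$, $$\mathcal{K}_{\alpha}[F](z)=\frac{1}{2\pi}\int_{0}^{2\pi}\mathcal{K}_{\alpha}(ze^{-it})F(e^{it})\,dt,\quad \mathcal{K}_{\alpha}(z)=\mathcal{C}_{\alpha}\frac{(1-|z|^2)^{\alpha+1}}{|1-z|^{\alpha+2}},\quad \mathcal{C}_{\alpha}=\frac{\Gamma^2(1+\frac{\alpha}{2})}{\Gamma(1+\alpha)},\quad z\in\mathbb{D},$$ where $\Gamma$ is the Gamma function. Absolute continuity of $F$ on $\mathbb{T}$ refers to $\theta\mapsto F(e^{i\theta})$ on $[0,2\pi]$, and $\dot F(e^{i\theta})=\frac{d}{d\theta}F(e^{i\theta})$, which exists a.e. For $p\in[1,\infty)$, $\|G\|_{\mathcal{L}^p(\mathbb{T})}=\big(\frac1{2\pi}\int_0^{2\pi}|G(e^{i\theta})|^p\,d\theta\big)^{1/p}$, and $\|G\|_{\mathcal{L}^\infty(\mathbb{T})}$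 is the essential supremum. Derivatives: $\partial_z=\frac12(\partial_x-i\partial_y)$, $\partial_{\overline z}=\frac12(\partial_x+i\partial_y)$; $\partial_\theta f$ and $\partial_r f$ are the polar derivatives, i.e. for $z=re^{i\theta}$, $\partial_\theta f(z)=i(z\partial_zf(z)-\overline z\,\partial_{\overline z}f(z))$ and $\partial_r f(z)=\partial_zf(z)e^{i\theta}+\partial_{\overline z}f(z)e^{-i\theta}$. Hardy type norm: for a measurable complex-valued $g$ on $\mathbb{D}$, $\|g\|_{\mathcal{H}^p_{\mathcal{G}}(\mathbb{D})}=H_p(g)=\sup_{r\in[0,1)}M_p(r,g)$, where $M_p(r,g)=\big(\frac1{2\pi}\int_0^{2\pi}|g(re^{i\theta})|^p\,d\theta\big)^{1/p}$ for $p<\infty$ and $M_\infty(r,g)=\max_{\theta\in[0,2\pi]}|g(re^{i\theta})|$. Parameter sets: $\Pi=\{(\alpha,p):-1<\alpha<\infty,\ 1\le p\le\infty\}$; $\Pi_1=\{(\alpha,p):0<\alpha<\infty,\ 1\le p\le\infty\}\cup\{(\alpha,p):\alpha=0,\ 1<p<\infty\}$; $\Pi_2=\{(\alpha,p):-1<\alpha<0,\ 1\le p<-\frac1\alpha\}\cup\{(0,1)\}$; $\Pi_3=\{(\alpha,p):-1<\alpha<0,\ -\frac1\alpha\le p\le\infty\}\cup\{(0,\infty)\}$. Elliptic mappings: put $\|D_f(z)\|=|\partial_zf(z)|+|\partial_{\overline z}f(z)|$ and $J_f=|\partial_zf|^2-|\partial_{\overline z}f|^2$ (the Jacobian). A sense-preserving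 (so $J_f\ge0$ a.e.) continuous mapping $f:\mathbb{D}\to\mathbb{C}$ is $(K,K')$-elliptic, for constants $K\ge1$ and $K'\ge0$, if (i) $f$ is absolutely continuous on almost every horizontal line and almost every vertical line in every closed rectangle $R\subset\mathbb{D}$ with sides parallel to the axes, the partial derivatives of $f$ are locally square integrable in $\mathbb{D}$, and $J_f\ne0$ a.e. in $\mathbb{D}$; and (ii) $\|D_f(z)\|^2\le KJ_f(z)+K'$ a.e. in $\mathbb{D}$. Notation $\lesssim$: for nonnegative quantities $X,Y$, $X\lesssim Y$ means that there exist constants $M_1\ge1$ and $M_2\ge0$ with $X\le M_1Y+M_2$. The constants may depend on all the data ($\alpha,p,K,K'$ and on the given mapping $f$); in particular, the left-hand side is finite whenever the right-hand side is. *)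

theory Defs
  imports "HOL-Analysis.Analysis" "HOL-Probability.Essential_Supremum"
begin

abbreviation unit_disc :: "complex set" where
  "unit_disc \<equiv> ball 0 1"

text \<open>
  A function on the circle is represented by a function on all of the complex plane;
  the notions for such functions (prefix \<open>circle\<close>) only look at its values at the points \<open>cis \<theta>\<close>.
  Integrals over the circle are taken with respect to the completed Lebesgue measure on
  \<open>[0, 2 pi]\<close>, so that a function defined almost everywhere may take arbitrary values on the
  exceptional null set without losing measurability.
\<close>

definition abs_continuous_on :: "real \<Rightarrow> real \<Rightarrow> (real \<Rightarrow> 'a::metric_space) \<Rightarrow> bool" where
  "abs_continuous_on a b g \<longleftrightarrow>
     (\<forall>\<epsilon>>0. \<exists>\<delta>>0. \<forall>(n::nat) (u::nat \<Rightarrow> real) (v::nat \<Rightarrow> real).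
        (\<forall>i<n. a \<le> u i \<and> u i \<le> v i \<and> v i \<le> b) \<longrightarrow>
        disjoint_family_on (\<lambda>i. {u i<..<v i}) {..<n} \<longrightarrow>
        (\<Sum>i<n. v i - u i) < \<delta> \<longrightarrow>
        (\<Sum>i<n. dist (g (u i)) (g (v i))) < \<epsilon>)"

definition circle_abs_continuous :: "(complex \<Rightarrow> complex) \<Rightarrow> bool" where
  "circle_abs_continuous F \<longleftrightarrow> abs_continuous_on 0 (2 * pi) (\<lambda>\<theta>. F (cis \<theta>))"

text \<open>
  The tangential derivative; only meaningful at those \<open>w = cis \<theta>\<close> at which
  \<open>\<theta> \<mapsto> F (cis \<theta>)\<close> is differentiable.
\<close>
definition circle_deriv :: "(complex \<Rightarrow> complex) \<Rightarrow> complex \<Rightarrow> complex" where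
  "circle_deriv F w = vector_derivative (\<lambda>\<theta>. F (cis \<theta>)) (at (Arg w))"

definition ennreal_powr :: "ennreal \<Rightarrow> real \<Rightarrow> ennreal" where
  "ennreal_powr x a = (if x = \<infinity> then \<infinity> else ennreal (enn2real x powr a))"

definition circle_mean :: "real \<Rightarrow> (complex \<Rightarrow> complex) \<Rightarrow> ennreal" where
  "circle_mean q G = ennreal_powr
     (ennreal (1 / (2 * pi)) *
        (\<integral>\<^sup>+ \<theta>. ennreal (norm (G (cis \<theta>)) powr q) \<partial>lebesgue_on {0..2 * pi}))
     (1 / q)"

definition circle_Lp_norm :: "ereal \<Rightarrow> (complex \<Rightarrow> complex) \<Rightarrow> ennreal" where
  "circle_Lp_norm p G =
     (if p = \<infinity> then esssup (lebesgue_on {0..2 * pi}) (\<lambda>\<theta>. ennreal (norm (G (cis \<theta>))))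
      else circle_mean (real_of_ereal p) G)"

definition circle_Lp :: "ereal \<Rightarrow> (complex \<Rightarrow> complex) set" where
  "circle_Lp p = {G. (\<lambda>\<theta>. G (cis \<theta>)) \<in> borel_measurable (lebesgue_on {0..2 * pi}) \<and>
                     circle_Lp_norm p G < \<infinity>}"

definition poisson_const :: "real \<Rightarrow> real" where
  "poisson_const \<alpha> = (Gamma (1 + \<alpha> / 2))\<^sup>2 / Gamma (1 + \<alpha>)"

definition poisson_kernel :: "real \<Rightarrow> complex \<Rightarrow> real" where
  "poisson_kernel \<alpha> z =
     poisson_const \<alpha> * ((1 - (norm z)\<^sup>2) powr (\<alpha> + 1) / norm (1 - z) powr (\<alpha> + 2))"

definition poisson_integral :: "real \<Rightarrow> (complex \<Rightarrow> complex) \<Rightarrow> complex \<Rightarrow> complex" where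
  "poisson_integral \<alpha> F z =
     of_real (1 / (2 * pi)) *
       (\<integral>t. of_real (poisson_kernel \<alpha> (z * cis (- t))) * F (cis t) \<partial>lebesgue_on {0..2 * pi})"

definition partial_x :: "(complex \<Rightarrow> complex) \<Rightarrow> complex \<Rightarrow> complex" where
  "partial_x f z = vector_derivative (\<lambda>x. f (Complex x (Im z))) (at (Re z))"

definition partial_y :: "(complex \<Rightarrow> complex) \<Rightarrow> complex \<Rightarrow> complex" where
  "partial_y f z = vector_derivative (\<lambda>y. f (Complex (Re z) y)) (at (Im z))"

definition partial_z :: "(complex \<Rightarrow> complex) \<Rightarrow> complex \<Rightarrow> complex" where
  "partial_z f z = (partial_x f z - \<i> * partial_y f z) / 2"

definition partial_zbar :: "(complex \<Rightarrow> complex) \<Rightarrow> complex \<Rightarrow> complex" where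
  "partial_zbar f z = (partial_x f z + \<i> * partial_y f z) / 2"

definition partial_theta :: "(complex \<Rightarrow> complex) \<Rightarrow> complex \<Rightarrow> complex" where
  "partial_theta f z = \<i> * (z * partial_z f z - cnj z * partial_zbar f z)"

text \<open>
  At the origin the radial direction is undetermined; since \<open>Arg 0 = 0\<close>, the value used there
  is the derivative in the direction of the positive real axis.
\<close>
definition partial_r :: "(complex \<Rightarrow> complex) \<Rightarrow> complex \<Rightarrow> complex" where
  "partial_r f z = partial_z f z * cis (Arg z) + partial_zbar f z * cis (- Arg z)"

text \<open>
  Unlike in \<^const>\<open>circle_Lp_norm\<close>, for \<open>p = \<infinity>\<close> this is a genuine (not essential) supremum; it is
  the maximum over the circle of radius \<open>r\<close> whenever the latter exists.
\<close>
definition integral_mean :: "ereal \<Rightarrow> real \<Rightarrow> (complex \<Rightarrow> complex) \<Rightarrow> ennreal" where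
  "integral_mean p r g =
     (if p = \<infinity> then (SUP \<theta>\<in>{0..2 * pi}. ennreal (norm (g (of_real r * cis \<theta>))))
      else circle_mean (real_of_ereal p) (\<lambda>w. g (of_real r * w)))"

definition hardy_norm :: "ereal \<Rightarrow> (complex \<Rightarrow> complex) \<Rightarrow> ennreal" where
  "hardy_norm p g = (SUP r\<in>{0..<1}. integral_mean p r g)"

definition op_norm_D :: "(complex \<Rightarrow> complex) \<Rightarrow> complex \<Rightarrow> real" where
  "op_norm_D f z = norm (partial_z f z) + norm (partial_zbar f z)"

definition jacobian :: "(complex \<Rightarrow> complex) \<Rightarrow> complex \<Rightarrow> real" where
  "jacobian f z = (norm (partial_z f z))\<^sup>2 - (norm (partial_zbar f z))\<^sup>2"

definition ACL_disc :: "(complex \<Rightarrow> complex) \<Rightarrow> bool" where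
  "ACL_disc f \<longleftrightarrow>
     (\<forall>A B. cbox A B \<subseteq> unit_disc \<longrightarrow>
        (AE y in lborel. y \<in> {Im A..Im B} \<longrightarrow>
           abs_continuous_on (Re A) (Re B) (\<lambda>x. f (Complex x y))) \<and>
        (AE x in lborel. x \<in> {Re A..Re B} \<longrightarrow>
           abs_continuous_on (Im A) (Im B) (\<lambda>y. f (Complex x y))))"

definition locally_L2_disc :: "(complex \<Rightarrow> complex) \<Rightarrow> bool" where
  "locally_L2_disc g \<longleftrightarrow>
     g \<in> borel_measurable (lebesgue_on unit_disc) \<and>
     (\<forall>C. compact C \<and> C \<subseteq> unit_disc \<longrightarrow> set_integrable lebesgue C (\<lambda>z. (norm (g z))\<^sup>2))"

text \<open>
  Being sense-preserving enters through its analytic content, the almost everywhere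
  nonnegativity of the Jacobian.
\<close>
definition elliptic_mapping :: "real \<Rightarrow> real \<Rightarrow> (complex \<Rightarrow> complex) \<Rightarrow> bool" where
  "elliptic_mapping K K' f \<longleftrightarrow>
     1 \<le> K \<and> 0 \<le> K' \<and>
     continuous_on unit_disc f \<and>
     (AE z in lebesgue_on unit_disc. 0 \<le> jacobian f z) \<and>
     ACL_disc f \<and>
     locally_L2_disc (partial_x f) \<and> locally_L2_disc (partial_y f) \<and>
     (AE z in lebesgue_on unit_disc. jacobian f z \<noteq> 0) \<and>
     (AE z in lebesgue_on unit_disc. (op_norm_D f z)\<^sup>2 \<le> K * jacobian f z + K')"

definition Param :: "(real \<times> ereal) set" where
  "Param = {(\<alpha>, p). -1 < \<alpha> \<and> 1 \<le> p}"

definition Param1 :: "(real \<times> ereal) set" where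
  "Param1 = {(\<alpha>, p). 0 < \<alpha> \<and> 1 \<le> p} \<union> {(\<alpha>, p). \<alpha> = 0 \<and> 1 < p \<and> p < \<infinity>}"

definition Param2 :: "(real \<times> ereal) set" where
  "Param2 = {(\<alpha>, p). -1 < \<alpha> \<and> \<alpha> < 0 \<and> 1 \<le> p \<and> p < ereal (- 1 / \<alpha>)} \<union> {(0, 1)}"

definition Param3 :: "(real \<times> ereal) set" where
  "Param3 = {(\<alpha>, p). -1 < \<alpha> \<and> \<alpha> < 0 \<and> ereal (- 1 / \<alpha>) \<le> p} \<union> {(0, \<infinity>)}"

definition lesssim :: "ennreal \<Rightarrow> ennreal \<Rightarrow> bool" where
  "lesssim X Y \<longleftrightarrow>
     (\<exists>M1 M2 :: real. 1 \<le> M1 \<and> 0 \<le> M2 \<and> X \<le> ennreal M1 * Y + ennreal M2)"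

end

theory Submission
  imports Defs "HOL-Complex_Analysis.Complex_Analysis"
begin

text \<open>
  The constants in \<^const>\<open>lesssim\<close> may depend on \<open>f\<close> and include an additive one, so an estimate
  holds as soon as its left-hand side is finite. What has to be shown is that the partial
  derivatives in question have bounded means over the circles \<open>|z| = r\<close>, uniformly in \<open>r < 1\<close>.

  Write \<open>\<phi>(t) = F(e\<^sup>i\<^sup>t)\<close> and \<open>g = \<phi>'\<close>, and for \<open>z = r e\<^sup>i\<^sup>\<theta>\<close> put \<open>s = \<theta> - t\<close>, \<open>w = r e\<^sup>i\<^sup>s\<close>. Differentiation under
  the integral sign expresses the polar derivatives of \<open>f\<close> as convolutions of \<open>\<phi>\<close> with
  kernels in \<open>s\<close>. The kernel belonging to \<open>\<partial>\<^sub>\<theta> f\<close> is the derivative in \<open>s\<close> of the Poisson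
  type kernel itself, and \<open>\<phi>\<close> is absolutely continuous, so integration by parts gives
  \<open>\<partial>\<^sub>\<theta> f = K\<^sub>\<alpha>[g]\<close> (\<open>angular_derivative_representation\<close>). The kernels \<open>K\<^sub>\<alpha>\<close> are bounded in \<open>L\<^sup>1\<close> uniformly in \<open>r\<close>, and
  Schur's test yields the first claim.

  For the radial derivative everything rests on an identity (\<open>radial_conjugate_derivative\<close>):
  with \<open>d = 1 - r\<^sup>2\<close> and \<open>E = |1 - w|\<^sup>2\<close>, and up to the factor \<open>C\<^sub>\<alpha>\<close>,
  \<open>r \<partial>\<^sub>r K\<^sub>\<alpha> = \<partial>\<^sub>s Q + R\<close> where \<open>Q = 2 d\<^sup>\<alpha> Im w / |1 - w|\<^sup>\<alpha>\<^sup>+\<^sup>2\<close> and \<open>R = (\<alpha>/2) d\<^sup>\<alpha> (d - E) / |1 - w|\<^sup>\<alpha>\<^sup>+\<^sup>2\<close>.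
  Hence \<open>r \<partial>\<^sub>r f\<close> is the sum of \<open>Q * g\<close> and \<open>R * \<phi>\<close>. If \<open>\<alpha> > 0\<close>, then both kernels are
  \<open>O((1 - r)\<^sup>\<alpha> |1 - w|\<^sup>-\<^sup>\<alpha>\<^sup>-\<^sup>1)\<close>, so they too are bounded in \<open>L\<^sup>1\<close> and Schur's test applies again. If
  \<open>\<alpha> = 0\<close>, then \<open>R\<close> vanishes and \<open>Q\<close> is the conjugate Poisson kernel, which is not bounded in
  \<open>L\<^sup>1\<close>; here M. Riesz's theorem on conjugate functions is needed, and it requires
  \<open>1 < p < \<infinity>\<close> (\<open>riesz_bound_all\<close>).

  If \<open>f\<close> is elliptic, the radial derivative need not be estimated at all: with
  \<open>D = |\<partial>\<^sub>z f| + |\<partial>\<^sub>z\<^sub>b\<^sub>a\<^sub>r f|\<close> and \<open>l = ||\<partial>\<^sub>z f| - |\<partial>\<^sub>z\<^sub>b\<^sub>a\<^sub>r f||\<close> the Jacobian is at most \<open>D l\<close>, so \<open>D\<^sup>2 \<le> K D l + K'\<close> and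
  therefore \<open>D \<le> K l + sqrt K'\<close>, while \<open>|z| l \<le> |\<partial>\<^sub>\<theta> f|\<close> (\<open>elliptic_mapping_partial_bound\<close>). In all
  cases the polar derivatives dominate the partial derivatives for \<open>|z| \<ge> 1/2\<close>, and on the remaining disc
  the partial derivatives are continuous, hence bounded (\<open>partials_bounded_means\<close>).

  Two classical theorems are proved on the way. An absolutely continuous
  function is differentiable almost everywhere and is the integral of its derivative
  (\<open>abs_continuous_ftc\<close>): subtracting it from its total variation splits it into monotone absolutely continuous
  functions, these have densities by the Radon-Nikodym theorem, and indefinite integrals
  are differentiable almost everywhere. M. Riesz's theorem is proved for Herglotz integrals of
  nonnegative densities, which take values in the right half-plane: there \<open>|\<zeta>|\<^sup>q\<close> is at most
  a multiple of \<open>(Re \<zeta>)\<^sup>q\<close> plus a multiple of the harmonic function \<open>Re \<zeta>\<^sup>q\<close> (\<open>sector_inequality\<close>), and the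
  mean of the latter over a circle is its value at the centre. This breaks down exactly
  when \<open>q\<close> is an odd integer, and then the exponent \<open>q/2\<close> applied to the square of the Herglotz
  integral fills the gap (\<open>riesz_bound_double\<close>).
\<close>

definition intervals_in :: "real \<Rightarrow> real \<Rightarrow> (nat \<times> (nat \<Rightarrow> real) \<times> (nat \<Rightarrow> real)) set" where
  "intervals_in a b = {(n, u, v). (\<forall>i<n. a \<le> u i \<and> u i \<le> v i \<and> v i \<le> b) \<and>
     disjoint_family_on (\<lambda>i. {u i<..<v i}) {..<n}}"

text \<open>
  Taking the value in \<^typ>\<open>ennreal\<close> lets the supremum below exist before it is known to be finite.
\<close>
definition increment_sum :: "(real \<Rightarrow> 'a::metric_space) \<Rightarrow> nat \<times> (nat \<Rightarrow> real) \<times> (nat \<Rightarrow> real) \<Rightarrow> ennreal" where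
  "increment_sum g = (\<lambda>(n, u, v). ennreal (\<Sum>i<n. dist (g (u i)) (g (v i))))"

definition variation :: "(real \<Rightarrow> 'a::metric_space) \<Rightarrow> real \<Rightarrow> real \<Rightarrow> ennreal" where
  "variation g a b = (SUP x\<in>intervals_in a b. increment_sum g x)"

section \<open>Total variation of absolutely continuous functions\<close>

lemma disjoint_family_on_shrink:
  assumes "disjoint_family_on A I" "\<And>i. i \<in> I \<Longrightarrow> B i \<subseteq> A i"
  shows "disjoint_family_on B I"
  using assms unfolding disjoint_family_on_def by blast

lemma intervals_in_nonempty: "intervals_in a b \<noteq> {}"
proof -
  have "(0, \<lambda>_. 0, \<lambda>_. 0) \<in> intervals_in a b"
    by (simp add: intervals_in_def disjoint_family_on_def)
  then show ?thesis by blast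
qed

lemma intervals_in_mono: "b \<le> c \<Longrightarrow> intervals_in a b \<subseteq> intervals_in a c"
  by (fastforce simp: intervals_in_def)

lemma variation_mono: "b \<le> c \<Longrightarrow> variation g a b \<le> variation g a c"
  unfolding variation_def by (intro SUP_subset_mono intervals_in_mono) auto

text \<open>
  Cutting every interval of a family at the point \<open>b\<close> produces a family to the left and one to the
  right of \<open>b\<close>; the clamped endpoints \<open>min (u i) b\<close> and \<open>max (u i) b\<close> do this uniformly, at the price of
  some degenerate intervals, which contribute nothing.
\<close>
lemma variation_subadditive:
  assumes "a \<le> b" "b \<le> c"
  shows "variation g a c \<le> variation g a b + variation g b c"
  unfolding variation_def[of g a c]
proof (rule SUP_least)
  fix x assume "x \<in> intervals_in a c"
  then obtain n u v where x: "x = (n, u, v)" and uv: "\<And>i. i < n \<Longrightarrow> a \<le> u i \<and> u i \<le> v i \<and> v i \<le> c"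
    and disj: "disjoint_family_on (\<lambda>i. {u i<..<v i}) {..<n}"
    by (auto simp: intervals_in_def)
  let ?u1 = "\<lambda>i. min (u i) b" and ?v1 = "\<lambda>i. min (v i) b"
  let ?u2 = "\<lambda>i. max (u i) b" and ?v2 = "\<lambda>i. max (v i) b"
  have 1: "(n, ?u1, ?v1) \<in> intervals_in a b"
  proof -
    have "disjoint_family_on (\<lambda>i. {?u1 i<..<?v1 i}) {..<n}"
      by (rule disjoint_family_on_shrink[OF disj]) auto
    with uv assms show ?thesis
      by (force simp: intervals_in_def min_le_iff_disj)
  qed
  have 2: "(n, ?u2, ?v2) \<in> intervals_in b c"
  proof -
    have "disjoint_family_on (\<lambda>i. {?u2 i<..<?v2 i}) {..<n}"
      by (rule disjoint_family_on_shrink[OF disj]) auto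
    with uv assms show ?thesis
      by (force simp: intervals_in_def le_max_iff_disj)
  qed
  have "dist (g (u i)) (g (v i)) \<le> dist (g (?u1 i)) (g (?v1 i)) + dist (g (?u2 i)) (g (?v2 i))" if "i < n" for i
    using uv[OF that]
    by (cases "u i \<le> b"; cases "v i \<le> b") (auto simp: min_def max_def dist_triangle intro: order.trans)
  then have "(\<Sum>i<n. dist (g (u i)) (g (v i))) \<le>
      (\<Sum>i<n. dist (g (?u1 i)) (g (?v1 i))) + (\<Sum>i<n. dist (g (?u2 i)) (g (?v2 i)))"
    by (subst sum.distrib[symmetric]) (auto intro: sum_mono)
  then have "increment_sum g x \<le> increment_sum g (n, ?u1, ?v1) + increment_sum g (n, ?u2, ?v2)"
    by (simp add: x increment_sum_def ennreal_plus[symmetric] sum_nonneg del: ennreal_plus)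
  also have "\<dots> \<le> variation g a b + variation g b c"
    unfolding variation_def using 1 2 by (intro add_mono SUP_upper)
  finally show "increment_sum g x \<le> variation g a b + variation g b c" .
qed

text \<open>
  The interval from \<open>b\<close> to \<open>c\<close> may be appended to any family in \<open>[a, b]\<close>. This makes both
  the variation and its difference with a real function nondecreasing.
\<close>
lemma variation_add_dist_le:
  assumes "a \<le> b" "b \<le> c"
  shows "variation g a b + ennreal (dist (g b) (g c)) \<le> variation g a c"
proof -
  have "variation g a b + ennreal (dist (g b) (g c)) =
      (SUP x\<in>intervals_in a b. increment_sum g x + ennreal (dist (g b) (g c)))"
    unfolding variation_def by (rule ennreal_SUP_add_left[symmetric]) (auto simp: intervals_in_nonempty)
  also have "\<dots> \<le> variation g a c"
  proof (rule SUP_least)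
    fix x assume "x \<in> intervals_in a b"
    then obtain n u v where x: "x = (n, u, v)"
      and uv: "\<And>i. i < n \<Longrightarrow> a \<le> u i \<and> u i \<le> v i \<and> v i \<le> b"
      and disj: "disjoint_family_on (\<lambda>i. {u i<..<v i}) {..<n}"
      by (auto simp: intervals_in_def)
    let ?x = "(Suc n, u(n := b), v(n := c))"
    have "disjoint_family_on (\<lambda>i. {(u(n := b)) i<..<(v(n := c)) i}) (insert n {..<n})"
    proof (subst disjoint_family_on_insert)
      have "disjoint_family_on (\<lambda>i. {(u(n := b)) i<..<(v(n := c)) i}) {..<n}"
        using disj by (rule disjoint_family_on_shrink) auto
      moreover have "x \<le> b" if "x \<in> (\<Union>i<n. {(u(n := b)) i<..<(v(n := c)) i})" for x
        using that uv by fastforce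
      then have "{b<..<c} \<inter> (\<Union>i<n. {(u(n := b)) i<..<(v(n := c)) i}) = {}"
        by fastforce
      ultimately show "{(u(n := b)) n<..<(v(n := c)) n} \<inter> (\<Union>i<n. {(u(n := b)) i<..<(v(n := c)) i}) = {}
          \<and> disjoint_family_on (\<lambda>i. {(u(n := b)) i<..<(v(n := c)) i}) {..<n}"
        by simp
    qed simp
    moreover have "\<forall>i<Suc n. a \<le> (u(n := b)) i \<and> (u(n := b)) i \<le> (v(n := c)) i \<and> (v(n := c)) i \<le> c"
      using uv assms by (force simp: less_Suc_eq)
    ultimately have "?x \<in> intervals_in a c"
      by (simp add: intervals_in_def lessThan_Suc)
    moreover have "increment_sum g x + ennreal (dist (g b) (g c)) = increment_sum g ?x"
      by (simp add: x increment_sum_def ennreal_plus[symmetric] sum_nonneg del: ennreal_plus)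
    ultimately show "increment_sum g x + ennreal (dist (g b) (g c)) \<le> variation g a c"
      unfolding variation_def by (metis SUP_upper)
  qed
  finally show ?thesis .
qed

text \<open>
  Absolute continuity refers to families indexed by initial segments of the naturals. The arguments below
  naturally produce families indexed by pairs, or by the members of a covering.
\<close>
lemma abs_continuous_on_finite:
  assumes "abs_continuous_on a b g" "\<epsilon> > 0"
  obtains \<delta> where "\<delta> > 0"
    "\<And>(I :: 'i set) u v. finite I \<Longrightarrow> (\<And>i. i \<in> I \<Longrightarrow> a \<le> u i \<and> u i \<le> v i \<and> v i \<le> b) \<Longrightarrow>
        disjoint_family_on (\<lambda>i. {u i<..<v i}) I \<Longrightarrow> (\<Sum>i\<in>I. v i - u i) < \<delta> \<Longrightarrow>
        (\<Sum>i\<in>I. dist (g (u i)) (g (v i))) < \<epsilon>"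
proof -
  obtain \<delta> where "\<delta> > 0" and \<delta>: "\<And>(n::nat) u v. (\<forall>i<n. a \<le> u i \<and> u i \<le> v i \<and> v i \<le> b) \<Longrightarrow>
      disjoint_family_on (\<lambda>i. {u i<..<v i}) {..<n} \<Longrightarrow> (\<Sum>i<n. v i - u i) < \<delta> \<Longrightarrow>
      (\<Sum>i<n. dist (g (u i)) (g (v i))) < \<epsilon>"
    using assms unfolding abs_continuous_on_def by blast
  show ?thesis
  proof (rule that[OF \<open>\<delta> > 0\<close>])
    fix I :: "'i set" and u v
    assume I: "finite I" and uv: "\<And>i. i \<in> I \<Longrightarrow> a \<le> u i \<and> u i \<le> v i \<and> v i \<le> b"
      and disj: "disjoint_family_on (\<lambda>i. {u i<..<v i}) I" and len: "(\<Sum>i\<in>I. v i - u i) < \<delta>"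
    obtain h where h: "bij_betw h {..<card I} I"
      using ex_bij_betw_nat_finite[OF I] by (auto simp: atLeast0LessThan)
    have hI: "h i \<in> I" if "i < card I" for i
      using h that by (auto simp: bij_betw_def)
    have "(\<Sum>i<card I. dist (g (u (h i))) (g (v (h i)))) < \<epsilon>"
    proof (rule \<delta>)
      show "\<forall>i<card I. a \<le> u (h i) \<and> u (h i) \<le> v (h i) \<and> v (h i) \<le> b"
        using uv hI by blast
      show "disjoint_family_on (\<lambda>i. {u (h i)<..<v (h i)}) {..<card I}"
        using disj hI h unfolding disjoint_family_on_def bij_betw_def
        by (metis inj_on_contraD lessThan_iff)
      show "(\<Sum>i<card I. v (h i) - u (h i)) < \<delta>"
        using len sum.reindex_bij_betw[OF h, of "\<lambda>i. v i - u i"] by simp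
    qed
    then show "(\<Sum>i\<in>I. dist (g (u i)) (g (v i))) < \<epsilon>"
      using sum.reindex_bij_betw[OF h, of "\<lambda>i. dist (g (u i)) (g (v i))"] by simp
  qed
qed

text \<open>
  Suprema over independent index sets may be pulled out of a finite sum one at a time. The summand
  \<open>c0\<close> collects the choices already made in the induction.
\<close>
lemma sum_SUP_le_ennreal:
  fixes s :: "nat \<Rightarrow> 'b \<Rightarrow> ennreal"
  assumes "\<And>i. A i \<noteq> {}" and "\<And>x. (\<And>i. i < n \<Longrightarrow> x i \<in> A i) \<Longrightarrow> c0 + (\<Sum>i<n. s i (x i)) \<le> c"
  shows "c0 + (\<Sum>i<n. SUP y\<in>A i. s i y) \<le> c"
  using assms(2)
proof (induction n arbitrary: c0)
  case (Suc n)
  have "c0 + s n y + (\<Sum>i<n. SUP y\<in>A i. s i y) \<le> c" if "y \<in> A n" for y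
  proof (rule Suc.IH)
    fix x assume x: "\<And>i. i < n \<Longrightarrow> x i \<in> A i"
    have "c0 + (\<Sum>i<Suc n. s i ((x(n := y)) i)) \<le> c"
      by (rule Suc.prems) (use x that in \<open>auto simp: less_Suc_eq\<close>)
    then show "c0 + s n y + (\<Sum>i<n. s i (x i)) \<le> c"
      by (simp add: ac_simps)
  qed
  then have *: "(SUP y\<in>A n. s n y + (c0 + (\<Sum>i<n. SUP y\<in>A i. s i y))) \<le> c"
    by (intro SUP_least) (simp add: ac_simps)
  have "(SUP y\<in>A n. s n y) + (c0 + (\<Sum>i<n. SUP y\<in>A i. s i y)) \<le> c"
    using * ennreal_SUP_add_left[OF assms(1)[of n], of "s n"] by simp
  then show ?case
    by (simp add: ac_simps)
qed (use assms(1) in \<open>auto\<close>)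

text \<open>
  The variation inherits the epsilon-delta property: replacing every interval by a family inside
  it does not increase the total length, so the combined family is still admissible.
\<close>
lemma sum_variation_le:
  assumes "abs_continuous_on a b g" "\<epsilon> > 0"
  obtains \<delta> where "\<delta> > 0"
    "\<And>(n::nat) u v. (\<And>i. i < n \<Longrightarrow> a \<le> u i \<and> u i \<le> v i \<and> v i \<le> b) \<Longrightarrow>
        disjoint_family_on (\<lambda>i. {u i<..<v i}) {..<n} \<Longrightarrow> (\<Sum>i<n. v i - u i) < \<delta> \<Longrightarrow>
        (\<Sum>i<n. variation g (u i) (v i)) \<le> ennreal \<epsilon>"
proof -
  obtain \<delta> where "\<delta> > 0" and \<delta>: 
    "\<And>(I :: (nat \<times> nat) set) u v. finite I \<Longrightarrow> (\<And>i. i \<in> I \<Longrightarrow> a \<le> u i \<and> u i \<le> v i \<and> v i \<le> b) \<Longrightarrow>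
        disjoint_family_on (\<lambda>i. {u i<..<v i}) I \<Longrightarrow> (\<Sum>i\<in>I. v i - u i) < \<delta> \<Longrightarrow>
        (\<Sum>i\<in>I. dist (g (u i)) (g (v i))) < \<epsilon>"
    by (rule abs_continuous_on_finite[OF assms, where 'i = "nat \<times> nat"]) blast
  show ?thesis
  proof (rule that[OF \<open>\<delta> > 0\<close>])
    fix n :: nat and u v :: "nat \<Rightarrow> real"
    assume uv: "\<And>i. i < n \<Longrightarrow> a \<le> u i \<and> u i \<le> v i \<and> v i \<le> b"
      and disj: "disjoint_family_on (\<lambda>i. {u i<..<v i}) {..<n}" and len: "(\<Sum>i<n. v i - u i) < \<delta>"
    have "0 + (\<Sum>i<n. SUP x\<in>intervals_in (u i) (v i). increment_sum g x) \<le> ennreal \<epsilon>"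
    proof (rule sum_SUP_le_ennreal)
      fix x assume x: "\<And>i. i < n \<Longrightarrow> x i \<in> intervals_in (u i) (v i)"
      define m where "m i = fst (x i)" for i
      define p where "p i = fst (snd (x i))" for i
      define q where "q i = snd (snd (x i))" for i
      have xi: "x i = (m i, p i, q i)" for i
        by (simp add: m_def p_def q_def)
      have pq: "u i \<le> p i j \<and> p i j \<le> q i j \<and> q i j \<le> v i" if "i < n" "j < m i" for i j
        using x[OF that(1)] that(2) by (auto simp: xi intervals_in_def)
      have dj: "disjoint_family_on (\<lambda>j. {p i j<..<q i j}) {..<m i}" if "i < n" for i
        using x[OF that(1)] by (auto simp: xi intervals_in_def)
      let ?I = "SIGMA i:{..<n}. {..<m i}"
      have disjI: "disjoint_family_on (\<lambda>(i,j). {p i j<..<q i j}) ?I"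
        unfolding disjoint_family_on_def
      proof (intro ballI impI)
        fix k k' assume k: "k \<in> ?I" "k' \<in> ?I" "k \<noteq> k'"
        obtain i j i' j' where [simp]: "k = (i, j)" "k' = (i', j')"
          by (cases k; cases k')
        from k have *: "i < n" "j < m i" "i' < n" "j' < m i'" "i = i' \<longrightarrow> j \<noteq> j'"
          by auto
        have "{p i j<..<q i j} \<inter> {p i' j'<..<q i' j'} = {}"
        proof (cases "i = i'")
          case True
          with * dj[of i] show ?thesis unfolding disjoint_family_on_def by blast
        next
          case False
          have "{p i j<..<q i j} \<subseteq> {u i<..<v i}" "{p i' j'<..<q i' j'} \<subseteq> {u i'<..<v i'}"
            using pq[of i j] pq[of i' j'] * by auto
          moreover have "{u i<..<v i} \<inter> {u i'<..<v i'} = {}"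
            using disj * False unfolding disjoint_family_on_def by blast
          ultimately show ?thesis by blast
        qed
        then show "(case k of (i,j) \<Rightarrow> {p i j<..<q i j}) \<inter> (case k' of (i,j) \<Rightarrow> {p i j<..<q i j}) = {}"
          by simp
      qed
      have len_i: "(\<Sum>j<m i. q i j - p i j) \<le> v i - u i" if i: "i < n" for i
      proof -
        have "(\<Sum>j<m i. q i j - p i j) = (\<Sum>j<m i. measure lborel {p i j<..<q i j})"
          using pq[OF i] by (intro sum.cong) auto
        also have "\<dots> = measure lborel (\<Union>j<m i. {p i j<..<q i j})"
          using dj[OF i] pq[OF i] by (intro measure_finite_Union[symmetric]) (auto simp: ennreal_neq_top)
        also have "\<dots> \<le> measure lborel {u i..v i}"
          using pq[OF i] uv[OF i] by (intro measure_mono_fmeasurable) (force intro!: fmeasurableI simp: ennreal_less_top)+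
        also have "\<dots> = v i - u i"
          using uv[OF i] by simp
        finally show ?thesis .
      qed
      have "(\<Sum>(i,j)\<in>?I. dist (g (p i j)) (g (q i j))) < \<epsilon>"
      proof -
        have "(\<Sum>k\<in>?I. dist (g ((case k of (i,j) \<Rightarrow> p i j))) (g (case k of (i,j) \<Rightarrow> q i j))) < \<epsilon>"
        proof (rule \<delta>)
          show "finite ?I" by auto
          show "a \<le> (case k of (i,j) \<Rightarrow> p i j) \<and> (case k of (i,j) \<Rightarrow> p i j) \<le> (case k of (i,j) \<Rightarrow> q i j)
              \<and> (case k of (i,j) \<Rightarrow> q i j) \<le> b" if "k \<in> ?I" for k
            using that pq uv by (auto) (meson order_trans)+
          show "disjoint_family_on (\<lambda>k. {(case k of (i,j) \<Rightarrow> p i j)<..<(case k of (i,j) \<Rightarrow> q i j)}) ?I"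
            using disjI by (simp add: case_prod_beta')
          have "(\<Sum>k\<in>?I. (case k of (i,j) \<Rightarrow> q i j) - (case k of (i,j) \<Rightarrow> p i j)) = (\<Sum>i<n. \<Sum>j<m i. q i j - p i j)"
            by (subst sum.Sigma) (auto simp: case_prod_beta')
          also have "\<dots> \<le> (\<Sum>i<n. v i - u i)"
            by (intro sum_mono len_i) auto
          finally show "(\<Sum>k\<in>?I. (case k of (i,j) \<Rightarrow> q i j) - (case k of (i,j) \<Rightarrow> p i j)) < \<delta>"
            using len by simp
        qed
        then show ?thesis by (simp add: case_prod_beta')
      qed
      moreover have "(\<Sum>i<n. increment_sum g (x i)) = ennreal (\<Sum>(i,j)\<in>?I. dist (g (p i j)) (g (q i j)))"
        by (subst sum.Sigma[symmetric]) (auto simp: increment_sum_def xi sum_nonneg)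
      ultimately show "0 + (\<Sum>i<n. increment_sum g (x i)) \<le> ennreal \<epsilon>"
        by (simp add: ennreal_leI)
    qed (rule intervals_in_nonempty)
    then show "(\<Sum>i<n. variation g (u i) (v i)) \<le> ennreal \<epsilon>"
      by (simp add: variation_def)
  qed
qed

text \<open>
  On an interval shorter than the \<open>\<delta>\<close> that belongs to \<open>\<epsilon> = 1\<close> the variation is at most 1; finitely many such
  intervals cover \<open>[a, b]\<close>.
\<close>
lemma variation_finite:
  assumes ac: "abs_continuous_on a b g" and "a \<le> b"
  shows "variation g a b < \<infinity>"
proof -
  obtain \<delta> where "\<delta> > 0" and \<delta>: 
    "\<And>(n::nat) u v. (\<And>i. i < n \<Longrightarrow> a \<le> u i \<and> u i \<le> v i \<and> v i \<le> b) \<Longrightarrow>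
        disjoint_family_on (\<lambda>i. {u i<..<v i}) {..<n} \<Longrightarrow> (\<Sum>i<n. v i - u i) < \<delta> \<Longrightarrow>
        (\<Sum>i<n. variation g (u i) (v i)) \<le> ennreal 1"
    by (rule sum_variation_le[OF ac zero_less_one]) blast
  have small: "variation g x y \<le> 1" if "a \<le> x" "x \<le> y" "y \<le> b" "y - x < \<delta>" for x y
    using \<delta>[of 1 "\<lambda>_. x" "\<lambda>_. y"] that by (simp add: disjoint_family_on_def)
  \<comment> \<open>The step \<open>\<delta> / 2\<close> is strictly shorter than \<open>\<delta>\<close>.\<close>
  define c where "c k = min b (a + real k * (\<delta> / 2))" for k
  have "variation g a (c k) < \<infinity>" for k
  proof (induction k)
    case 0
    then show ?case
      using small[of a a] \<open>a \<le> b\<close> \<open>\<delta> > 0\<close> by (auto simp: c_def min_def intro: le_less_trans)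
  next
    case (Suc k)
    have "a \<le> c k" "c k \<le> c (Suc k)" "c (Suc k) \<le> b" "c (Suc k) - c k < \<delta>"
      using \<open>\<delta> > 0\<close> \<open>a \<le> b\<close> by (auto simp: c_def min_def field_simps)
    then have "variation g a (c (Suc k)) \<le> variation g a (c k) + 1"
      using variation_subadditive[of a "c k" "c (Suc k)" g] small[of "c k" "c (Suc k)"]
      by (meson add_left_mono order_trans)
    also have "\<dots> < \<infinity>" using Suc by (simp add: less_top)
    finally show ?case .
  qed
  moreover obtain k where "real k * (\<delta> / 2) > b - a"
    using \<open>\<delta> > 0\<close> reals_Archimedean3[of "\<delta> / 2"] by (metis half_gt_zero)
  then have "c k = b" by (auto simp: c_def)
  ultimately show ?thesis by metis
qed

text \<open>
  Clamping the argument extends a function on \<open>[a, b]\<close> to the whole line by constants.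
  Measures and indefinite integrals can then be taken over the line without boundary terms.
\<close>
lemma abs_continuous_on_compose_clamp:
  assumes "abs_continuous_on a b g" "a \<le> b"
  shows "abs_continuous_on c d (\<lambda>x. g (max a (min b x)))"
  unfolding abs_continuous_on_def
proof (intro allI impI)
  fix \<epsilon> :: real assume "\<epsilon> > 0"
  then obtain \<delta> where "\<delta> > 0" and \<delta>: "\<And>(n::nat) u v. (\<forall>i<n. a \<le> u i \<and> u i \<le> v i \<and> v i \<le> b) \<Longrightarrow>
      disjoint_family_on (\<lambda>i. {u i<..<v i}) {..<n} \<Longrightarrow> (\<Sum>i<n. v i - u i) < \<delta> \<Longrightarrow>
      (\<Sum>i<n. dist (g (u i)) (g (v i))) < \<epsilon>"
    using assms(1) unfolding abs_continuous_on_def by blast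
  let ?h = "\<lambda>x. max a (min b x)"
  have "(\<Sum>i<n. dist (g (?h (u i))) (g (?h (v i)))) < \<epsilon>"
    if "\<forall>i<n. c \<le> u i \<and> u i \<le> v i \<and> v i \<le> d" "disjoint_family_on (\<lambda>i. {u i<..<v i}) {..<n}"
      "(\<Sum>i<n. v i - u i) < \<delta>" for n :: nat and u v
  proof (rule \<delta>)
    show "\<forall>i<n. a \<le> ?h (u i) \<and> ?h (u i) \<le> ?h (v i) \<and> ?h (v i) \<le> b"
      using that(1) \<open>a \<le> b\<close> by (auto simp: min_def max_def)
    show "disjoint_family_on (\<lambda>i. {?h (u i)<..<?h (v i)}) {..<n}"
      using that(2) by (rule disjoint_family_on_shrink) (use \<open>a \<le> b\<close> in \<open>auto simp: min_def max_def split: if_splits\<close>)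
    have "(\<Sum>i<n. ?h (v i) - ?h (u i)) \<le> (\<Sum>i<n. v i - u i)"
      using that(1) \<open>a \<le> b\<close> by (intro sum_mono) (auto simp: min_def max_def)
    then show "(\<Sum>i<n. ?h (v i) - ?h (u i)) < \<delta>"
      using that(3) by linarith
  qed
  then show "\<exists>\<delta>>0. \<forall>(n::nat) u v. (\<forall>i<n. c \<le> u i \<and> u i \<le> v i \<and> v i \<le> d) \<longrightarrow>
      disjoint_family_on (\<lambda>i. {u i<..<v i}) {..<n} \<longrightarrow> (\<Sum>i<n. v i - u i) < \<delta> \<longrightarrow>
      (\<Sum>i<n. dist (g (?h (u i))) (g (?h (v i)))) < \<epsilon>"
    using \<open>\<delta> > 0\<close> by blast
qed

lemma abs_continuous_on_dominated:
  assumes g: "abs_continuous_on a b g" and h: "abs_continuous_on a b h"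
    and dom: "\<And>x y. a \<le> x \<Longrightarrow> x \<le> y \<Longrightarrow> y \<le> b \<Longrightarrow>
        dist (k x) (k y) \<le> A * dist (g x) (g y) + B * dist (h x) (h y)"
    and "A \<ge> 0" "B \<ge> 0"
  shows "abs_continuous_on a b k"
  unfolding abs_continuous_on_def
proof (intro allI impI)
  fix \<epsilon> :: real assume "\<epsilon> > 0"
  define \<eta> where "\<eta> = \<epsilon> / (A + B + 1)"
  have "\<eta> > 0" using \<open>\<epsilon> > 0\<close> assms by (simp add: \<eta>_def add_nonneg_pos)
  obtain \<delta>1 where "\<delta>1 > 0" and \<delta>1: "\<And>(n::nat) u v. (\<forall>i<n. a \<le> u i \<and> u i \<le> v i \<and> v i \<le> b) \<Longrightarrow>
      disjoint_family_on (\<lambda>i. {u i<..<v i}) {..<n} \<Longrightarrow> (\<Sum>i<n. v i - u i) < \<delta>1 \<Longrightarrow>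
      (\<Sum>i<n. dist (g (u i)) (g (v i))) < \<eta>"
    using g \<open>\<eta> > 0\<close> unfolding abs_continuous_on_def by blast
  obtain \<delta>2 where "\<delta>2 > 0" and \<delta>2: "\<And>(n::nat) u v. (\<forall>i<n. a \<le> u i \<and> u i \<le> v i \<and> v i \<le> b) \<Longrightarrow>
      disjoint_family_on (\<lambda>i. {u i<..<v i}) {..<n} \<Longrightarrow> (\<Sum>i<n. v i - u i) < \<delta>2 \<Longrightarrow>
      (\<Sum>i<n. dist (h (u i)) (h (v i))) < \<eta>"
    using h \<open>\<eta> > 0\<close> unfolding abs_continuous_on_def by blast
  have "(\<Sum>i<n. dist (k (u i)) (k (v i))) < \<epsilon>"
    if *: "\<forall>i<n. a \<le> u i \<and> u i \<le> v i \<and> v i \<le> b" "disjoint_family_on (\<lambda>i. {u i<..<v i}) {..<n}"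
      "(\<Sum>i<n. v i - u i) < min \<delta>1 \<delta>2" for n :: nat and u v
  proof -
    have "(\<Sum>i<n. dist (k (u i)) (k (v i))) \<le>
        (\<Sum>i<n. A * dist (g (u i)) (g (v i)) + B * dist (h (u i)) (h (v i)))"
      using * by (intro sum_mono dom) auto
    also have "\<dots> = A * (\<Sum>i<n. dist (g (u i)) (g (v i))) + B * (\<Sum>i<n. dist (h (u i)) (h (v i)))"
      by (simp add: sum.distrib sum_distrib_left)
    also have "\<dots> \<le> A * \<eta> + B * \<eta>"
      using \<delta>1[of n u v] \<delta>2[of n u v] * assms by (intro add_mono mult_left_mono) auto
    also have "\<dots> < (A + B + 1) * \<eta>"
      using \<open>\<eta> > 0\<close> by (simp add: algebra_simps)
    also have "\<dots> = \<epsilon>"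
      using assms by (simp add: \<eta>_def add_nonneg_pos)
    finally show ?thesis .
  qed
  then show "\<exists>\<delta>>0. \<forall>(n::nat) u v. (\<forall>i<n. a \<le> u i \<and> u i \<le> v i \<and> v i \<le> b) \<longrightarrow>
      disjoint_family_on (\<lambda>i. {u i<..<v i}) {..<n} \<longrightarrow> (\<Sum>i<n. v i - u i) < \<delta> \<longrightarrow>
      (\<Sum>i<n. dist (k (u i)) (k (v i))) < \<epsilon>"
    using \<open>\<delta>1 > 0\<close> \<open>\<delta>2 > 0\<close> by (intro exI[of _ "min \<delta>1 \<delta>2"]) auto
qed

lemma abs_continuous_on_compose_nonexpansive:
  assumes "abs_continuous_on a b g" "\<And>x y. dist (h x) (h y) \<le> dist x y"
  shows "abs_continuous_on a b (\<lambda>x. h (g x))"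
  by (rule abs_continuous_on_dominated[OF assms(1) assms(1), of _ 1 0]) (use assms(2) in auto)

lemma abs_continuous_on_id: "abs_continuous_on a b (\<lambda>x::real. x)"
  unfolding abs_continuous_on_def
proof (intro allI impI)
  fix \<epsilon> :: real assume "\<epsilon> > 0"
  have "(\<Sum>i<n. dist (u i) (v i)) = (\<Sum>i<n. v i - u i)"
    if "\<forall>i<n. a \<le> u i \<and> u i \<le> v i \<and> v i \<le> b" for n :: nat and u v :: "nat \<Rightarrow> real"
    using that by (intro sum.cong) (auto simp: dist_real_def)
  then show "\<exists>\<delta>>0. \<forall>(n::nat) u v. (\<forall>i<n. a \<le> u i \<and> u i \<le> v i \<and> v i \<le> b) \<longrightarrow>
      disjoint_family_on (\<lambda>i. {u i<..<v i}) {..<n} \<longrightarrow> (\<Sum>i<n. v i - u i) < \<delta> \<longrightarrow>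
      (\<Sum>i<n. dist (u i) (v i)) < \<epsilon>"
    using \<open>\<epsilon> > 0\<close> by (intro exI[of _ \<epsilon>]) auto
qed

lemma abs_continuous_on_imp_continuous_on:
  assumes "abs_continuous_on a b g"
  shows "continuous_on {a..b} g"
  unfolding continuous_on_iff
proof (intro ballI allI impI)
  fix x and \<epsilon> :: real assume x: "x \<in> {a..b}" and "\<epsilon> > 0"
  obtain \<delta> where "\<delta> > 0" and \<delta>: "\<And>(n::nat) u v. (\<forall>i<n. a \<le> u i \<and> u i \<le> v i \<and> v i \<le> b) \<Longrightarrow>
      disjoint_family_on (\<lambda>i. {u i<..<v i}) {..<n} \<Longrightarrow> (\<Sum>i<n. v i - u i) < \<delta> \<Longrightarrow>
      (\<Sum>i<n. dist (g (u i)) (g (v i))) < \<epsilon>"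
    using assms \<open>\<epsilon> > 0\<close> unfolding abs_continuous_on_def by blast
  have "dist (g y) (g x) < \<epsilon>" if "y \<in> {a..b}" "dist y x < \<delta>" for y
  proof (cases "x \<le> y")
    case True
    then show ?thesis
      using \<delta>[of 1 "\<lambda>_. x" "\<lambda>_. y"] that x
      by (simp add: disjoint_family_on_def dist_real_def dist_commute)
  next
    case False
    then show ?thesis
      using \<delta>[of 1 "\<lambda>_. y" "\<lambda>_. x"] that x
      by (simp add: disjoint_family_on_def dist_real_def dist_commute)
  qed
  then show "\<exists>d>0. \<forall>x'\<in>{a..b}. dist x' x < d \<longrightarrow> dist (g x') (g x) < \<epsilon>"
    using \<open>\<delta> > 0\<close> by blast
qed

text \<open>
  The total variation up to \<open>x\<close>, extended by constants, increases at least as fast as the function itself moves. Hence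
  \<open>V\<close> and, for real \<open>g\<close>, also \<open>V - g\<close> are monotone, which is the Jordan decomposition.
\<close>
lemma monotone_abs_continuous_majorant:
  assumes ac: "abs_continuous_on a b g" and "a \<le> b"
  obtains V :: "real \<Rightarrow> real" where "mono V" "\<And>c d. abs_continuous_on c d V"
    "\<And>x y. a \<le> x \<Longrightarrow> x \<le> y \<Longrightarrow> y \<le> b \<Longrightarrow> dist (g x) (g y) \<le> V y - V x"
    "\<And>x. V x = V (max a (min b x))"
proof -
  define W where "W x = enn2real (variation g a x)" for x
  have fin: "variation g a x < \<infinity>" if "x \<le> b" for x
    using variation_finite[OF ac \<open>a \<le> b\<close>] variation_mono[OF that] by (meson le_less_trans)
  have W: "variation g a x = ennreal (W x)" if "x \<le> b" for x
    using fin[OF that] by (simp add: W_def)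
  have W_nonneg: "0 \<le> W x" for x by (simp add: W_def)
  have W_dist: "dist (g x) (g y) \<le> W y - W x" if "a \<le> x" "x \<le> y" "y \<le> b" for x y
  proof -
    have "ennreal (W x + dist (g x) (g y)) \<le> ennreal (W y)"
      using variation_add_dist_le[OF that(1,2), of g] W[of x] W[of y] that
      by (simp add: W_nonneg)
    then have "W x + dist (g x) (g y) \<le> W y" 
      using W_nonneg by (subst (asm) ennreal_le_iff) auto
    then show ?thesis by simp
  qed
  have W_mono: "W x \<le> W y" if "a \<le> x" "x \<le> y" "y \<le> b" for x y
    using W_dist[OF that] by (smt (verit) zero_le_dist)
  have "abs_continuous_on a b W"
    unfolding abs_continuous_on_def
  proof (intro allI impI)
    fix \<epsilon> :: real assume "\<epsilon> > 0"
    obtain \<delta> where "\<delta> > 0" and \<delta>: 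
      "\<And>(n::nat) u v. (\<And>i. i < n \<Longrightarrow> a \<le> u i \<and> u i \<le> v i \<and> v i \<le> b) \<Longrightarrow>
        disjoint_family_on (\<lambda>i. {u i<..<v i}) {..<n} \<Longrightarrow> (\<Sum>i<n. v i - u i) < \<delta> \<Longrightarrow>
        (\<Sum>i<n. variation g (u i) (v i)) \<le> ennreal (\<epsilon> / 2)"
      by (rule sum_variation_le[OF ac half_gt_zero[OF \<open>\<epsilon> > 0\<close>]]) blast
    have "(\<Sum>i<n. dist (W (u i)) (W (v i))) < \<epsilon>"
      if *: "\<forall>i<n. a \<le> u i \<and> u i \<le> v i \<and> v i \<le> b" "disjoint_family_on (\<lambda>i. {u i<..<v i}) {..<n}"
        "(\<Sum>i<n. v i - u i) < \<delta>" for n :: nat and u v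
    proof -
      have "ennreal (dist (W (u i)) (W (v i))) \<le> variation g (u i) (v i)" if "i < n" for i
      proof -
        have i: "a \<le> u i" "u i \<le> v i" "v i \<le> b" using * that by auto
        have "ennreal (W (u i)) + ennreal (W (v i) - W (u i)) = ennreal (W (v i))"
          using W_mono[OF i] W_nonneg by (simp flip: ennreal_plus)
        also have "\<dots> \<le> ennreal (W (u i)) + variation g (u i) (v i)"
          using variation_subadditive[OF i(1,2), of g] W[of "u i"] W[of "v i"] i by simp
        finally have "ennreal (W (v i) - W (u i)) \<le> variation g (u i) (v i)"
          by (simp add: ennreal_add_left_cancel_le)
        then show ?thesis using W_mono[OF i] by (simp add: dist_real_def)
      qed
      then have "(\<Sum>i<n. ennreal (dist (W (u i)) (W (v i)))) \<le> (\<Sum>i<n. variation g (u i) (v i))"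
        by (intro sum_mono) auto
      also have "\<dots> \<le> ennreal (\<epsilon> / 2)"
        using * by (intro \<delta>) auto
      finally have "ennreal (\<Sum>i<n. dist (W (u i)) (W (v i))) \<le> ennreal (\<epsilon> / 2)"
        by (simp add: sum_ennreal)
      then have "(\<Sum>i<n. dist (W (u i)) (W (v i))) \<le> \<epsilon> / 2"
        using \<open>\<epsilon> > 0\<close> by (subst (asm) ennreal_le_iff) auto
      then show ?thesis using \<open>\<epsilon> > 0\<close> by simp
    qed
    then show "\<exists>\<delta>>0. \<forall>(n::nat) u v. (\<forall>i<n. a \<le> u i \<and> u i \<le> v i \<and> v i \<le> b) \<longrightarrow>
      disjoint_family_on (\<lambda>i. {u i<..<v i}) {..<n} \<longrightarrow> (\<Sum>i<n. v i - u i) < \<delta> \<longrightarrow>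
      (\<Sum>i<n. dist (W (u i)) (W (v i))) < \<epsilon>"
      using \<open>\<delta> > 0\<close> by blast
  qed
  then have "abs_continuous_on c d (\<lambda>x. W (max a (min b x)))" for c d
    using \<open>a \<le> b\<close> by (rule abs_continuous_on_compose_clamp)
  moreover have "mono (\<lambda>x. W (max a (min b x)))"
    using \<open>a \<le> b\<close> by (auto intro!: monoI W_mono simp: min_def max_def)
  moreover have "dist (g x) (g y) \<le> W (max a (min b y)) - W (max a (min b x))"
    if "a \<le> x" "x \<le> y" "y \<le> b" for x y
    using W_dist[OF that] that by (auto simp: min_def max_def)
  moreover have "W (max a (min b x)) = W (max a (min b (max a (min b x))))" for x
    using \<open>a \<le> b\<close> by (auto simp: min_def max_def)
  ultimately show ?thesis using that by blast
qed

section \<open>The fundamental theorem of calculus for absolutely continuous functions\<close>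

lemma emeasure_interval_measure_abs_continuous:
  fixes P :: "real \<Rightarrow> real"
  assumes "mono P" and ac: "\<And>c d. abs_continuous_on c d P" and uv: "u \<le> v"
  shows "emeasure (interval_measure P) {u..v} = ennreal (P v - P u)"
proof (rule emeasure_interval_measure_Icc[OF uv])
  show "continuous_on UNIV P"
  proof (intro continuous_at_imp_continuous_on ballI)
    fix x :: real
    show "isCont P x"
      by (rule continuous_on_interior[OF abs_continuous_on_imp_continuous_on[OF ac, of "x - 1" "x + 1"]]) simp
  qed
qed (use \<open>mono P\<close> in \<open>auto simp: mono_def\<close>)

text \<open>
  A null set inside an interval is covered by countably many nonoverlapping closed intervals of
  total length below \<open>\<delta>\<close>. Every finite subfamily has measure at most \<open>\<epsilon>\<close>, because the measure of an interval is the
  increment of \<open>P\<close>; continuity of the measure from below passes to the whole covering.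
\<close>
lemma interval_measure_absolutely_continuous:
  fixes P :: "real \<Rightarrow> real"
  assumes "mono P" and ac: "\<And>c d. abs_continuous_on c d P"
  shows "absolutely_continuous lborel (interval_measure P)"
proof -
  let ?\<mu> = "interval_measure P"
  note Icc = emeasure_interval_measure_abs_continuous[OF assms]
  have bdd: "emeasure ?\<mu> S = 0" if S: "S \<in> null_sets lborel" "S \<subseteq> {a..b}" for S a b
  proof -
    have eps: "emeasure ?\<mu> S \<le> 0 + ennreal \<epsilon>" if "\<epsilon> > 0" for \<epsilon>
    proof -
      obtain \<delta> where "\<delta> > 0" and \<delta>: 
        "\<And>(I :: real set set) u v. finite I \<Longrightarrow> (\<And>i. i \<in> I \<Longrightarrow> a \<le> u i \<and> u i \<le> v i \<and> v i \<le> b) \<Longrightarrow>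
            disjoint_family_on (\<lambda>i. {u i<..<v i}) I \<Longrightarrow> (\<Sum>i\<in>I. v i - u i) < \<delta> \<Longrightarrow>
            (\<Sum>i\<in>I. dist (P (u i)) (P (v i))) < \<epsilon>"
        by (rule abs_continuous_on_finite[OF ac \<open>\<epsilon> > 0\<close>, where 'i = "real set"]) blast
      have S': "S \<in> lmeasurable" "measure lebesgue S = 0"
        using S(1) by (auto simp: null_sets_def fmeasurable_def measure_def)
      obtain D where D: "countable D"
        "\<And>K. K \<in> D \<Longrightarrow> K \<subseteq> cbox a b \<and> K \<noteq> {} \<and> (\<exists>c d. K = cbox c d)"
        "pairwise (\<lambda>A B. interior A \<inter> interior B = {}) D"
        "S \<subseteq> \<Union>D" "\<Union>D \<in> lmeasurable" "measure lebesgue (\<Union>D) \<le> measure lebesgue S + \<delta> / 2"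
        by (rule measurable_outer_intervals_bounded[of S a b "\<delta> / 2"])
           (use S' S(2) \<open>\<delta> > 0\<close> in auto)
      define u v where "u K = Inf K" and "v K = Sup K" for K :: "real set"
      have K: "K = {u K..v K} \<and> u K \<le> v K \<and> a \<le> u K \<and> v K \<le> b" if "K \<in> D" for K
        using D(2)[OF that] by (auto simp: u_def v_def)
      have Ksets: "K \<in> sets ?\<mu>" if "K \<in> D" for K
      proof -
        have "K = {u K..v K}" using K that by blast
        also have "\<dots> \<in> sets ?\<mu>" by simp
        finally show ?thesis .
      qed
      have disj: "disjoint_family_on (\<lambda>K. {u K<..<v K}) D"
        unfolding disjoint_family_on_def
      proof (intro ballI impI)
        fix A B assume "A \<in> D" "B \<in> D" "A \<noteq> B"
        then have "interior A \<inter> interior B = {}" using D(3) by (auto simp: pairwise_def)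
        moreover have "interior A = {u A<..<v A}" "interior B = {u B<..<v B}"
          using K[OF \<open>A \<in> D\<close>] K[OF \<open>B \<in> D\<close>] by (metis interior_atLeastAtMost_real)+
        ultimately show "{u A<..<v A} \<inter> {u B<..<v B} = {}" by simp
      qed
      have fin: "emeasure ?\<mu> (\<Union>F) \<le> ennreal \<epsilon>" if F: "finite F" "F \<subseteq> D" for F
      proof -
        have KF: "K = {u K..v K} \<and> u K \<le> v K \<and> a \<le> u K \<and> v K \<le> b" if "K \<in> F" for K
          using K F that by blast
        have "(\<Sum>K\<in>F. v K - u K) = (\<Sum>K\<in>F. measure lebesgue {u K<..<v K})"
          using KF by (intro sum.cong) auto
        also have "\<dots> = measure lebesgue (\<Union>K\<in>F. {u K<..<v K})"
          using disj F KF by (intro measure_finite_Union[symmetric])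
            (auto intro: disjoint_family_on_mono simp: ennreal_neq_top)
        also have "\<dots> \<le> measure lebesgue (\<Union>D)"
        proof (rule measure_mono_fmeasurable)
          show "(\<Union>K\<in>F. {u K<..<v K}) \<subseteq> \<Union>D"
          proof
            fix x assume "x \<in> (\<Union>K\<in>F. {u K<..<v K})"
            then obtain K where "K \<in> F" "x \<in> {u K..v K}" by force
            then show "x \<in> \<Union>D" using KF[of K] F by blast
          qed
        qed (use F D(5) in auto)
        also have "\<dots> < \<delta>" using D(6) S' \<open>\<delta> > 0\<close> by simp
        finally have len: "(\<Sum>K\<in>F. v K - u K) < \<delta>" .
        have "emeasure ?\<mu> (\<Union>F) = emeasure ?\<mu> (\<Union>K\<in>F. {u K..v K})"
          using KF by (metis (no_types, lifting) SUP_cong image_ident)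
        also have "\<dots> \<le> (\<Sum>K\<in>F. emeasure ?\<mu> {u K..v K})"
          using F by (intro emeasure_subadditive_finite) auto
        also have "\<dots> = (\<Sum>K\<in>F. ennreal (dist (P (u K)) (P (v K))))"
        proof (rule sum.cong)
          fix K assume "K \<in> F"
          then have "u K \<le> v K" using KF by blast
          then show "emeasure ?\<mu> {u K..v K} = ennreal (dist (P (u K)) (P (v K)))"
            using \<open>mono P\<close> by (simp add: Icc dist_real_def mono_def)
        qed simp
        also have "\<dots> = ennreal (\<Sum>K\<in>F. dist (P (u K)) (P (v K)))" by (simp add: sum_ennreal)
        also have "\<dots> \<le> ennreal \<epsilon>"
          using \<delta>[OF F(1), of u v] KF disjoint_family_on_mono[OF F(2) disj] len
          by (intro ennreal_leI less_imp_le) blast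
        finally show ?thesis .
      qed
      have "emeasure ?\<mu> S \<le> emeasure ?\<mu> (\<Union>D)"
        using D(1) Ksets by (intro emeasure_mono D(4) sets.countable_Union) auto
      also have "\<dots> \<le> ennreal \<epsilon>"
      proof (cases "D = {}")
        case False
        let ?B = "\<lambda>n::nat. \<Union>i\<in>{..n}. from_nat_into D i"
        have inD: "from_nat_into D i \<in> D" for i using False by (rule from_nat_into)
        have "?B n \<in> sets ?\<mu>" for n
          using Ksets[OF inD] by (intro sets.finite_UN) auto
        moreover have "incseq ?B" by (intro incseq_SucI UN_mono) auto
        ultimately have "(SUP n. emeasure ?\<mu> (?B n)) = emeasure ?\<mu> (\<Union>n. ?B n)"
          by (intro SUP_emeasure_incseq) auto
        moreover have "(\<Union>n. ?B n) = (\<Union>i. from_nat_into D i)" by blast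
        moreover have "\<dots> = \<Union>D"
          using range_from_nat_into[OF False D(1)] by simp
        moreover have "emeasure ?\<mu> (?B n) \<le> ennreal \<epsilon>" for n
          using fin[of "from_nat_into D ` {..n}"] inD by (simp add: image_subset_iff)
        then have "(SUP n. emeasure ?\<mu> (?B n)) \<le> ennreal \<epsilon>"
          by (rule SUP_least)
        ultimately show ?thesis by simp
      qed simp
      finally show ?thesis by simp
    qed
    have "emeasure ?\<mu> S \<le> 0" by (rule ennreal_le_epsilon, rule eps)
    then show ?thesis by simp
  qed
  show ?thesis
    unfolding absolutely_continuous_def
  proof
    fix S :: "real set" assume S: "S \<in> null_sets lborel"
    then have Sb: "S \<in> sets borel" by auto
    have "S \<inter> {- real n..real n} \<in> null_sets ?\<mu>" for n
    proof (rule null_setsI)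
      show "emeasure ?\<mu> (S \<inter> {- real n..real n}) = 0"
        by (rule bdd[OF null_set_Int2[OF S], where a = "- real n" and b = "real n"]) auto
    qed (use Sb in auto)
    then have "(\<Union>n. S \<inter> {- real n..real n}) \<in> null_sets ?\<mu>" by (rule null_sets_UN)
    moreover have "(\<Union>n. S \<inter> {- real n..real n}) = S"
    proof safe
      fix x assume "x \<in> S"
      obtain n where "\<bar>x\<bar> \<le> real n" using real_arch_simple by blast
      then show "x \<in> (\<Union>n. S \<inter> {- real n..real n})" using \<open>x \<in> S\<close> by (auto intro!: exI[of _ n])
    qed
    ultimately show "S \<in> null_sets ?\<mu>" by simp
  qed
qed

lemma monotone_abs_continuous_density:
  fixes P :: "real \<Rightarrow> real"
  assumes "mono P" and ac: "\<And>c d. abs_continuous_on c d P"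
  obtains p where "p \<in> borel_measurable borel" "\<And>x. 0 \<le> p x"
    "\<And>a b. a \<le> b \<Longrightarrow> (p has_integral (P b - P a)) {a..b}"
proof -
  let ?\<mu> = "interval_measure P"
  note Icc = emeasure_interval_measure_abs_continuous[OF assms]
  obtain f where f[measurable]: "f \<in> borel_measurable lborel" and dens: "density lborel f = ?\<mu>"
    using sigma_finite_measure.Radon_Nikodym[OF sigma_finite_lborel interval_measure_absolutely_continuous[OF assms]] by auto
  have int: "(\<integral>\<^sup>+x. f x * indicator {a..b} x \<partial>lborel) = ennreal (P b - P a)" if "a \<le> b" for a b
    using Icc[OF that] by (simp add: dens[symmetric] emeasure_density)
  define p where "p x = enn2real (f x)" for x
  have [measurable]: "p \<in> borel_measurable borel" unfolding p_def by measurable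
  have "(p has_integral (P b - P a)) {a..b}" if "a \<le> b" for a b
  proof -
    have "(\<integral>\<^sup>+x. f x * indicator {a..b} x \<partial>lborel) \<noteq> \<infinity>" using int[OF that] by simp
    then have "AE x in lborel. f x * indicator {a..b} x \<noteq> \<infinity>"
      by (rule nn_integral_PInf_AE[rotated]) measurable
    then have "AE x in lborel. ennreal (p x * indicator {a..b} x) = f x * indicator {a..b} x"
      by eventually_elim (auto simp: p_def less_top indicator_def split: if_splits)
    then have 1: "(\<integral>\<^sup>+x. ennreal (p x * indicator {a..b} x) \<partial>lborel) = ennreal (P b - P a)"
      unfolding int[OF that, symmetric] by (rule nn_integral_cong_AE)
    have 2: "P a \<le> P b" using \<open>mono P\<close> that by (simp add: mono_def)
    have "((\<lambda>x. p x * indicator {a..b} x) has_integral (P b - P a)) UNIV"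
    proof (rule nn_integral_has_integral[OF _ _ 1])
      show "(\<lambda>x. p x * indicator {a..b} x) \<in> borel_measurable borel" by measurable
    qed (use 2 in \<open>auto simp: p_def\<close>)
    moreover have "(\<lambda>x. p x * indicator {a..b} x) = (\<lambda>x. if x \<in> {a..b} then p x else 0)"
      by (auto simp: indicator_def)
    ultimately show ?thesis
      by (simp only: has_integral_restrict_UNIV)
  qed
  note pint = this
  have "0 \<le> p x" for x by (simp add: p_def)
  then show ?thesis
    by (rule that[OF \<open>p \<in> borel_measurable borel\<close> _ pint])
qed

text \<open>
  This is the one-dimensional case of the fact that averages over the cubes with lowest vertex \<open>x\<close> converge to the value at \<open>x\<close> for
  almost every \<open>x\<close>.
\<close>
lemma right_derivative_ae:
  fixes p P :: "real \<Rightarrow> real"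
  assumes int: "\<And>a b. a \<le> b \<Longrightarrow> (p has_integral (P b - P a)) {a..b}"
  obtains N where "negligible N"
    "\<And>x e. x \<notin> N \<Longrightarrow> e > 0 \<Longrightarrow> \<exists>d>0. \<forall>h. 0 < h \<and> h < d \<longrightarrow> \<bar>(P (x + h) - P x) / h - p x\<bar> < e"
proof -
  have "p integrable_on cbox a b" for a b
    using int[of a b] by (cases "a \<le> b") (auto simp: integrable_on_def)
  then obtain N where N: "negligible N" "\<And>x e. \<lbrakk>x \<notin> N; 0 < e\<rbrakk> \<Longrightarrow>
      \<exists>d>0. \<forall>h. 0 < h \<and> h < d \<longrightarrow>
         norm (integral (cbox x (x + h *\<^sub>R One)) p /\<^sub>R h ^ DIM(real) - p x) < e"
    by (rule integrable_ccontinuous_explicit) blast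
  have "integral (cbox x (x + h *\<^sub>R One)) p = P (x + h) - P x" if "h > 0" for x h
    using integral_unique[OF int[of x "x + h"]] that by simp
  then have "\<exists>d>0. \<forall>h. 0 < h \<and> h < d \<longrightarrow> \<bar>(P (x + h) - P x) / h - p x\<bar> < e" if "x \<notin> N" "e > 0" for x e
    using N(2)[OF that] by (auto simp: divide_inverse mult.commute)
  with N(1) that show ?thesis by blast
qed

text \<open>
  The left difference quotients are right difference quotients of the reflected function.
\<close>
lemma indefinite_integral_derivative_ae:
  fixes p P :: "real \<Rightarrow> real"
  assumes int: "\<And>a b. a \<le> b \<Longrightarrow> (p has_integral (P b - P a)) {a..b}"
  obtains N where "negligible N" "\<And>x. x \<notin> N \<Longrightarrow> (P has_real_derivative p x) (at x)"
proof -
  obtain N1 where N1: "negligible N1"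
    "\<And>x e. x \<notin> N1 \<Longrightarrow> e > 0 \<Longrightarrow> \<exists>d>0. \<forall>h. 0 < h \<and> h < d \<longrightarrow> \<bar>(P (x + h) - P x) / h - p x\<bar> < e"
    using right_derivative_ae[OF int] by blast
  have "((\<lambda>x. p (- x)) has_integral (- P (- b) - (- P (- a)))) {a..b}" if "a \<le> b" for a b
    using has_integral_reflect_lemma_real[OF int[of "- b" "- a"]] that by simp
  then obtain N2 where N2: "negligible N2"
    "\<And>x e. x \<notin> N2 \<Longrightarrow> e > 0 \<Longrightarrow>
        \<exists>d>0. \<forall>h. 0 < h \<and> h < d \<longrightarrow> \<bar>(- P (- (x + h)) - (- P (- x))) / h - p (- x)\<bar> < e"
    using right_derivative_ae[of "\<lambda>x. p (- x)" "\<lambda>x. - P (- x)"] by blast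
  have "negligible (uminus ` N2)"
    by (rule negligible_differentiable_image_negligible[OF order_refl N2(1)])
       (auto simp: differentiable_on_def intro!: derivative_intros)
  then have "negligible (N1 \<union> uminus ` N2)"
    using N1(1) by (simp add: negligible_Un)
  moreover have "(P has_real_derivative p x) (at x)" if "x \<notin> N1 \<union> uminus ` N2" for x
    unfolding DERIV_def LIM_eq
  proof (intro allI impI)
    fix e :: real assume "e > 0"
    have x: "x \<notin> N1" "- x \<notin> N2"
      using that by (auto simp: image_iff)
    obtain d1 where "d1 > 0" and d1: "\<And>h. 0 < h \<and> h < d1 \<Longrightarrow> \<bar>(P (x + h) - P x) / h - p x\<bar> < e"
      using N1(2)[OF x(1) \<open>e > 0\<close>] by blast
    obtain d2 where "d2 > 0" and d2: "\<And>h. 0 < h \<and> h < d2 \<Longrightarrow> \<bar>(- P (x - h) + P x) / h - p x\<bar> < e"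
      using N2(2)[OF x(2) \<open>e > 0\<close>] by auto
    have "\<bar>(P (x + h) - P x) / h - p x\<bar> < e" if "h \<noteq> 0" "\<bar>h\<bar> < min d1 d2" for h
    proof (cases "h > 0")
      case False
      then show ?thesis using d2[of "- h"] that by (simp add: minus_divide_right[symmetric] minus_divide_left)
    qed (use d1[of h] that in auto)
    then show "\<exists>s>0. \<forall>h. h \<noteq> 0 \<and> norm (h - 0) < s \<longrightarrow> norm ((P (x + h) - P x) / h - p x) < e"
      using \<open>d1 > 0\<close> \<open>d2 > 0\<close> by (intro exI[of _ "min d1 d2"]) auto
  qed
  ultimately show ?thesis using that by blast
qed

text \<open>
  Both \<open>V\<close> and \<open>V - g\<close> are monotone and absolutely continuous, so both have densities; the
  difference of the densities is the derivative of \<open>g\<close>.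
\<close>
lemma abs_continuous_ftc_real:
  fixes g :: "real \<Rightarrow> real"
  assumes ac: "abs_continuous_on a b g" and "a \<le> b"
  obtains g' N where "negligible N" "\<And>x. x \<in> {a<..<b} - N \<Longrightarrow> (g has_real_derivative g' x) (at x)"
    "(g' has_integral (g b - g a)) {a..b}"
proof -
  obtain V :: "real \<Rightarrow> real" where V: "mono V" "\<And>c d. abs_continuous_on c d V"
    "\<And>x y. a \<le> x \<Longrightarrow> x \<le> y \<Longrightarrow> y \<le> b \<Longrightarrow> dist (g x) (g y) \<le> V y - V x"
    "\<And>x. V x = V (max a (min b x))"
    using monotone_abs_continuous_majorant[OF ac \<open>a \<le> b\<close>] by metis
  define G where "G x = g (max a (min b x))" for x
  have G_ac: "abs_continuous_on c d G" for c d
    using abs_continuous_on_compose_clamp[OF ac \<open>a \<le> b\<close>] unfolding G_def .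
  have G_eq: "G x = g x" if "a \<le> x" "x \<le> b" for x
    using that by (simp add: G_def)
  have "mono (\<lambda>x. V x - G x)"
  proof (rule monoI)
    fix x y :: real assume "x \<le> y"
    have "dist (G x) (G y) \<le> V (max a (min b y)) - V (max a (min b x))"
      unfolding G_def using \<open>x \<le> y\<close> \<open>a \<le> b\<close> by (intro V(3)) auto
    then show "V x - G x \<le> V y - G y"
      unfolding V(4)[of x] V(4)[of y] by (auto simp: dist_real_def abs_le_iff)
  qed
  moreover have "abs_continuous_on c d (\<lambda>x. V x - G x)" for c d
  proof (rule abs_continuous_on_dominated[OF V(2) G_ac])
    fix x y
    show "dist (V x - G x) (V y - G y) \<le> 1 * dist (V x) (V y) + 1 * dist (G x) (G y)"
      by (auto simp: dist_real_def)
  qed auto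
  ultimately obtain q where q: "\<And>a b. a \<le> b \<Longrightarrow> (q has_integral ((V b - G b) - (V a - G a))) {a..b}"
    using monotone_abs_continuous_density[of "\<lambda>x. V x - G x"] by metis
  obtain p where p: "\<And>a b. a \<le> b \<Longrightarrow> (p has_integral (V b - V a)) {a..b}"
    using monotone_abs_continuous_density[OF V(1,2)] by metis
  have r: "((\<lambda>x. p x - q x) has_integral (G d - G c)) {c..d}" if "c \<le> d" for c d
    using has_integral_diff[OF p[OF that] q[OF that]] by (simp add: algebra_simps)
  then obtain N where N: "negligible N" "\<And>x. x \<notin> N \<Longrightarrow> (G has_real_derivative p x - q x) (at x)"
    using indefinite_integral_derivative_ae[OF r] by blast
  show ?thesis
  proof (rule that[OF N(1)])
    fix x assume x: "x \<in> {a<..<b} - N"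
    show "(g has_real_derivative p x - q x) (at x)"
      by (rule has_field_derivative_transform_within_open[OF N(2), of x "{a<..<b}"]) (use x G_eq in auto)
  next
    show "((\<lambda>x. p x - q x) has_integral (g b - g a)) {a..b}"
      using r[OF \<open>a \<le> b\<close>] G_eq \<open>a \<le> b\<close> by simp
  qed
qed

lemma has_vector_derivative_complex_iff:
  "(f has_vector_derivative f') (at x) \<longleftrightarrow>
     ((\<lambda>x. Re (f x)) has_real_derivative Re f') (at x) \<and> ((\<lambda>x. Im (f x)) has_real_derivative Im f') (at x)"
  by (simp add: has_vector_derivative_def has_field_derivative_def has_derivative_componentwise_within[of f]
      Basis_complex_def inner_complex_def mult.commute[of "Re f'"] mult.commute[of "Im f'"] mult_commute_abs)

lemma has_integral_complex_iff:
  "(f has_integral y) S \<longleftrightarrow> ((\<lambda>x. Re (f x)) has_integral Re y) S \<and> ((\<lambda>x. Im (f x)) has_integral Im y) S"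
  by (subst has_integral_componentwise_iff) (simp add: Basis_complex_def inner_complex_def)

theorem abs_continuous_ftc:
  fixes g :: "real \<Rightarrow> complex"
  assumes ac: "abs_continuous_on a b g" and "a \<le> b"
  obtains g' N where "negligible N" "\<And>x. x \<in> {a<..<b} - N \<Longrightarrow> (g has_vector_derivative g' x) (at x)"
    "(g' has_integral (g b - g a)) {a..b}"
proof -
  have "abs_continuous_on a b (\<lambda>x. Re (g x))" "abs_continuous_on a b (\<lambda>x. Im (g x))"
    by (rule abs_continuous_on_compose_nonexpansive[OF ac];
        metis dist_norm abs_Re_le_cmod abs_Im_le_cmod minus_complex.simps real_norm_def)+
  then obtain r N1 s N2 where 
    r: "negligible N1" "\<And>x. x \<in> {a<..<b} - N1 \<Longrightarrow> ((\<lambda>x. Re (g x)) has_real_derivative r x) (at x)"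
      "(r has_integral (Re (g b) - Re (g a))) {a..b}" and
    s: "negligible N2" "\<And>x. x \<in> {a<..<b} - N2 \<Longrightarrow> ((\<lambda>x. Im (g x)) has_real_derivative s x) (at x)"
      "(s has_integral (Im (g b) - Im (g a))) {a..b}"
    using abs_continuous_ftc_real[OF _ \<open>a \<le> b\<close>] by metis
  show ?thesis
  proof (rule that[of "N1 \<union> N2" "\<lambda>x. Complex (r x) (s x)"])
    show "negligible (N1 \<union> N2)" using r s by (simp add: negligible_Un)
    show "(g has_vector_derivative Complex (r x) (s x)) (at x)" if "x \<in> {a<..<b} - (N1 \<union> N2)" for x
      using that r s by (simp add: has_vector_derivative_complex_iff)
    show "((\<lambda>x. Complex (r x) (s x)) has_integral (g b - g a)) {a..b}"
      using r s by (simp add: has_integral_complex_iff)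
  qed
qed

text \<open>
  The product \<open>k g\<close> is again absolutely continuous, so its derivative, which the product rule
  gives almost everywhere, integrates to its increment.
\<close>
theorem abs_continuous_integration_by_parts:
  fixes g :: "real \<Rightarrow> complex" and k k' :: "real \<Rightarrow> real"
  assumes ac: "abs_continuous_on a b g" and "a \<le> b"
    and k: "\<And>t. (k has_real_derivative k' t) (at t)" and k': "continuous_on {a..b} k'"
    and N: "negligible N" "\<And>t. t \<in> {a<..<b} - N \<Longrightarrow> (g has_vector_derivative g' t) (at t)"
  shows "((\<lambda>t. k' t *\<^sub>R g t + k t *\<^sub>R g' t) has_integral (k b *\<^sub>R g b - k a *\<^sub>R g a)) {a..b}"
proof -
  have "continuous_on {a..b} k"
    using k by (meson DERIV_isCont continuous_at_imp_continuous_on)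
  then have "bounded (k ` {a..b})"
    by (simp add: compact_continuous_image compact_imp_bounded)
  then obtain A where A: "A > 0" "\<And>t. t \<in> {a..b} \<Longrightarrow> \<bar>k t\<bar> \<le> A"
    by (auto simp: bounded_pos)
  have "bounded (k' ` {a..b})"
    using k' by (simp add: compact_continuous_image compact_imp_bounded)
  then obtain B where B: "B > 0" "\<And>t. t \<in> {a..b} \<Longrightarrow> \<bar>k' t\<bar> \<le> B"
    by (auto simp: bounded_pos)
  have "bounded (g ` {a..b})"
    using abs_continuous_on_imp_continuous_on[OF ac] by (simp add: compact_continuous_image compact_imp_bounded)
  then obtain C where C: "C > 0" "\<And>t. t \<in> {a..b} \<Longrightarrow> norm (g t) \<le> C"
    by (auto simp: bounded_pos)
  have lip: "\<bar>k x - k y\<bar> \<le> B * \<bar>x - y\<bar>" if "x \<in> {a..b}" "y \<in> {a..b}" for x y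
    using field_differentiable_bound[of "{a..b}" k k' B x y] k B that
    by (auto intro: has_field_derivative_at_within)
  have kg: "abs_continuous_on a b (\<lambda>t. k t *\<^sub>R g t)"
  proof (rule abs_continuous_on_dominated[OF ac abs_continuous_on_id])
    fix x y assume xy: "a \<le> x" "x \<le> y" "y \<le> b"
    have "dist (k x *\<^sub>R g x) (k y *\<^sub>R g y) = norm (k x *\<^sub>R (g x - g y) + (k x - k y) *\<^sub>R g y)"
      by (simp add: dist_norm algebra_simps)
    also have "\<dots> \<le> \<bar>k x\<bar> * norm (g x - g y) + \<bar>k x - k y\<bar> * norm (g y)"
      by (rule order_trans[OF norm_triangle_ineq]) simp
    also have "\<dots> \<le> A * norm (g x - g y) + (B * \<bar>x - y\<bar>) * C"
    proof (intro add_mono mult_right_mono)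
      have x: "x \<in> {a..b}" and y: "y \<in> {a..b}" using xy by auto
      show "\<bar>k x\<bar> \<le> A" using A(2)[OF x] .
      show "\<bar>k x - k y\<bar> * norm (g y) \<le> (B * \<bar>x - y\<bar>) * C"
        using lip[OF x y] C(2)[OF y] B(1) by (intro mult_mono) auto
    qed simp
    finally show "dist (k x *\<^sub>R g x) (k y *\<^sub>R g y) \<le> A * dist (g x) (g y) + (B * C) * dist x y"
      unfolding dist_norm real_norm_def by (simp only: mult.assoc mult.commute[of C] mult.left_commute[of C])
  qed (use A B C in auto)
  obtain h' M where M: "negligible M"
    "\<And>x. x \<in> {a<..<b} - M \<Longrightarrow> ((\<lambda>t. k t *\<^sub>R g t) has_vector_derivative h' x) (at x)"
    "(h' has_integral (k b *\<^sub>R g b - k a *\<^sub>R g a)) {a..b}"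
    by (rule abs_continuous_ftc[OF kg \<open>a \<le> b\<close>]) blast
  show ?thesis
  proof (rule has_integral_spike[OF _ _ M(3)])
    show "negligible (N \<union> M \<union> {a, b})" using M(1) N(1) by (simp add: negligible_Un)
    fix t assume "t \<in> {a..b} - (N \<union> M \<union> {a, b})"
    then have t: "t \<in> {a<..<b} - N" "t \<in> {a<..<b} - M" by auto
    have "((\<lambda>t. k t *\<^sub>R g t) has_vector_derivative (k t *\<^sub>R g' t + k' t *\<^sub>R g t)) (at t)"
      using has_vector_derivative_scaleR[OF k[of t] N(2)[OF t(1)]] .
    then show "k' t *\<^sub>R g t + k t *\<^sub>R g' t = h' t"
      using M(2)[OF t(2)] by (metis vector_derivative_unique_at add.commute)
  qed
qed

section \<open>Schur's test and kernels on the circle\<close>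

text \<open>
  Jensen's inequality for the measure \<open>k dM\<close>. It follows by integrating Young's inequality \<open>y \<le> c (1 - 1/p) + c\<^sup>1\<^sup>-\<^sup>p y\<^sup>p / p\<close>, in which
  equality holds at \<open>y = c\<close>; the best \<open>c\<close> is the mean of \<open>h\<close>, with the upper bound \<open>A\<close> in place of the mass.
\<close>
lemma weighted_power_mean:
  fixes k h :: "'a \<Rightarrow> real"
  assumes k: "integrable M k" "\<And>x. 0 \<le> k x" and h: "h \<in> borel_measurable M" "\<And>x. 0 \<le> h x"
    and kh: "integrable M (\<lambda>x. k x * h x powr p)" and "1 \<le> p" and A: "0 < A" "integral\<^sup>L M k \<le> A"
  shows "integrable M (\<lambda>x. k x * h x)"
    and "(\<integral>x. k x * h x \<partial>M) powr p \<le> A powr (p - 1) * (\<integral>x. k x * h x powr p \<partial>M)"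
proof -
  have young: "y \<le> c * (1 - 1/p) + c powr (1 - p) * y powr p / p" if "0 \<le> y" "0 < c" for y c :: real
  proof (cases "y = 0")
    case False
    have "((y / c) powr p) powr (1 / p) * 1 powr (1 - 1 / p) \<le> (1 / p) * (y / c) powr p + (1 - 1 / p) * 1"
      using Youngs_inequality_0[of "1 / p" "1 - 1 / p" "(y / c) powr p" 1] that \<open>1 \<le> p\<close> False by simp
    then have "y / c \<le> (y / c) powr p / p + (1 - 1 / p)"
      using that \<open>1 \<le> p\<close> by (simp add: powr_powr)
    then have "c * (y / c) \<le> c * ((y / c) powr p / p + (1 - 1 / p))"
      using \<open>0 < c\<close> by (intro mult_left_mono) auto
    also have "c * ((y / c) powr p / p + (1 - 1 / p)) = c * (1 - 1/p) + c powr (1 - p) * y powr p / p"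
      using that by (simp add: powr_divide powr_diff algebra_simps)
    finally show ?thesis using that by simp
  qed (use that \<open>1 \<le> p\<close> in simp)
  have bound: "h x \<le> 1 + h x powr p" for x
  proof -
    have "h x \<le> 1 * (1 - 1/p) + 1 powr (1 - p) * h x powr p / p"
      using young[of "h x" 1] h by auto
    also have "\<dots> \<le> 1 + h x powr p"
      using \<open>1 \<le> p\<close> mult_left_mono[of 1 p "h x powr p"] by (intro add_mono) (auto simp: field_simps)
    finally show ?thesis .
  qed
  show int: "integrable M (\<lambda>x. k x * h x)"
  proof (rule Bochner_Integration.integrable_bound)
    show "integrable M (\<lambda>x. k x + k x * h x powr p)" using k kh by simp
    show "(\<lambda>x. k x * h x) \<in> borel_measurable M" using k h by auto
    show "AE x in M. norm (k x * h x) \<le> norm (k x + k x * h x powr p)"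
      using mult_left_mono[OF bound k(2)] k(2) h(2) by (intro always_eventually) (auto simp: algebra_simps abs_mult)
  qed
  let ?I = "\<integral>x. k x * h x \<partial>M" and ?J = "\<integral>x. k x * h x powr p \<partial>M"
  have "?I \<ge> 0" "?J \<ge> 0" using k h by (auto intro!: integral_nonneg_AE)
  show "?I powr p \<le> A powr (p - 1) * ?J"
  proof (cases "?I = 0")
    case True
    then show ?thesis using \<open>?J \<ge> 0\<close> by simp
  next
    case False
    then have I: "?I > 0" using \<open>?I \<ge> 0\<close> by simp
    \<comment> \<open>This \<open>c\<close> optimises the bound that Young's inequality yields after integration.\<close>
    define c where "c = ?I / A"
    have "c > 0" using I A by (simp add: c_def)
    have "?I \<le> (\<integral>x. c * (1 - 1/p) * k x + c powr (1 - p) / p * (k x * h x powr p) \<partial>M)"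
    proof (rule integral_mono[OF int])
      show "integrable M (\<lambda>x. c * (1 - 1/p) * k x + c powr (1 - p) / p * (k x * h x powr p))"
        using k kh by simp
      fix x
      show "k x * h x \<le> c * (1 - 1/p) * k x + c powr (1 - p) / p * (k x * h x powr p)"
        using mult_left_mono[OF young[OF h(2)[of x] \<open>c > 0\<close>] k(2)[of x]] by (simp add: algebra_simps)
    qed
    also have "\<dots> = c * (1 - 1/p) * integral\<^sup>L M k + c powr (1 - p) / p * ?J"
      using k kh by simp
    also have "\<dots> \<le> c * (1 - 1/p) * A + c powr (1 - p) / p * ?J"
      using A \<open>c > 0\<close> \<open>1 \<le> p\<close> by (intro add_mono mult_left_mono) auto
    also have "c * (1 - 1/p) * A = ?I * (1 - 1 / p)" using A by (simp add: c_def)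
    finally have "?I / p \<le> c powr (1 - p) * ?J / p" by (simp add: algebra_simps)
    then have "?I \<le> c powr (1 - p) * ?J" using \<open>1 \<le> p\<close> by (simp add: divide_le_cancel)
    then have "?I * c powr (p - 1) \<le> c powr (1 - p) * ?J * c powr (p - 1)"
      by (intro mult_right_mono) auto
    also have "\<dots> = ?J" using \<open>c > 0\<close> by (simp add: powr_diff)
    finally have "?I * c powr (p - 1) * A powr (p - 1) \<le> ?J * A powr (p - 1)"
      by (intro mult_right_mono) auto
    moreover have "?I * c powr (p - 1) * A powr (p - 1) = ?I powr p"
      using I A by (simp add: c_def powr_divide powr_diff)
    ultimately show ?thesis by (simp add: mult.commute)
  qed
qed

text \<open>
  Jensen's inequality in the inner variable, where the mass of the kernel is at most \<open>A\<close>, costs the factor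
  \<open>A\<^sup>p\<^sup>-\<^sup>1\<close>; Tonelli's theorem and the bound in the other variable cost one more \<open>A\<close>.
\<close>
lemma schur_test:
  fixes K :: "'a \<Rightarrow> 'a \<Rightarrow> real" and h :: "'a \<Rightarrow> real"
  assumes "finite_measure M"
    and K: "(\<lambda>(x, t). K x t) \<in> borel_measurable (M \<Otimes>\<^sub>M M)" "\<And>x t. 0 \<le> K x t"
      "\<And>x t. x \<in> space M \<Longrightarrow> t \<in> space M \<Longrightarrow> K x t \<le> B"
    and A: "A > 0" "\<And>x. x \<in> space M \<Longrightarrow> (\<integral>\<^sup>+t. K x t \<partial>M) \<le> ennreal A"
      "\<And>t. t \<in> space M \<Longrightarrow> (\<integral>\<^sup>+x. K x t \<partial>M) \<le> ennreal A"
    and h: "h \<in> borel_measurable M" "\<And>t. 0 \<le> h t" and "1 \<le> p" "(\<integral>\<^sup>+t. h t powr p \<partial>M) < \<infinity>"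
  shows "(\<integral>\<^sup>+x. ennreal ((\<integral>t. K x t * h t \<partial>M) powr p) \<partial>M) \<le> ennreal (A powr p) * (\<integral>\<^sup>+t. h t powr p \<partial>M)"
proof -
  interpret finite_measure M by fact
  interpret MM: pair_sigma_finite M M ..
  have [measurable]: "(\<lambda>(x, t). K x t) \<in> borel_measurable (M \<Otimes>\<^sub>M M)" "h \<in> borel_measurable M" by fact+
  have Kt[measurable]: "(\<lambda>t. K x t) \<in> borel_measurable M" if "x \<in> space M" for x
    using measurable_Pair2[OF K(1) that] by simp
  have Kx[measurable]: "(\<lambda>x. K x t) \<in> borel_measurable M" if "t \<in> space M" for t
    using measurable_Pair1[OF K(1) that] by simp
  have hp: "integrable M (\<lambda>t. h t powr p)"
    using assms by (intro integrableI_nonneg) auto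
  have pt: "ennreal ((\<integral>t. K x t * h t \<partial>M) powr p) \<le> ennreal (A powr (p - 1)) * (\<integral>\<^sup>+t. ennreal (K x t * h t powr p) \<partial>M)"
    if x: "x \<in> space M" for x
  proof -
    have ik: "integrable M (\<lambda>t. K x t)"
      using Kt[OF x] A(2)[OF x] K(2) by (intro integrableI_nonneg) (auto intro: le_less_trans)
    have ikh: "integrable M (\<lambda>t. K x t * h t powr p)"
    proof (rule Bochner_Integration.integrable_bound)
      show "integrable M (\<lambda>t. B * h t powr p)" using hp by simp
      show "AE t in M. norm (K x t * h t powr p) \<le> norm (B * h t powr p)"
      proof (rule AE_I2)
        fix t assume "t \<in> space M"
        then show "norm (K x t * h t powr p) \<le> norm (B * h t powr p)"
          using K(2)[of x t] K(3)[OF x] by (auto simp: abs_mult intro!: mult_right_mono order_trans[OF K(3)[OF x] abs_ge_self])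
      qed
    qed (use Kt[OF x] in measurable)
    have "integral\<^sup>L M (K x) = enn2real (\<integral>\<^sup>+t. K x t \<partial>M)"
      using K(2) Kt[OF x] by (intro integral_eq_nn_integral) auto
    also have "\<dots> \<le> A" using A(2)[OF x] A(1) by (simp add: enn2real_leI)
    finally have "(\<integral>t. K x t * h t \<partial>M) powr p \<le> A powr (p - 1) * (\<integral>t. K x t * h t powr p \<partial>M)"
      using weighted_power_mean(2)[OF ik K(2) h ikh \<open>1 \<le> p\<close> A(1)] by blast
    then have "ennreal ((\<integral>t. K x t * h t \<partial>M) powr p) \<le> ennreal (A powr (p - 1) * (\<integral>t. K x t * h t powr p \<partial>M))"
      by (rule ennreal_leI)
    also have "\<dots> = ennreal (A powr (p - 1)) * (\<integral>\<^sup>+t. ennreal (K x t * h t powr p) \<partial>M)"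
      using ikh K(2) by (subst nn_integral_eq_integral) (auto simp: ennreal_mult' integral_nonneg_AE)
    finally show ?thesis .
  qed
  have "(\<integral>\<^sup>+x. ennreal ((\<integral>t. K x t * h t \<partial>M) powr p) \<partial>M) \<le>
      (\<integral>\<^sup>+x. ennreal (A powr (p - 1)) * (\<integral>\<^sup>+t. ennreal (K x t * h t powr p) \<partial>M) \<partial>M)"
    by (intro nn_integral_mono pt)
  also have "\<dots> = ennreal (A powr (p - 1)) * (\<integral>\<^sup>+x. (\<integral>\<^sup>+t. ennreal (K x t * h t powr p) \<partial>M) \<partial>M)"
    by (intro nn_integral_cmult) measurable
  also have "(\<integral>\<^sup>+x. (\<integral>\<^sup>+t. ennreal (K x t * h t powr p) \<partial>M) \<partial>M) = (\<integral>\<^sup>+t. (\<integral>\<^sup>+x. ennreal (K x t * h t powr p) \<partial>M) \<partial>M)"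
    by (rule MM.Fubini'[symmetric]) measurable
  also have "\<dots> \<le> (\<integral>\<^sup>+t. ennreal A * ennreal (h t powr p) \<partial>M)"
  proof (rule nn_integral_mono)
    fix t assume t: "t \<in> space M"
    have "(\<integral>\<^sup>+x. ennreal (K x t * h t powr p) \<partial>M) = (\<integral>\<^sup>+x. ennreal (K x t) * ennreal (h t powr p) \<partial>M)"
      using K(2) by (simp add: ennreal_mult)
    also have "\<dots> = (\<integral>\<^sup>+x. ennreal (K x t) \<partial>M) * ennreal (h t powr p)"
      by (rule nn_integral_multc) (use Kx[OF t] in simp)
    also have "\<dots> \<le> ennreal A * ennreal (h t powr p)"
      by (intro mult_right_mono A(3) t) auto
    finally show "(\<integral>\<^sup>+x. ennreal (K x t * h t powr p) \<partial>M) \<le> ennreal A * ennreal (h t powr p)" .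
  qed
  also have "(\<integral>\<^sup>+t. ennreal A * ennreal (h t powr p) \<partial>M) = ennreal A * (\<integral>\<^sup>+t. h t powr p \<partial>M)"
    by (intro nn_integral_cmult) measurable
  finally have "(\<integral>\<^sup>+x. ennreal ((\<integral>t. K x t * h t \<partial>M) powr p) \<partial>M) \<le>
      ennreal (A powr (p - 1)) * (ennreal A * (\<integral>\<^sup>+t. h t powr p \<partial>M))"
    by (simp add: mult_left_mono)
  also have "\<dots> = ennreal (A powr p) * (\<integral>\<^sup>+t. h t powr p \<partial>M)"
    using A(1) by (simp add: mult.assoc[symmetric] ennreal_mult''[symmetric] powr_diff)
  finally show ?thesis .
qed

text \<open>
  The sine is concave on \<open>[0, pi/2]\<close> and therefore lies above its chord.
\<close>
lemma sin_ge_linear: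
  assumes "0 \<le> x" "x \<le> pi / 2"
  shows "2 * x / pi \<le> sin x"
proof -
  have "convex_on {0..pi/2} (\<lambda>x. - sin x)"
    by (rule f''_ge0_imp_convex[where f' = "\<lambda>x. - cos x" and f'' = sin])
       (auto intro!: derivative_eq_intros sin_ge_zero)
  then have "- sin ((1 - 2 * x / pi) *\<^sub>R 0 + (2 * x / pi) *\<^sub>R (pi / 2)) \<le>
      (1 - 2 * x / pi) * (- sin 0) + (2 * x / pi) * (- sin (pi / 2))"
    by (rule convex_onD) (use assms in \<open>auto simp: field_simps\<close>)
  then show ?thesis by simp
qed

lemma norm_one_minus_rcis_cos: "(norm (1 - of_real r * cis s))\<^sup>2 = 1 - 2 * r * cos s + r\<^sup>2"
proof -
  have "(norm (1 - of_real r * cis s))\<^sup>2 = (1 - r * cos s)\<^sup>2 + (r * sin s)\<^sup>2"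
    by (simp add: cmod_power2)
  also have "\<dots> = 1 - 2 * r * cos s + r\<^sup>2 * ((cos s)\<^sup>2 + (sin s)\<^sup>2)"
    by algebra
  finally show ?thesis by simp
qed

lemma norm_one_minus_rcis_squared: "(norm (1 - of_real r * cis s))\<^sup>2 = (1 - r)\<^sup>2 + 4 * r * (sin (s / 2))\<^sup>2"
proof -
  have "(norm (1 - of_real r * cis s))\<^sup>2 = 1 - 2 * r * cos s + r\<^sup>2"
    by (rule norm_one_minus_rcis_cos)
  also have "cos s = 1 - 2 * (sin (s / 2))\<^sup>2"
    using cos_double_sin[of "s / 2"] by simp
  finally show ?thesis
    by (simp add: power2_eq_square algebra_simps)
qed

text \<open>
  The distance from \<open>1\<close> to \<open>r e\<^sup>i\<^sup>s\<close> is comparable to the larger of \<open>1 - r\<close> and \<open>|s|\<close>. Close to the circle this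
  is seen from the half-angle formula; for \<open>r < 1/2\<close> the distance is bounded below anyway.
\<close>
lemma norm_one_minus_rcis_lower:
  assumes r: "0 \<le> r" "r < 1" and s: "\<bar>s\<bar> \<le> pi"
  shows "(1 - r + \<bar>s\<bar> / pi) / 4 \<le> norm (1 - of_real r * cis s)"
proof (cases "r < 1 / 2")
  case True
  have *: "(1 - r + x) / 4 \<le> 1 - r" if "x \<le> 1" for x using True that by simp
  have "(1 - r + \<bar>s\<bar> / pi) / 4 \<le> 1 - r" using s by (intro *) simp
  also have "\<dots> = norm (1::complex) - norm (of_real r * cis s)" using r by (simp add: norm_mult)
  also have "\<dots> \<le> norm (1 - of_real r * cis s)" by (rule norm_triangle_ineq2)
  finally show ?thesis .
next
  case False
  have "\<bar>s\<bar> / pi \<le> \<bar>sin (s / 2)\<bar>"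
    using sin_ge_linear[of "\<bar>s\<bar> / 2"] s by (cases "s \<ge> 0") auto
  then have "(\<bar>s\<bar> / pi)\<^sup>2 \<le> (sin (s / 2))\<^sup>2"
    by (metis abs_ge_zero abs_le_square_iff abs_of_nonneg divide_nonneg_pos pi_gt_zero)
  then have "2 * (\<bar>s\<bar> / pi)\<^sup>2 \<le> 4 * r * (sin (s / 2))\<^sup>2"
    using False mult_mono[of 2 "4 * r" "(\<bar>s\<bar> / pi)\<^sup>2" "(sin (s / 2))\<^sup>2"] by simp
  moreover have "((1 - r + \<bar>s\<bar> / pi) / 4)\<^sup>2 \<le> (1 - r)\<^sup>2 + 2 * (\<bar>s\<bar> / pi)\<^sup>2"
  proof -
    have aux: "(2 * a + 2 * b - c) / 16 \<le> a + 2 * b" if "0 \<le> a" "0 \<le> b" "0 \<le> c" for a b c :: real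
      using that by simp
    have "((x + y) / 4)\<^sup>2 \<le> x\<^sup>2 + 2 * y\<^sup>2" for x y :: real
    proof -
      have "((x + y) / 4)\<^sup>2 = (2 * x\<^sup>2 + 2 * y\<^sup>2 - (x - y)\<^sup>2) / 16"
        by (simp add: power2_eq_square algebra_simps)
      also have "\<dots> \<le> x\<^sup>2 + 2 * y\<^sup>2"
        by (rule aux) simp_all
      finally show ?thesis .
    qed
    then show ?thesis .
  qed
  ultimately have "((1 - r + \<bar>s\<bar> / pi) / 4)\<^sup>2 \<le> (norm (1 - of_real r * cis s))\<^sup>2"
    unfolding norm_one_minus_rcis_squared by linarith
  then show ?thesis by (rule power2_le_imp_le) simp
qed

lemma nn_integral_shifted_abs_powr:
  assumes "\<delta> > 0" "\<beta> > 1"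
  shows "(\<integral>\<^sup>+s. ennreal ((\<delta> + \<bar>s - c\<bar> / pi) powr (- \<beta>)) \<partial>lborel) \<le> ennreal (2 * pi / (\<beta> - 1) * \<delta> powr (1 - \<beta>))"
proof -
  let ?f = "\<lambda>s. (\<delta> + \<bar>s\<bar> / pi) powr (- \<beta>)"
  have half: "(\<integral>\<^sup>+s. ennreal (?f s) * indicator {0..} s \<partial>lborel) = ennreal (pi / (\<beta> - 1) * \<delta> powr (1 - \<beta>))"
  proof -
    let ?F = "\<lambda>s. - pi / (\<beta> - 1) * (\<delta> + s / pi) powr (1 - \<beta>)"
    have "(\<integral>\<^sup>+s. ennreal ((\<delta> + s / pi) powr (- \<beta>)) * indicator {0..} s \<partial>lborel) = ennreal (0 - ?F 0)"
    proof (rule nn_integral_FTC_atLeast)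
      fix s :: real assume "0 \<le> s"
      then have "\<delta> + s / pi > 0" using \<open>\<delta> > 0\<close> by (simp add: add_pos_nonneg)
      then have "(?F has_real_derivative - pi / (\<beta> - 1) * ((1 - \<beta>) * (\<delta> + s / pi) powr (1 - \<beta> - 1) * (1 / pi))) (at s)"
        using \<open>\<beta> > 1\<close> by (auto intro!: derivative_eq_intros)
      also have "- pi / (\<beta> - 1) * ((1 - \<beta>) * (\<delta> + s / pi) powr (1 - \<beta> - 1) * (1 / pi)) = (\<delta> + s / pi) powr (- \<beta>)"
        using \<open>\<beta> > 1\<close> by (simp add: divide_simps) (simp add: algebra_simps)
      finally show "(?F has_real_derivative (\<delta> + s / pi) powr (- \<beta>)) (at s)" .
    next
      have "filterlim (\<lambda>s. s * (1 / pi)) at_top at_top"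
        by (rule filterlim_at_top_mult_tendsto_pos[OF tendsto_const _ filterlim_ident]) simp
      then have "filterlim (\<lambda>s. \<delta> + s / pi) at_top at_top"
        by (intro filterlim_tendsto_add_at_top[OF tendsto_const]) simp
      then have "((\<lambda>s. (\<delta> + s / pi) powr (1 - \<beta>)) \<longlongrightarrow> 0) at_top"
        using \<open>\<beta> > 1\<close> by (intro tendsto_neg_powr) auto
      then show "(?F \<longlongrightarrow> 0) at_top" using tendsto_mult_right_zero by blast
    qed auto
    also have "(\<integral>\<^sup>+s. ennreal ((\<delta> + s / pi) powr (- \<beta>)) * indicator {0..} s \<partial>lborel) =
        (\<integral>\<^sup>+s. ennreal (?f s) * indicator {0..} s \<partial>lborel)"
      by (intro nn_integral_cong) (auto simp: indicator_def)
    finally show ?thesis by simp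
  qed
  have "(\<integral>\<^sup>+s. ennreal (?f (s - c)) \<partial>lborel) = (\<integral>\<^sup>+s. ennreal (?f s) \<partial>lborel)"
    using nn_integral_real_affine[of "\<lambda>s. ennreal (?f (s - c))" 1 c] by simp
  also have "\<dots> \<le> (\<integral>\<^sup>+s. ennreal (?f s) * indicator {0..} s + ennreal (?f s) * indicator {0..} (- s) \<partial>lborel)"
    by (intro nn_integral_mono) (auto simp: indicator_def)
  also have "\<dots> = (\<integral>\<^sup>+s. ennreal (?f s) * indicator {0..} s \<partial>lborel) + (\<integral>\<^sup>+s. ennreal (?f s) * indicator {0..} (- s) \<partial>lborel)"
    by (intro nn_integral_add) auto
  also have "(\<integral>\<^sup>+s. ennreal (?f s) * indicator {0..} (- s) \<partial>lborel) = (\<integral>\<^sup>+s. ennreal (?f s) * indicator {0..} s \<partial>lborel)"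
    using nn_integral_real_affine[of "\<lambda>s. ennreal (?f s) * indicator {0..} s" "- 1" 0] by simp
  finally show ?thesis
    unfolding half using \<open>\<beta> > 1\<close> by (simp add: ennreal_plus[symmetric] mult.assoc del: ennreal_plus)
qed

abbreviation circle_measure :: "real measure" where
  "circle_measure \<equiv> lebesgue_on {0..2 * pi}"

text \<open>
  With \<open>\<delta> = 1 - r\<close>, the kernel is at most a multiple of \<open>\<delta>\<^sup>\<beta>\<^sup>-\<^sup>1 (\<delta> + |s|/pi)\<^sup>-\<^sup>\<beta>\<close> for \<open>|s| \<le> pi\<close>, and the integral
  of the latter over the line does not depend on \<open>\<delta>\<close>. This is where \<open>\<beta> > 1\<close> enters.
\<close>
lemma nn_integral_circle_kernel:
  assumes "0 \<le> r" "r < 1" "\<beta> > 1" and \<theta>: "\<theta> \<in> {0..2 * pi}"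
  shows "(\<integral>\<^sup>+t. ennreal ((1 - r) powr (\<beta> - 1) * norm (1 - of_real r * cis (\<theta> - t)) powr (- \<beta>)) \<partial>circle_measure)
     \<le> ennreal (4 powr \<beta> * (6 * pi / (\<beta> - 1)))"
proof -
  define \<delta> where "\<delta> = 1 - r"
  have "\<delta> > 0" using assms by (simp add: \<delta>_def)
  let ?N = "\<lambda>t. norm (1 - of_real r * cis (\<theta> - t)) powr (- \<beta>)"
  let ?g = "\<lambda>c t. (\<delta> + \<bar>t - c\<bar> / pi) powr (- \<beta>)"
  \<comment> \<open>The difference \<open>\<theta> - t\<close> ranges over \<open>[-2 pi, 2 pi]\<close>, while the lower bound for the distance wants the representative in \<open>[-pi, pi]\<close>; one of the three shifts provides it.\<close>
  have pt: "?N t \<le> 4 powr \<beta> * (?g \<theta> t + ?g (\<theta> - 2 * pi) t + ?g (\<theta> + 2 * pi) t)" if "t \<in> {0..2 * pi}" for t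
  proof -
    have *: "?N t \<le> 4 powr \<beta> * ?g c t" if c: "\<bar>t - c\<bar> \<le> pi" "cis (\<theta> - t) = cis (c - t)" for c
    proof -
      have "(\<delta> + \<bar>t - c\<bar> / pi) / 4 \<le> norm (1 - of_real r * cis (c - t))"
        using norm_one_minus_rcis_lower[of r "c - t"] assms(1,2) c by (simp add: \<delta>_def abs_minus_commute)
      moreover have pos: "0 < (\<delta> + \<bar>t - c\<bar> / pi) / 4" using \<open>\<delta> > 0\<close> by (simp add: add_pos_nonneg)
      ultimately have "?N t \<le> ((\<delta> + \<bar>t - c\<bar> / pi) / 4) powr (- \<beta>)"
        using \<open>\<beta> > 1\<close> by (simp add: c powr_mono2')
      also have "\<dots> = 4 powr \<beta> * ?g c t"
        using pos \<open>\<delta> > 0\<close> by (simp add: powr_divide powr_minus_divide)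
      finally show ?thesis .
    qed
    have "?g c t \<ge> 0" for c by simp
    note ** = mult_left_mono[of _ "?g \<theta> t + ?g (\<theta> - 2 * pi) t + ?g (\<theta> + 2 * pi) t" "4 powr \<beta>"]
    have "\<bar>t - \<theta>\<bar> \<le> pi \<or> \<bar>t - (\<theta> - 2 * pi)\<bar> \<le> pi \<or> \<bar>t - (\<theta> + 2 * pi)\<bar> \<le> pi"
      using that \<theta> unfolding abs_le_iff atLeastAtMost_iff by linarith
    then consider "\<bar>t - \<theta>\<bar> \<le> pi" | "\<bar>t - (\<theta> - 2 * pi)\<bar> \<le> pi" | "\<bar>t - (\<theta> + 2 * pi)\<bar> \<le> pi"
      by blast
    then show ?thesis
    proof cases
      case 1
      from *[OF this] show ?thesis by (rule order_trans) (auto intro!: **)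
    next
      case 2
      have "cis (\<theta> - t) = cis (\<theta> - 2 * pi - t)" by (simp add: complex_eq_iff cos_diff sin_diff)
      from *[OF 2 this] show ?thesis by (rule order_trans) (auto intro!: **)
    next
      case 3
      have "cis (\<theta> - t) = cis (\<theta> + 2 * pi - t)" by (simp add: complex_eq_iff cos_diff sin_diff)
      from *[OF 3 this] show ?thesis by (rule order_trans) (auto intro!: **)
    qed
  qed
  have "(\<integral>\<^sup>+t. ennreal (\<delta> powr (\<beta> - 1) * ?N t) \<partial>circle_measure) =
      (\<integral>\<^sup>+t. ennreal (\<delta> powr (\<beta> - 1) * ?N t) * indicator {0..2 * pi} t \<partial>lborel)"
    by (simp add: nn_integral_restrict_space nn_integral_completion)
  also have "\<dots> \<le> (\<integral>\<^sup>+t. ennreal (\<delta> powr (\<beta> - 1) * 4 powr \<beta>) * (ennreal (?g \<theta> t) + ennreal (?g (\<theta> - 2 * pi) t) + ennreal (?g (\<theta> + 2 * pi) t)) \<partial>lborel)"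
  proof (rule nn_integral_mono)
    fix t
    show "ennreal (\<delta> powr (\<beta> - 1) * ?N t) * indicator {0..2 * pi} t \<le> ennreal (\<delta> powr (\<beta> - 1) * 4 powr \<beta>) * (ennreal (?g \<theta> t) + ennreal (?g (\<theta> - 2 * pi) t) + ennreal (?g (\<theta> + 2 * pi) t))"
    proof (cases "t \<in> {0..2 * pi}")
      case True
      have "\<delta> powr (\<beta> - 1) * ?N t \<le> \<delta> powr (\<beta> - 1) * (4 powr \<beta> * (?g \<theta> t + ?g (\<theta> - 2 * pi) t + ?g (\<theta> + 2 * pi) t))"
        by (intro mult_left_mono pt True) auto
      then show ?thesis using True
        by (simp add: ennreal_mult[symmetric] ennreal_plus[symmetric] mult.assoc ennreal_leI del: ennreal_plus)
    qed simp
  qed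
  also have "\<dots> = ennreal (\<delta> powr (\<beta> - 1) * 4 powr \<beta>) * ((\<integral>\<^sup>+t. ennreal (?g \<theta> t) \<partial>lborel) + (\<integral>\<^sup>+t. ennreal (?g (\<theta> - 2 * pi) t) \<partial>lborel) + (\<integral>\<^sup>+t. ennreal (?g (\<theta> + 2 * pi) t) \<partial>lborel))"
    by (subst nn_integral_cmult) (auto simp: nn_integral_add)
  also have "\<dots> \<le> ennreal (\<delta> powr (\<beta> - 1) * 4 powr \<beta>) * 
     (ennreal (2 * pi / (\<beta> - 1) * \<delta> powr (1 - \<beta>)) + ennreal (2 * pi / (\<beta> - 1) * \<delta> powr (1 - \<beta>)) + ennreal (2 * pi / (\<beta> - 1) * \<delta> powr (1 - \<beta>)))"
    by (intro mult_left_mono add_mono nn_integral_shifted_abs_powr \<open>\<delta> > 0\<close> \<open>\<beta> > 1\<close>) auto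
  also have "\<dots> = ennreal ((\<delta> powr (\<beta> - 1) * 4 powr \<beta>) * (3 * (2 * pi / (\<beta> - 1) * \<delta> powr (1 - \<beta>))))"
    using \<open>\<beta> > 1\<close> by (simp add: ennreal_mult[symmetric] ennreal_plus[symmetric] del: ennreal_plus)
  also have "(\<delta> powr (\<beta> - 1) * 4 powr \<beta>) * (3 * (2 * pi / (\<beta> - 1) * \<delta> powr (1 - \<beta>))) = 4 powr \<beta> * (6 * pi / (\<beta> - 1))"
    using \<open>\<delta> > 0\<close> by (simp add: powr_diff)
  finally show ?thesis by (simp add: \<delta>_def)
qed

section \<open>Differentiating the Poisson type integral\<close>

lemma norm_one_minus_pos: "norm (z::complex) < 1 \<Longrightarrow> norm (1 - z) > 0"
  by (metis eq_iff_diff_eq_0 less_irrefl norm_one zero_less_norm_iff)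

lemma one_minus_norm_power_pos: "norm (z::complex) < 1 \<Longrightarrow> 0 < 1 - (norm z)\<^sup>2"
  by (simp add: power_less_one_iff abs_square_less_1)

lemma poisson_kernel_alt:
  assumes "norm z < 1"
  shows "poisson_kernel \<alpha> z =
    poisson_const \<alpha> * (1 - (norm z)\<^sup>2) powr (\<alpha> + 1) * ((norm (1 - z))\<^sup>2) powr (- (\<alpha> + 2) / 2)"
proof -
  have "((norm (1 - z))\<^sup>2) powr (- (\<alpha> + 2) / 2) = norm (1 - z) powr (2 * (- (\<alpha> + 2) / 2))"
    using norm_one_minus_pos[OF assms] by (simp only: powr_powr powr_numeral[symmetric])
  also have "2 * (- (\<alpha> + 2) / 2) = - (\<alpha> + 2)" by simp
  also have "norm (1 - z) powr (- (\<alpha> + 2)) = 1 / norm (1 - z) powr (\<alpha> + 2)"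
    by (rule powr_minus_divide)
  finally show ?thesis
    by (simp add: poisson_kernel_def)
qed

text \<open>
  The gradient of the kernel with respect to the real inner product on the complex plane: the
  directional derivative along \<open>h\<close> is the inner product with \<open>h\<close>.
\<close>
definition poisson_gradient :: "real \<Rightarrow> complex \<Rightarrow> complex" where
  "poisson_gradient \<alpha> z = poisson_kernel \<alpha> z *\<^sub>R
     ((- 2 * (\<alpha> + 1) / (1 - (norm z)\<^sup>2)) *\<^sub>R z + ((\<alpha> + 2) / (norm (1 - z))\<^sup>2) *\<^sub>R (1 - z))"

lemma poisson_kernel_has_derivative:
  assumes "norm z < 1"
  shows "(poisson_kernel \<alpha> has_derivative (\<lambda>h. poisson_gradient \<alpha> z \<bullet> h)) (at z)"
proof -
  let ?C = "poisson_const \<alpha>"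
  let ?d = "\<lambda>z::complex. 1 - z \<bullet> z" and ?e = "\<lambda>z::complex. (1 - z) \<bullet> (1 - z)"
  have d: "?d z > 0" and e: "?e z > 0"
    using one_minus_norm_power_pos[OF assms] norm_one_minus_pos[OF assms] by (auto simp: power2_norm_eq_inner)
  have Dd: "(?d has_derivative (\<lambda>h. - 2 * (z \<bullet> h))) (at z)"
    by (auto intro!: derivative_eq_intros simp: inner_commute)
  have De: "(?e has_derivative (\<lambda>h. - 2 * ((1 - z) \<bullet> h))) (at z)"
    by (auto intro!: derivative_eq_intros simp: inner_commute simp del: inner_diff_left inner_diff_right)
  have pw: "((\<lambda>x. x powr c) has_derivative (*) (c * (x powr c / x))) (at x)" if "x > 0" for x c :: real
    using has_real_derivative_powr[OF that, of c] that
    by (simp add: has_field_derivative_def powr_diff)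
  note D = has_derivative_mult[OF has_derivative_mult_right[OF has_derivative_compose[OF Dd pw[OF d]], of ?C]
      has_derivative_compose[OF De pw[OF e]], of "\<alpha> + 1" "- (\<alpha> + 2) / 2"]
  have alg: "C * X * (- (\<alpha> + 2) / 2 * (Y / e') * (- 2 * b)) + C * ((\<alpha> + 1) * (X / d') * (- 2 * a)) * Y
     = C * X * Y * (- 2 * (\<alpha> + 1) / d' * a + (\<alpha> + 2) / e' * b)" for C X Y d' e' a b :: real
    by (simp add: algebra_simps add_divide_distrib diff_divide_distrib)
  have "((\<lambda>z. ?C * ?d z powr (\<alpha> + 1) * ?e z powr (- (\<alpha> + 2) / 2)) has_derivative
      (\<lambda>h. poisson_gradient \<alpha> z \<bullet> h)) (at z)"
    using D unfolding alg poisson_gradient_def poisson_kernel_alt[OF assms] power2_norm_eq_inner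
      inner_add_left inner_scaleR_left by simp
  then show ?thesis
  proof (rule has_derivative_transform_within_open[of _ _ _ _ "ball 0 1"])
    fix w :: complex assume "w \<in> ball 0 1"
    then show "?C * ?d w powr (\<alpha> + 1) * ?e w powr (- (\<alpha> + 2) / 2) = poisson_kernel \<alpha> w"
      using poisson_kernel_alt[of w \<alpha>] by (simp add: power2_norm_eq_inner)
  qed (use assms in auto)
qed

lemma continuous_on_poisson_kernel: "continuous_on (ball 0 1) (poisson_kernel \<alpha>)"
  by (intro continuous_at_imp_continuous_on ballI has_derivative_continuous[OF poisson_kernel_has_derivative]) auto

lemma continuous_on_poisson_gradient: "continuous_on (ball 0 1) (poisson_gradient \<alpha>)"
proof -
  have "1 - (norm z)\<^sup>2 \<noteq> 0" "norm (1 - z) \<noteq> 0" if "z \<in> ball (0::complex) 1" for z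
    using norm_one_minus_pos[of z] one_minus_norm_power_pos[of z] that by auto
  then show ?thesis
    unfolding poisson_gradient_def by (intro continuous_intros continuous_on_poisson_kernel) auto
qed

text \<open>
  The gradient of \<open>z \<mapsto> K\<^sub>\<alpha>(z e\<^sup>-\<^sup>i\<^sup>t)\<close>.
\<close>
definition rotated_gradient :: "real \<Rightarrow> complex \<Rightarrow> real \<Rightarrow> complex" where
  "rotated_gradient \<alpha> z t = poisson_gradient \<alpha> (z * cis (- t)) * cis t"

lemma inner_mult_cis: "(a * cis t) \<bullet> h = a \<bullet> (h * cis (- t))"
  by (simp add: inner_complex_def algebra_simps)

lemma continuous_on_rotated_gradient:
  "continuous_on (ball 0 1 \<times> UNIV) (\<lambda>(z, t). rotated_gradient \<alpha> z t)"
  unfolding rotated_gradient_def case_prod_beta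
  by (intro continuous_intros continuous_on_compose2[OF continuous_on_poisson_gradient])
     (auto simp: norm_mult)

text \<open>
  The Poisson type integral in terms of the boundary function \<open>t \<mapsto> F(e\<^sup>i\<^sup>t)\<close> and the gauge integral, for which
  differentiation under the integral sign is at hand.
\<close>
definition poisson_average :: "real \<Rightarrow> (real \<Rightarrow> complex) \<Rightarrow> complex \<Rightarrow> complex" where
  "poisson_average \<alpha> \<phi> z =
     (1 / (2 * pi)) *\<^sub>R integral {0..2 * pi} (\<lambda>t. poisson_kernel \<alpha> (z * cis (- t)) *\<^sub>R \<phi> t)"

definition poisson_average_deriv :: "real \<Rightarrow> (real \<Rightarrow> complex) \<Rightarrow> complex \<Rightarrow> complex \<Rightarrow> complex" where
  "poisson_average_deriv \<alpha> \<phi> z h =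
     (1 / (2 * pi)) *\<^sub>R integral {0..2 * pi} (\<lambda>t. (rotated_gradient \<alpha> z t \<bullet> h) *\<^sub>R \<phi> t)"

lemma poisson_integral_eq_average:
  assumes "continuous_on {0..2 * pi} (\<lambda>t. F (cis t))" "norm z < 1"
  shows "poisson_integral \<alpha> F z = poisson_average \<alpha> (\<lambda>t. F (cis t)) z"
proof -
  have "continuous_on {0..2 * pi} (\<lambda>t. of_real (poisson_kernel \<alpha> (z * cis (- t))) * F (cis t))"
    using assms by (intro continuous_intros continuous_on_compose2[OF continuous_on_poisson_kernel]) (auto simp: norm_mult)
  then have "integrable circle_measure (\<lambda>t. of_real (poisson_kernel \<alpha> (z * cis (- t))) * F (cis t))"
    by (rule continuous_imp_integrable_real)
  then show ?thesis
    by (simp add: poisson_integral_def poisson_average_def lebesgue_integral_eq_integral scaleR_conv_of_real)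
qed

text \<open>
  Leibniz's rule applies because the gradient of the kernel is jointly continuous in the point and the
  boundary variable.
\<close>
lemma poisson_average_has_derivative:
  assumes \<phi>: "continuous_on {0..2 * pi} \<phi>" and z: "norm z < 1"
  shows "(poisson_average \<alpha> \<phi> has_derivative poisson_average_deriv \<alpha> \<phi> z) (at z)"
proof -
  let ?fx = "\<lambda>z t. blinfun_scaleR_left (\<phi> t) o\<^sub>L blinfun_inner_right (rotated_gradient \<alpha> z t)"
  have fx: "blinfun_apply (?fx z t) h = (rotated_gradient \<alpha> z t \<bullet> h) *\<^sub>R \<phi> t" for z t h
    by simp
  have cont: "continuous_on (ball 0 1 \<times> cbox 0 (2 * pi)) (\<lambda>(z, t). ?fx z t)"
    unfolding case_prod_beta
  proof (intro bounded_bilinear.continuous_on[OF bounded_bilinear_blinfun_compose]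
      bounded_linear.continuous_on[OF bounded_linear_blinfun_scaleR_left]
      bounded_linear.continuous_on[OF bounded_linear_blinfun_inner_right])
    show "continuous_on (ball 0 1 \<times> cbox 0 (2 * pi)) (\<lambda>x. \<phi> (snd x))"
      by (rule continuous_on_compose2[OF \<phi> continuous_on_snd]) auto
    show "continuous_on (ball 0 1 \<times> cbox 0 (2 * pi)) (\<lambda>x. rotated_gradient \<alpha> (fst x) (snd x))"
      using continuous_on_rotated_gradient[of \<alpha>] unfolding case_prod_beta
      by (rule continuous_on_subset) auto
  qed
  have int: "integral (cbox 0 (2 * pi)) (?fx z) h = integral {0..2 * pi} (\<lambda>t. (rotated_gradient \<alpha> z t \<bullet> h) *\<^sub>R \<phi> t)" for h
  proof -
    have "continuous_on (cbox 0 (2 * pi)) (?fx z)"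
    proof -
      have "continuous_on (cbox 0 (2 * pi)) (\<lambda>t. (z, t))" by (intro continuous_intros)
      moreover have "(\<lambda>t. (z, t)) ` cbox 0 (2 * pi) \<subseteq> ball 0 1 \<times> cbox 0 (2 * pi)" using z by auto
      ultimately show ?thesis using continuous_on_compose2[OF cont, of _ "\<lambda>t. (z, t)"] by simp
    qed
    then show ?thesis
      by (subst blinfun_apply_integral) (auto intro: integrable_continuous_real)
  qed
  have "((\<lambda>z. integral (cbox 0 (2 * pi)) (\<lambda>t. poisson_kernel \<alpha> (z * cis (- t)) *\<^sub>R \<phi> t)) has_derivative
      integral (cbox 0 (2 * pi)) (?fx z)) (at z within ball 0 1)"
  proof (rule leibniz_rule[OF _ _ cont])
    fix w :: complex and t :: real assume w: "w \<in> ball 0 1"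
    have "((\<lambda>w. poisson_kernel \<alpha> (w * cis (- t))) has_derivative
        (\<lambda>h. poisson_gradient \<alpha> (w * cis (- t)) \<bullet> (h * cis (- t)))) (at w)"
      by (rule has_derivative_compose[OF _ poisson_kernel_has_derivative])
         (use w in \<open>auto intro!: derivative_eq_intros simp: norm_mult\<close>)
    then have "((\<lambda>w. poisson_kernel \<alpha> (w * cis (- t)) *\<^sub>R \<phi> t) has_derivative
        (\<lambda>h. (rotated_gradient \<alpha> w t \<bullet> h) *\<^sub>R \<phi> t)) (at w)"
      by (auto intro!: derivative_eq_intros simp: rotated_gradient_def inner_mult_cis)
    then show "((\<lambda>w. poisson_kernel \<alpha> (w * cis (- t)) *\<^sub>R \<phi> t) has_derivative blinfun_apply (?fx w t)) (at w within ball 0 1)"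
      unfolding fx[abs_def] by (rule has_derivative_at_withinI)
  next
    fix w :: complex assume "w \<in> ball 0 1"
    then show "(\<lambda>t. poisson_kernel \<alpha> (w * cis (- t)) *\<^sub>R \<phi> t) integrable_on cbox 0 (2 * pi)"
      using \<phi> by (intro integrable_continuous continuous_intros continuous_on_compose2[OF continuous_on_poisson_kernel])
        (auto simp: norm_mult)
  qed (use z in auto)
  then have "((\<lambda>z. integral (cbox 0 (2 * pi)) (\<lambda>t. poisson_kernel \<alpha> (z * cis (- t)) *\<^sub>R \<phi> t)) has_derivative
      integral (cbox 0 (2 * pi)) (?fx z)) (at z)"
    using z by (subst (asm) at_within_open) auto
  then have "((\<lambda>z. (1 / (2 * pi)) *\<^sub>R integral (cbox 0 (2 * pi)) (\<lambda>t. poisson_kernel \<alpha> (z * cis (- t)) *\<^sub>R \<phi> t)) has_derivative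
      (\<lambda>h. (1 / (2 * pi)) *\<^sub>R integral (cbox 0 (2 * pi)) (?fx z) h)) (at z)"
    by (rule has_derivative_scaleR_right)
  then show ?thesis
    unfolding poisson_average_def[abs_def] poisson_average_deriv_def[abs_def] int[symmetric]
    by (simp only: box_real)
qed

lemma continuous_on_poisson_average_deriv:
  assumes \<phi>: "continuous_on {0..2 * pi} \<phi>"
  shows "continuous_on (ball 0 1) (\<lambda>z. poisson_average_deriv \<alpha> \<phi> z h)"
proof -
  have "continuous_on (ball 0 1 \<times> cbox 0 (2 * pi)) (\<lambda>(z, t). (rotated_gradient \<alpha> z t \<bullet> h) *\<^sub>R \<phi> t)"
    unfolding case_prod_beta
  proof (intro continuous_intros)
    show "continuous_on (ball 0 1 \<times> cbox 0 (2 * pi)) (\<lambda>x. \<phi> (snd x))"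
      by (rule continuous_on_compose2[OF \<phi> continuous_on_snd]) auto
    show "continuous_on (ball 0 1 \<times> cbox 0 (2 * pi)) (\<lambda>x. rotated_gradient \<alpha> (fst x) (snd x))"
      using continuous_on_rotated_gradient[of \<alpha>] unfolding case_prod_beta
      by (rule continuous_on_subset) auto
  qed
  from integral_continuous_on_param[OF this] show ?thesis
    unfolding poisson_average_deriv_def by (intro continuous_intros) simp
qed

lemma partial_xy_eq_derivative:
  assumes f: "\<And>w. w \<in> unit_disc \<Longrightarrow> f w = g w" and z: "norm z < 1" and g: "(g has_derivative g') (at z)"
  shows "partial_x f z = g' 1" "partial_y f z = g' \<i>"
proof -
  have f': "(f has_derivative g') (at z)"
    by (rule has_derivative_transform_within_open[OF g, of "ball 0 1"]) (use f z in auto)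
  have *: "(f has_derivative g') (at (Complex (Re z) (Im z)))" using f' by simp
  have "((\<lambda>x. f (Complex x (Im z))) has_derivative (\<lambda>h. g' (Complex h 0))) (at (Re z))"
    by (rule has_derivative_compose[of "\<lambda>x. Complex x (Im z)" "\<lambda>h. Complex h 0" "Re z" UNIV f g', OF _ *])
       (auto intro!: derivative_eq_intros simp: Complex_eq)
  moreover have "g' (Complex h 0) = h *\<^sub>R g' 1" for h
    using linear_scale[OF has_derivative_linear[OF g], of h 1] by (simp add: scaleR_conv_of_real complex_of_real_def)
  ultimately show "partial_x f z = g' 1"
    unfolding partial_x_def has_vector_derivative_def by (intro vector_derivative_at) (simp add: has_vector_derivative_def)
  have "((\<lambda>y. f (Complex (Re z) y)) has_derivative (\<lambda>h. g' (Complex 0 h))) (at (Im z))"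
    by (rule has_derivative_compose[of "\<lambda>y. Complex (Re z) y" "\<lambda>h. Complex 0 h" "Im z" UNIV f g', OF _ *])
       (auto intro!: derivative_eq_intros simp: Complex_eq)
  moreover have "g' (Complex 0 h) = h *\<^sub>R g' \<i>" for h
    using linear_scale[OF has_derivative_linear[OF g], of h \<i>] by (simp add: complex_eq_iff Complex_eq scaleR_conv_of_real mult.commute)
  ultimately show "partial_y f z = g' \<i>"
    unfolding partial_y_def by (intro vector_derivative_at) (simp add: has_vector_derivative_def)
qed

lemma partials_of_poisson_average:
  assumes f: "\<And>w. w \<in> unit_disc \<Longrightarrow> f w = poisson_average \<alpha> \<phi> w"
    and \<phi>: "continuous_on {0..2 * pi} \<phi>" and z: "norm z < 1"
  shows "partial_x f z = poisson_average_deriv \<alpha> \<phi> z 1"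
    and "partial_y f z = poisson_average_deriv \<alpha> \<phi> z \<i>"
    and "partial_theta f z = poisson_average_deriv \<alpha> \<phi> z (\<i> * z)"
    and "poisson_average_deriv \<alpha> \<phi> z h = Re h *\<^sub>R partial_x f z + Im h *\<^sub>R partial_y f z"
proof -
  let ?D = "poisson_average_deriv \<alpha> \<phi> z"
  note D = poisson_average_has_derivative[OF \<phi> z, of \<alpha>]
  show x: "partial_x f z = ?D 1" and y: "partial_y f z = ?D \<i>"
    using partial_xy_eq_derivative[OF f z D] by auto
  show lin: "?D h = Re h *\<^sub>R partial_x f z + Im h *\<^sub>R partial_y f z" for h
  proof -
    have "h = Re h *\<^sub>R 1 + Im h *\<^sub>R \<i>" by (simp add: complex_eq_iff)
    then have "?D h = ?D (Re h *\<^sub>R 1 + Im h *\<^sub>R \<i>)" by simp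
    also have "\<dots> = Re h *\<^sub>R ?D 1 + Im h *\<^sub>R ?D \<i>"
      using has_derivative_linear[OF D] by (simp only: linear_add linear_scale)
    finally show ?thesis by (simp only: x y)
  qed
  show "partial_theta f z = ?D (\<i> * z)"
    unfolding lin partial_theta_def partial_z_def partial_zbar_def
    by (simp add: complex_eq_iff scaleR_conv_of_real field_simps)
qed

section \<open>Polar derivatives as convolutions\<close>

text \<open>
  Both \<open>\<kappa>\<close> and \<open>\<phi>\<close> are periodic, so no boundary terms appear.
\<close>
lemma convolution_by_parts:
  fixes \<phi> g :: "real \<Rightarrow> complex" and \<kappa> \<kappa>' :: "real \<Rightarrow> real"
  assumes ac: "abs_continuous_on 0 (2 * pi) \<phi>" and per: "\<phi> (2 * pi) = \<phi> 0"
    and N: "negligible N" "\<And>t. t \<in> {0<..<2 * pi} - N \<Longrightarrow> (\<phi> has_vector_derivative g t) (at t)"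
    and \<kappa>: "\<And>s. (\<kappa> has_real_derivative \<kappa>' s) (at s)" "continuous_on UNIV \<kappa>'" "\<And>s. \<kappa> (s - 2 * pi) = \<kappa> s"
  shows "((\<lambda>t. \<kappa> (\<theta> - t) *\<^sub>R g t) has_integral integral {0..2 * pi} (\<lambda>t. \<kappa>' (\<theta> - t) *\<^sub>R \<phi> t)) {0..2 * pi}"
proof -
  have der: "((\<lambda>t. \<kappa> (\<theta> - t)) has_real_derivative - \<kappa>' (\<theta> - t)) (at t)" for t
  proof -
    have "((\<lambda>t. \<theta> - t) has_real_derivative - 1) (at t)" by (auto intro!: derivative_eq_intros)
    from DERIV_chain2[OF \<kappa>(1) this] show ?thesis by simp
  qed
  have cont: "continuous_on {0..2 * pi} (\<lambda>t. \<kappa>' (\<theta> - t))"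
    by (intro continuous_on_compose2[OF \<kappa>(2)] continuous_intros) auto
  have "((\<lambda>t. (- \<kappa>' (\<theta> - t)) *\<^sub>R \<phi> t + \<kappa> (\<theta> - t) *\<^sub>R g t) has_integral
      (\<kappa> (\<theta> - 2 * pi) *\<^sub>R \<phi> (2 * pi) - \<kappa> (\<theta> - 0) *\<^sub>R \<phi> 0)) {0..2 * pi}"
    by (rule abs_continuous_integration_by_parts[OF ac _ der _ N]) (use cont in \<open>auto intro: continuous_intros\<close>)
  then have 1: "((\<lambda>t. (- \<kappa>' (\<theta> - t)) *\<^sub>R \<phi> t + \<kappa> (\<theta> - t) *\<^sub>R g t) has_integral 0) {0..2 * pi}"
    by (simp add: per \<kappa>(3))
  have "(\<lambda>t. \<kappa>' (\<theta> - t) *\<^sub>R \<phi> t) integrable_on {0..2 * pi}"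
    using cont abs_continuous_on_imp_continuous_on[OF ac] by (intro integrable_continuous_real continuous_intros)
  then have 2: "((\<lambda>t. \<kappa>' (\<theta> - t) *\<^sub>R \<phi> t) has_integral integral {0..2 * pi} (\<lambda>t. \<kappa>' (\<theta> - t) *\<^sub>R \<phi> t)) {0..2 * pi}"
    by (rule integrable_integral)
  from has_integral_add[OF 1 2] show ?thesis by simp
qed

lemma rcis_norm_lt1: "0 \<le> r \<Longrightarrow> r < 1 \<Longrightarrow> norm (of_real r * cis s) < 1"
  by (simp add: norm_mult)

text \<open>
  For \<open>\<alpha> = 0\<close> this is the conjugate Poisson kernel \<open>Im ((1 + w) / (1 - w))\<close> with \<open>w = r e\<^sup>i\<^sup>s\<close>.
\<close>
definition radial_conjugate :: "real \<Rightarrow> real \<Rightarrow> real \<Rightarrow> real" where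
  "radial_conjugate \<alpha> r s = 2 * poisson_const \<alpha> * (1 - r\<^sup>2) powr \<alpha> * (r * sin s) *
     ((norm (1 - of_real r * cis s))\<^sup>2) powr (- (\<alpha> + 2) / 2)"

definition radial_remainder :: "real \<Rightarrow> real \<Rightarrow> real \<Rightarrow> real" where
  "radial_remainder \<alpha> r s = poisson_const \<alpha> * (\<alpha> / 2) * (1 - r\<^sup>2) powr \<alpha> *
     ((1 - r\<^sup>2) - (norm (1 - of_real r * cis s))\<^sup>2) * ((norm (1 - of_real r * cis s))\<^sup>2) powr (- (\<alpha> + 2) / 2)"

text \<open>
  The inner product is the kernel of \<open>r \<partial>\<^sub>r f\<close>. With \<open>x = r cos s\<close>, \<open>q = r\<^sup>2\<close>, \<open>E = |1 - w|\<^sup>2 = 1 - 2 x + q\<close> and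
  \<open>(r sin s)\<^sup>2 = q - x\<^sup>2\<close>, both sides are powers of \<open>1 - q\<close> and \<open>E\<close> times polynomials in \<open>x\<close> and \<open>q\<close>; the claim is the polynomial identity
  \<open>key\<close> of the proof.
\<close>
lemma radial_conjugate_derivative:
  assumes r: "0 \<le> r" "r < 1"
  shows "(radial_conjugate \<alpha> r has_real_derivative
    poisson_gradient \<alpha> (of_real r * cis s) \<bullet> (of_real r * cis s) - radial_remainder \<alpha> r s) (at s)"
proof -
  let ?w = "of_real r * cis s" and ?C = "poisson_const \<alpha>"
  define d where "d = 1 - r\<^sup>2"
  define E where "E s = 1 - 2 * r * cos s + r\<^sup>2" for s
  define Y where "Y = E s powr (- (\<alpha> + 2) / 2)"
  have d: "d > 0"
    using one_minus_norm_power_pos[OF rcis_norm_lt1[OF r, of 0]] r by (simp add: d_def norm_mult)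
  have Eeq: "(norm (1 - of_real r * cis s))\<^sup>2 = E s" for s
    unfolding E_def by (rule norm_one_minus_rcis_cos)
  have E: "E s > 0" for s
    using norm_one_minus_pos[OF rcis_norm_lt1[OF r, of s]] by (simp flip: Eeq)
  have Y': "E s powr (- (\<alpha> + 2) / 2 - 1) = Y / E s"
    using E[of s] by (simp add: Y_def powr_diff)
  have dE: "(E has_real_derivative 2 * r * sin s) (at s)"
    unfolding E_def[abs_def] by (auto intro!: derivative_eq_intros)
  have pw: "((\<lambda>s. E s powr (- (\<alpha> + 2) / 2)) has_real_derivative (- (\<alpha> + 2) / 2 * (Y / E s)) * (2 * r * sin s)) (at s)"
    using DERIV_chain2[OF has_real_derivative_powr[OF E, where r = "- (\<alpha> + 2) / 2"] dE] unfolding Y' .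
  have sn: "((\<lambda>s. r * sin s) has_real_derivative r * cos s) (at s)"
    by (auto intro!: derivative_eq_intros)
  have D: "((\<lambda>s. 2 * ?C * d powr \<alpha> * ((r * sin s) * E s powr (- (\<alpha> + 2) / 2))) has_real_derivative
      2 * ?C * d powr \<alpha> * ((r * cos s) * Y + (- (\<alpha> + 2) / 2 * (Y / E s)) * (2 * r * sin s) * (r * sin s))) (at s)"
    using DERIV_cmult[OF DERIV_mult[OF sn pw], of "2 * ?C * d powr \<alpha>"] unfolding Y_def by (simp only: mult.commute mult.left_commute add.commute)
  have in1: "?w \<bullet> ?w = r\<^sup>2"
    by (simp add: norm_mult flip: power2_norm_eq_inner)
  have in2: "(1 - ?w) \<bullet> ?w = r * cos s - r\<^sup>2"
    using in1 by (simp add: inner_diff_left)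
  have nw: "norm ?w = r" using r by (simp add: norm_mult)
  have G: "poisson_gradient \<alpha> ?w \<bullet> ?w =
      ?C * (d * d powr \<alpha>) * Y * (- 2 * (\<alpha> + 1) / d * r\<^sup>2 + (\<alpha> + 2) / E s * (r * cos s - r\<^sup>2))"
    unfolding poisson_gradient_def poisson_kernel_alt[OF rcis_norm_lt1[OF r]] inner_add_left inner_scaleR_left in1 in2 nw Eeq
    using d by (simp add: d_def[symmetric] Y_def powr_add)
  have R: "radial_remainder \<alpha> r s = ?C * (\<alpha> / 2) * d powr \<alpha> * (d - E s) * Y"
    by (simp add: radial_remainder_def Eeq d_def Y_def)
  have "(r * sin s)\<^sup>2 = r\<^sup>2 - (r * cos s)\<^sup>2"
    by (simp add: power_mult_distrib sin_squared_eq algebra_simps)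
  then have S: "(r * sin s) * (r * sin s) = r\<^sup>2 - (r * cos s)\<^sup>2" by (simp add: power2_eq_square)
  have key: "2 * (x * e - (\<alpha> + 2) * (q - x\<^sup>2)) = (- 2 * (\<alpha> + 1) * q * e + (\<alpha> + 2) * (1 - q) * (x - q)) - \<alpha> / 2 * ((1 - q) - e) * e"
    if "e = 1 - 2 * x + q" for x e q :: real
    unfolding that by (simp add: field_simps power2_eq_square)
  have "2 * ((r * cos s) * Y + (- (\<alpha> + 2) / 2 * (Y / E s)) * (2 * r * sin s) * (r * sin s)) =
      (Y / E s) * (2 * ((r * cos s) * E s - (\<alpha> + 2) * ((r * sin s) * (r * sin s))))"
    using E[of s] by (simp add: field_simps)
  also have "\<dots> = (Y / E s) * ((- 2 * (\<alpha> + 1) * r\<^sup>2 * E s + (\<alpha> + 2) * d * (r * cos s - r\<^sup>2)) - \<alpha> / 2 * (d - E s) * E s)"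
    unfolding S d_def by (subst key) (simp_all add: E_def)
  also have "\<dots> = d * Y * (- 2 * (\<alpha> + 1) / d * r\<^sup>2 + (\<alpha> + 2) / E s * (r * cos s - r\<^sup>2)) - (\<alpha> / 2) * (d - E s) * Y"
    using E[of s] d by (simp add: field_simps)
  finally have "2 * ?C * d powr \<alpha> * ((r * cos s) * Y + (- (\<alpha> + 2) / 2 * (Y / E s)) * (2 * r * sin s) * (r * sin s)) =
      ?C * d powr \<alpha> * (d * Y * (- 2 * (\<alpha> + 1) / d * r\<^sup>2 + (\<alpha> + 2) / E s * (r * cos s - r\<^sup>2)) - (\<alpha> / 2) * (d - E s) * Y)"
    by simp
  also have "\<dots> = poisson_gradient \<alpha> ?w \<bullet> ?w - radial_remainder \<alpha> r s"
    unfolding G R by (simp add: algebra_simps)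
  finally have eq: "2 * ?C * d powr \<alpha> * ((r * cos s) * Y + (- (\<alpha> + 2) / 2 * (Y / E s)) * (2 * r * sin s) * (r * sin s)) =
     poisson_gradient \<alpha> ?w \<bullet> ?w - radial_remainder \<alpha> r s" .
  have fn: "radial_conjugate \<alpha> r = (\<lambda>s. 2 * ?C * d powr \<alpha> * ((r * sin s) * E s powr (- (\<alpha> + 2) / 2)))"
    by (rule ext) (simp add: radial_conjugate_def Eeq d_def)
  show ?thesis using D unfolding eq fn .
qed

lemma poisson_kernel_angular_derivative:
  assumes r: "0 \<le> r" "r < 1"
  shows "((\<lambda>s. poisson_kernel \<alpha> (of_real r * cis s)) has_real_derivative
    poisson_gradient \<alpha> (of_real r * cis s) \<bullet> (\<i> * (of_real r * cis s))) (at s)"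
proof -
  have "((\<lambda>s. of_real r * cis s) has_derivative (\<lambda>h. h *\<^sub>R (\<i> * (of_real r * cis s)))) (at s)"
    by (auto intro!: derivative_eq_intros simp: scaleR_conv_of_real)
  from has_derivative_compose[OF this poisson_kernel_has_derivative[OF rcis_norm_lt1[OF r]]]
  show ?thesis by (simp add: has_field_derivative_def mult_commute_abs)
qed

lemma continuous_on_rcis_compose:
  assumes "continuous_on (ball 0 1) h" "0 \<le> r" "r < 1"
  shows "continuous_on A (\<lambda>s. h (of_real r * cis s))"
  using assms by (intro continuous_on_compose2[OF assms(1)] continuous_intros) (auto simp: norm_mult)

lemma continuous_radial_remainder:
  assumes "0 \<le> r" "r < 1"
  shows "continuous_on A (radial_remainder \<alpha> r)"
  using norm_one_minus_pos[OF rcis_norm_lt1[OF assms]]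
  unfolding radial_remainder_def[abs_def] by (intro continuous_intros) auto

lemma continuous_radial_conjugate:
  assumes "0 \<le> r" "r < 1"
  shows "continuous_on A (radial_conjugate \<alpha> r)"
  using norm_one_minus_pos[OF rcis_norm_lt1[OF assms]]
  unfolding radial_conjugate_def[abs_def] by (intro continuous_intros) auto

context
  fixes \<phi> g :: "real \<Rightarrow> complex" and N :: "real set" and r \<theta> :: real
  assumes ac: "abs_continuous_on 0 (2 * pi) \<phi>" and per: "\<phi> (2 * pi) = \<phi> 0"
    and N: "negligible N" "\<And>t. t \<in> {0<..<2 * pi} - N \<Longrightarrow> (\<phi> has_vector_derivative g t) (at t)"
    and r: "0 \<le> r" "r < 1"
begin

lemma angular_derivative_representation:
  "((\<lambda>t. poisson_kernel \<alpha> (of_real r * cis (\<theta> - t)) *\<^sub>R g t) has_integral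
     (2 * pi) *\<^sub>R poisson_average_deriv \<alpha> \<phi> (of_real r * cis \<theta>) (\<i> * (of_real r * cis \<theta>))) {0..2 * pi}"
proof -
  have "poisson_gradient \<alpha> (of_real r * cis (\<theta> - t)) \<bullet> (\<i> * (of_real r * cis (\<theta> - t))) =
      rotated_gradient \<alpha> (of_real r * cis \<theta>) t \<bullet> (\<i> * (of_real r * cis \<theta>))" for t
    by (simp add: rotated_gradient_def inner_mult_cis cis_mult mult.assoc)
  moreover have "continuous_on UNIV (\<lambda>s. poisson_gradient \<alpha> (of_real r * cis s) \<bullet> (\<i> * (of_real r * cis s)))"
    using r by (intro continuous_intros continuous_on_rcis_compose[OF continuous_on_poisson_gradient])
  moreover have "cis (s - 2 * pi) = cis s" for s
    by (simp add: complex_eq_iff cos_diff sin_diff)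
  ultimately show ?thesis
    using convolution_by_parts[OF ac per N poisson_kernel_angular_derivative[OF r, of \<alpha>], of \<theta>]
    by (simp add: poisson_average_deriv_def)
qed

lemma radial_derivative_representation:
  "((\<lambda>t. radial_conjugate \<alpha> r (\<theta> - t) *\<^sub>R g t + radial_remainder \<alpha> r (\<theta> - t) *\<^sub>R \<phi> t) has_integral
     (2 * pi) *\<^sub>R poisson_average_deriv \<alpha> \<phi> (of_real r * cis \<theta>) (of_real r * cis \<theta>)) {0..2 * pi}"
proof -
  let ?n = "\<lambda>s. poisson_gradient \<alpha> (of_real r * cis s) \<bullet> (of_real r * cis s)"
  have n: "?n (\<theta> - t) = rotated_gradient \<alpha> (of_real r * cis \<theta>) t \<bullet> (of_real r * cis \<theta>)" for t
    by (simp add: rotated_gradient_def inner_mult_cis cis_mult mult.assoc)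
  have cn: "continuous_on A ?n" for A
    using r by (intro continuous_intros continuous_on_rcis_compose[OF continuous_on_poisson_gradient])
  have c\<phi>: "continuous_on {0..2 * pi} \<phi>"
    by (rule abs_continuous_on_imp_continuous_on[OF ac])
  have in1: "(\<lambda>t. ?n (\<theta> - t) *\<^sub>R \<phi> t) integrable_on {0..2 * pi}"
    by (intro integrable_continuous_real continuous_intros c\<phi> continuous_on_compose2[OF cn[of UNIV]]) auto
  have in2: "(\<lambda>t. radial_remainder \<alpha> r (\<theta> - t) *\<^sub>R \<phi> t) integrable_on {0..2 * pi}"
    by (intro integrable_continuous_real continuous_intros c\<phi>
        continuous_on_compose2[OF continuous_radial_remainder[OF r, of UNIV]]) auto
  have "((\<lambda>t. radial_conjugate \<alpha> r (\<theta> - t) *\<^sub>R g t) has_integral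
     integral {0..2 * pi} (\<lambda>t. (?n (\<theta> - t) - radial_remainder \<alpha> r (\<theta> - t)) *\<^sub>R \<phi> t)) {0..2 * pi}"
  proof (rule convolution_by_parts[OF ac per N radial_conjugate_derivative[OF r]])
    show "continuous_on UNIV (\<lambda>s. ?n s - radial_remainder \<alpha> r s)"
      by (intro continuous_intros cn continuous_radial_remainder[OF r])
    show "radial_conjugate \<alpha> r (s - 2 * pi) = radial_conjugate \<alpha> r s" for s
      by (simp add: radial_conjugate_def norm_one_minus_rcis_cos cos_diff sin_diff)
  qed
  from has_integral_add[OF this integrable_integral[OF in2]]
  have "((\<lambda>t. radial_conjugate \<alpha> r (\<theta> - t) *\<^sub>R g t + radial_remainder \<alpha> r (\<theta> - t) *\<^sub>R \<phi> t) has_integral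
      integral {0..2 * pi} (\<lambda>t. ?n (\<theta> - t) *\<^sub>R \<phi> t)) {0..2 * pi}"
    using in1 in2 by (simp add: scaleR_diff_left integral_diff)
  then show ?thesis
    unfolding n by (simp add: poisson_average_deriv_def)
qed

end

section \<open>Bounded means over concentric circles\<close>

text \<open>
  The property that the Hardy type norm is finite, stated without the normalising factor and
  without the outer \<open>p\<close>-th root.
\<close>
definition bounded_means :: "ereal \<Rightarrow> (complex \<Rightarrow> complex) \<Rightarrow> bool" where
  "bounded_means p h \<longleftrightarrow>
     (if p = \<infinity> then \<exists>B::real. \<forall>z\<in>unit_disc. norm (h z) \<le> B
      else \<exists>B::real. \<forall>r\<in>{0..<1}.
        (\<integral>\<^sup>+\<theta>. ennreal (norm (h (of_real r * cis \<theta>)) powr real_of_ereal p) \<partial>circle_measure) \<le> ennreal B)"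

text \<open>
  Membership in \<open>L\<^sup>p\<close> of the circle for a function of the angle.
\<close>
definition Lp_function :: "ereal \<Rightarrow> (real \<Rightarrow> 'b::real_normed_vector) \<Rightarrow> bool" where
  "Lp_function p g \<longleftrightarrow> g \<in> borel_measurable circle_measure \<and>
     (if p = \<infinity> then \<exists>B::real. AE t in circle_measure. norm (g t) \<le> B
      else (\<integral>\<^sup>+t. ennreal (norm (g t) powr real_of_ereal p) \<partial>circle_measure) < \<infinity>)"

lemma polar_form_0_2pi:
  obtains \<theta> where "\<theta> \<in> {0..2 * pi}" "z = of_real (norm z) * cis \<theta>"
  by (metis Arg2pi_eq Arg2pi_ge_0 Arg2pi_lt_2pi atLeastAtMost_iff cis_conv_exp less_eq_real_def)

lemma finite_circle_measure: "finite_measure circle_measure"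
  by (rule finite_measureI) (simp add: emeasure_restrict_space)

lemma ereal_exponent_cases:
  fixes p :: ereal
  assumes "1 \<le> p"
  obtains "p = \<infinity>" | q where "p = ereal q" "1 \<le> q"
  using assms by (cases p) auto

lemma ennreal_powr_mono: "x \<le> y \<Longrightarrow> 0 \<le> a \<Longrightarrow> ennreal_powr x a \<le> ennreal_powr y a"
  by (cases x; cases y) (auto simp: ennreal_powr_def powr_mono2 top_unique intro!: ennreal_leI)

lemma ennreal_powr_finite_iff: "ennreal_powr x a < top \<longleftrightarrow> x < top"
  by (cases x) (auto simp: ennreal_powr_def)

lemma hardy_norm_finite:
  assumes "1 \<le> p" "bounded_means p h"
  shows "hardy_norm p h < \<infinity>"
  using assms(1)
proof (cases rule: ereal_exponent_cases)
  case 1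
  then obtain B where B: "\<forall>z\<in>unit_disc. norm (h z) \<le> B"
    using assms(2) by (auto simp: bounded_means_def)
  have "hardy_norm p h \<le> ennreal B"
    unfolding hardy_norm_def integral_mean_def using 1
    by (auto intro!: SUP_least ennreal_leI B[rule_format] simp: norm_mult)
  then show ?thesis by (rule le_less_trans) simp
next
  case (2 q)
  then obtain B where B: "\<forall>r\<in>{0..<1}.
      (\<integral>\<^sup>+\<theta>. ennreal (norm (h (of_real r * cis \<theta>)) powr q) \<partial>circle_measure) \<le> ennreal B"
    using assms(2) by (auto simp: bounded_means_def)
  have "hardy_norm p h \<le> ennreal_powr (ennreal (1 / (2 * pi)) * ennreal B) (1 / q)"
    unfolding hardy_norm_def integral_mean_def circle_mean_def using 2
    by (auto intro!: SUP_least ennreal_powr_mono mult_left_mono B[rule_format])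
  also have "\<dots> < \<infinity>"
    by (simp add: ennreal_powr_finite_iff ennreal_mult_less_top)
  finally show ?thesis .
qed

lemma powr_add_le:
  fixes a b q :: real
  assumes "0 \<le> a" "0 \<le> b" "0 \<le> q"
  shows "(a + b) powr q \<le> 2 powr q * (a powr q + b powr q)"
proof -
  have "(a + b) powr q \<le> (2 * max a b) powr q"
    using assms by (intro powr_mono2) auto
  also have "\<dots> = 2 powr q * (max a b) powr q"
    using assms by (simp add: powr_mult)
  also have "\<dots> \<le> 2 powr q * (a powr q + b powr q)"
    by (intro mult_left_mono) (auto simp: max_def)
  finally show ?thesis .
qed

lemma circle_measurable_compose:
  assumes "continuous_on unit_disc a" "0 \<le> r" "r < 1"
  shows "(\<lambda>\<theta>. a (of_real r * cis \<theta>)) \<in> borel_measurable circle_measure"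
  by (intro continuous_imp_measurable_on_sets_lebesgue continuous_on_rcis_compose[OF assms]) auto

text \<open>
  Minkowski's inequality is replaced by the cruder bound \<open>(a + b)\<^sup>q \<le> 2\<^sup>q (a\<^sup>q + b\<^sup>q)\<close>, which is enough for finiteness. Continuity
  of \<open>a\<close> and \<open>b\<close> makes their means additive.
\<close>
lemma bounded_means_dominated:
  assumes "1 \<le> p" and a: "bounded_means p a" "continuous_on unit_disc a"
    and b: "bounded_means p b" "continuous_on unit_disc b"
    and "0 \<le> C" and dom: "\<And>z. z \<in> unit_disc \<Longrightarrow> norm (h z) \<le> C * (norm (a z) + norm (b z) + 1)"
  shows "bounded_means p h"
  using assms(1)
proof (cases rule: ereal_exponent_cases)
  case 1
  then obtain A B where A: "\<forall>z\<in>unit_disc. norm (a z) \<le> A" and B: "\<forall>z\<in>unit_disc. norm (b z) \<le> B"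
    using a b by (auto simp: bounded_means_def)
  have "norm (h z) \<le> C * (A + B + 1)" if "z \<in> unit_disc" for z
    using dom[OF that] A[rule_format, OF that] B[rule_format, OF that] \<open>0 \<le> C\<close>
    by (meson add_mono mult_left_mono order_refl order_trans)
  then show ?thesis
    using 1 unfolding bounded_means_def by (auto intro!: exI[of _ "C * (A + B + 1)"])
next
  case (2 q)
  then obtain A B where
    A: "\<forall>r\<in>{0..<1}. (\<integral>\<^sup>+\<theta>. ennreal (norm (a (of_real r * cis \<theta>)) powr q) \<partial>circle_measure) \<le> ennreal A" and
    B: "\<forall>r\<in>{0..<1}. (\<integral>\<^sup>+\<theta>. ennreal (norm (b (of_real r * cis \<theta>)) powr q) \<partial>circle_measure) \<le> ennreal B"
    using a b by (auto simp: bounded_means_def)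
  define c1 where "c1 = C powr q * 2 powr q"
  define c2 where "c2 = c1 * 2 powr q"
  have c: "c1 \<ge> 0" "c2 \<ge> 0" by (auto simp: c1_def c2_def)
  have pt: "norm (h z) powr q \<le> c2 * norm (a z) powr q + c2 * norm (b z) powr q + c1" if "z \<in> unit_disc" for z
  proof -
    have "norm (h z) powr q \<le> (C * (norm (a z) + norm (b z) + 1)) powr q"
      using dom[OF that] 2 by (intro powr_mono2) auto
    also have "\<dots> = C powr q * (norm (a z) + norm (b z) + 1) powr q"
      using \<open>0 \<le> C\<close> by (simp add: powr_mult)
    also have "\<dots> \<le> C powr q * (2 powr q * ((norm (a z) + norm (b z)) powr q + 1 powr q))"
      using 2 by (intro mult_left_mono powr_add_le) auto
    also have "\<dots> \<le> C powr q * (2 powr q * (2 powr q * (norm (a z) powr q + norm (b z) powr q) + 1 powr q))"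
      using 2 by (intro mult_left_mono add_right_mono powr_add_le) auto
    also have "\<dots> = c2 * norm (a z) powr q + c2 * norm (b z) powr q + c1"
      by (simp add: c1_def c2_def algebra_simps)
    finally show ?thesis .
  qed
  let ?D = "ennreal c2 * ennreal A + ennreal c2 * ennreal B + ennreal c1 * emeasure circle_measure (space circle_measure)"
  have "(\<integral>\<^sup>+\<theta>. ennreal (norm (h (of_real r * cis \<theta>)) powr q) \<partial>circle_measure) \<le> ?D" if r: "r \<in> {0..<1}" for r
  proof -
    let ?a = "\<lambda>\<theta>. ennreal (norm (a (of_real r * cis \<theta>)) powr q)" and ?b = "\<lambda>\<theta>. ennreal (norm (b (of_real r * cis \<theta>)) powr q)"
    have m: "?a \<in> borel_measurable circle_measure" "?b \<in> borel_measurable circle_measure"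
      using circle_measurable_compose[OF a(2), of r] circle_measurable_compose[OF b(2), of r] r by auto
    have "(\<integral>\<^sup>+\<theta>. ennreal (norm (h (of_real r * cis \<theta>)) powr q) \<partial>circle_measure) \<le>
        (\<integral>\<^sup>+\<theta>. ennreal c2 * ?a \<theta> + ennreal c2 * ?b \<theta> + ennreal c1 \<partial>circle_measure)"
    proof (rule nn_integral_mono)
      fix \<theta>
      have "of_real r * cis \<theta> \<in> unit_disc" using r by (simp add: norm_mult)
      from pt[OF this] show "ennreal (norm (h (of_real r * cis \<theta>)) powr q) \<le> ennreal c2 * ?a \<theta> + ennreal c2 * ?b \<theta> + ennreal c1"
        using c by (simp add: ennreal_mult[symmetric] ennreal_plus[symmetric] ennreal_leI del: ennreal_plus)
    qed
    also have "\<dots> = ennreal c2 * (\<integral>\<^sup>+\<theta>. ?a \<theta> \<partial>circle_measure) + ennreal c2 * (\<integral>\<^sup>+\<theta>. ?b \<theta> \<partial>circle_measure)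
        + ennreal c1 * emeasure circle_measure (space circle_measure)"
      using m by (simp add: nn_integral_add nn_integral_cmult)
    also have "\<dots> \<le> ?D"
      by (intro add_mono mult_left_mono A[rule_format] B[rule_format] r order_refl) auto
    finally show ?thesis .
  qed
  moreover have "?D < \<infinity>"
    using finite_measure.emeasure_finite[OF finite_circle_measure, of "space circle_measure"]
    by (auto simp: ennreal_mult_less_top less_top)
  then have D: "ennreal (enn2real ?D) = ?D" by simp
  ultimately have "\<forall>r\<in>{0..<1}. (\<integral>\<^sup>+\<theta>. ennreal (norm (h (of_real r * cis \<theta>)) powr q) \<partial>circle_measure) \<le> ennreal (enn2real ?D)"
    unfolding D by blast
  then show ?thesis
    using 2 unfolding bounded_means_def by auto
qed

lemma Lp_function_integrable:
  fixes g :: "real \<Rightarrow> 'b::{banach, second_countable_topology}"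
  assumes "1 \<le> p" "Lp_function p g"
  shows "integrable circle_measure g"
  using assms(1)
proof (cases rule: ereal_exponent_cases)
  case 1
  interpret finite_measure circle_measure by (rule finite_circle_measure)
  from 1 assms(2) obtain B where "g \<in> borel_measurable circle_measure" "AE t in circle_measure. norm (g t) \<le> B"
    by (auto simp: Lp_function_def)
  then show ?thesis by (intro integrable_const_bound) auto
next
  case (2 q)
  interpret finite_measure circle_measure by (rule finite_circle_measure)
  have m: "g \<in> borel_measurable circle_measure" and
    f: "(\<integral>\<^sup>+t. ennreal (norm (g t) powr q) \<partial>circle_measure) < \<infinity>"
    using 2 assms(2) by (auto simp: Lp_function_def)
  have i: "integrable circle_measure (\<lambda>t. 1 + norm (g t) powr q)"
    using m f by (intro Bochner_Integration.integrable_add integrable_const integrableI_nonneg) auto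
  have "y \<le> 1 + y powr q" if "0 \<le> y" for y :: real
  proof (cases "y \<le> 1")
    case False
    then have "y powr 1 \<le> y powr q" using 2 by (intro powr_mono) auto
    then show ?thesis using False by simp
  qed (use that in \<open>auto intro: order_trans\<close>)
  then show ?thesis
    using m by (intro Bochner_Integration.integrable_bound[OF i m]) auto
qed

lemma norm_integral_le_integral:
  fixes f :: "'a \<Rightarrow> 'b::{banach, second_countable_topology}"
  assumes "integrable M w" "\<And>x. norm (f x) \<le> w x"
  shows "norm (integral\<^sup>L M f) \<le> integral\<^sup>L M w"
proof (cases "integrable M f")
  case True
  then show ?thesis
    using assms by (intro order_trans[OF integral_norm_bound] integral_mono integrable_norm)
next
  case False
  have "0 \<le> w x" for x using assms(2)[of x] norm_ge_zero order_trans by blast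
  then show ?thesis using False by (simp add: not_integrable_integral_eq)
qed

lemma integrable_mult_continuous:
  fixes h u :: "real \<Rightarrow> complex"
  assumes h: "integrable circle_measure h" and u: "continuous_on {0..2 * pi} u"
  shows "integrable circle_measure (\<lambda>t. h t * u t)"
proof -
  have "bounded (u ` {0..2 * pi})"
    using u by (simp add: compact_continuous_image compact_imp_bounded)
  then obtain B where B: "\<forall>t\<in>{0..2 * pi}. norm (u t) \<le> B"
    unfolding bounded_iff by auto
  have um: "u \<in> borel_measurable circle_measure"
    by (rule continuous_imp_measurable_on_sets_lebesgue[OF u]) simp
  show ?thesis
  proof (rule Bochner_Integration.integrable_bound)
    show "integrable circle_measure (\<lambda>t. norm (h t) * B)" using h by simp
    show "(\<lambda>t. h t * u t) \<in> borel_measurable circle_measure" using h um by auto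
    show "AE t in circle_measure. norm (h t * u t) \<le> norm (norm (h t) * B)"
    proof (rule AE_I2)
      fix t assume "t \<in> space circle_measure"
      then have "norm (u t) \<le> \<bar>B\<bar>" using order_trans[OF B[rule_format, of t] abs_ge_self] by simp
      then show "norm (h t * u t) \<le> norm (norm (h t) * B)"
        by (simp add: norm_mult abs_mult mult_left_mono)
    qed
  qed
qed

text \<open>
  The factor \<open>c + 1\<close> instead of \<open>c\<close> keeps the kernel, and with it the constant in Schur's test, strictly
  positive.
\<close>
definition dominating_kernel :: "real \<Rightarrow> real \<Rightarrow> real \<Rightarrow> real \<Rightarrow> real" where
  "dominating_kernel \<beta> c r s = (c + 1) * ((1 - r) powr (\<beta> - 1) * norm (1 - of_real r * cis s) powr (- \<beta>))"

definition schur_const :: "real \<Rightarrow> real \<Rightarrow> real" where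
  "schur_const \<beta> c = (c + 1) * (4 powr \<beta> * (6 * pi / (\<beta> - 1)))"

lemma dominating_kernel_commute: "dominating_kernel \<beta> c r (s - t) = dominating_kernel \<beta> c r (t - s)"
proof -
  have "(norm (1 - of_real r * cis (s - t)))\<^sup>2 = (norm (1 - of_real r * cis (t - s)))\<^sup>2"
    unfolding norm_one_minus_rcis_cos by (simp add: cos_diff mult.commute)
  then have "norm (1 - of_real r * cis (s - t)) = norm (1 - of_real r * cis (t - s))"
    by (simp add: power2_eq_iff_nonneg)
  then show ?thesis by (simp add: dominating_kernel_def)
qed

context
  fixes \<beta> c r :: real
  assumes \<beta>: "1 < \<beta>" and c: "0 \<le> c" and r: "0 \<le> r" "r < 1"
begin

lemma dominating_kernel_nonneg: "0 \<le> dominating_kernel \<beta> c r s"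
  using c by (simp add: dominating_kernel_def)

lemma schur_const_pos: "0 < schur_const \<beta> c"
  using \<beta> c by (simp add: schur_const_def)

lemma nn_integral_dominating_kernel:
  assumes \<theta>: "\<theta> \<in> {0..2 * pi}"
  shows "(\<integral>\<^sup>+t. ennreal (dominating_kernel \<beta> c r (\<theta> - t)) \<partial>circle_measure) \<le> ennreal (schur_const \<beta> c)"
proof -
  have "continuous_on {0..2 * pi} (\<lambda>t. (1 - r) powr (\<beta> - 1) * norm (1 - of_real r * cis (\<theta> - t)) powr (- \<beta>))"
    by (intro continuous_intros) (use norm_one_minus_pos[OF rcis_norm_lt1[OF r]] in auto)
  then have "(\<lambda>t. (1 - r) powr (\<beta> - 1) * norm (1 - of_real r * cis (\<theta> - t)) powr (- \<beta>)) \<in> borel_measurable circle_measure"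
    by (rule continuous_imp_measurable_on_sets_lebesgue) simp
  then have m: "(\<lambda>t. ennreal ((1 - r) powr (\<beta> - 1) * norm (1 - of_real r * cis (\<theta> - t)) powr (- \<beta>))) \<in> borel_measurable circle_measure"
    by (rule measurable_compose[OF _ measurable_ennreal])
  have "(\<integral>\<^sup>+t. ennreal (dominating_kernel \<beta> c r (\<theta> - t)) \<partial>circle_measure) =
     (\<integral>\<^sup>+t. ennreal (c + 1) * ennreal ((1 - r) powr (\<beta> - 1) * norm (1 - of_real r * cis (\<theta> - t)) powr (- \<beta>)) \<partial>circle_measure)"
    using c by (intro nn_integral_cong) (simp only: dominating_kernel_def ennreal_mult[of "c + 1"], simp add: ennreal_mult)
  also have "\<dots> =
     ennreal (c + 1) * (\<integral>\<^sup>+t. ennreal ((1 - r) powr (\<beta> - 1) * norm (1 - of_real r * cis (\<theta> - t)) powr (- \<beta>)) \<partial>circle_measure)"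
    by (rule nn_integral_cmult[OF m])
  also have "\<dots> \<le> ennreal (c + 1) * ennreal (4 powr \<beta> * (6 * pi / (\<beta> - 1)))"
    by (rule mult_left_mono[OF nn_integral_circle_kernel[OF r \<beta> \<theta>]]) simp
  also have "\<dots> = ennreal (schur_const \<beta> c)"
    unfolding schur_const_def by (rule ennreal_mult[symmetric]) (use \<beta> c in auto)
  finally show ?thesis .
qed

lemma dominating_kernel_bounded:
  "dominating_kernel \<beta> c r s \<le> (c + 1) * ((1 - r) powr (\<beta> - 1) * (1 - r) powr (- \<beta>))"
proof -
  have "1 - r = norm (1::complex) - norm (of_real r * cis s)" using r by (simp add: norm_mult)
  also have "\<dots> \<le> norm (1 - of_real r * cis s)" by (rule norm_triangle_ineq2)
  finally show ?thesis
    unfolding dominating_kernel_def using r \<beta> c by (intro mult_left_mono powr_mono2') auto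
qed

lemma continuous_on_dominating_kernel: "continuous_on UNIV (dominating_kernel \<beta> c r)"
  unfolding dominating_kernel_def[abs_def]
  by (intro continuous_intros) (use norm_one_minus_pos[OF rcis_norm_lt1[OF r]] in auto)

lemma dominating_kernel_measurable:
  "(\<lambda>t. dominating_kernel \<beta> c r (\<theta> - t)) \<in> borel_measurable circle_measure"
  by (intro continuous_imp_measurable_on_sets_lebesgue
      continuous_on_compose2[OF continuous_on_dominating_kernel] continuous_intros) auto

lemma integrable_dominating_kernel:
  fixes g :: "real \<Rightarrow> 'b::{banach, second_countable_topology}"
  assumes g: "integrable circle_measure g"
  shows "integrable circle_measure (\<lambda>t. dominating_kernel \<beta> c r (\<theta> - t) * norm (g t))"
proof (rule Bochner_Integration.integrable_bound)
  show "integrable circle_measure (\<lambda>t. ((c + 1) * ((1 - r) powr (\<beta> - 1) * (1 - r) powr (- \<beta>))) * norm (g t))"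
    using g by (intro Bochner_Integration.integrable_mult_right integrable_norm)
  show "(\<lambda>t. dominating_kernel \<beta> c r (\<theta> - t) * norm (g t)) \<in> borel_measurable circle_measure"
    using g dominating_kernel_measurable by auto
  show "AE t in circle_measure. norm (dominating_kernel \<beta> c r (\<theta> - t) * norm (g t)) \<le>
      norm (((c + 1) * ((1 - r) powr (\<beta> - 1) * (1 - r) powr (- \<beta>))) * norm (g t))"
    using dominating_kernel_nonneg dominating_kernel_bounded c
    by (intro always_eventually allI) (auto simp: abs_mult intro!: mult_right_mono)
qed

lemma norm_convolution_le:
  fixes g :: "real \<Rightarrow> 'b::{banach, second_countable_topology}"
  assumes g: "integrable circle_measure g"
    and K: "\<And>s. \<bar>K s\<bar> \<le> c * ((1 - r) powr (\<beta> - 1) * norm (1 - of_real r * cis s) powr (- \<beta>))"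
  shows "norm (\<integral>t. K (\<theta> - t) *\<^sub>R g t \<partial>circle_measure) \<le>
    (\<integral>t. dominating_kernel \<beta> c r (\<theta> - t) * norm (g t) \<partial>circle_measure)"
proof (rule norm_integral_le_integral[OF integrable_dominating_kernel[OF g]])
  fix t
  have "\<bar>K (\<theta> - t)\<bar> \<le> dominating_kernel \<beta> c r (\<theta> - t)"
    using K by (rule order_trans) (auto simp: dominating_kernel_def intro!: mult_right_mono)
  then show "norm (K (\<theta> - t) *\<^sub>R g t) \<le> dominating_kernel \<beta> c r (\<theta> - t) * norm (g t)"
    by (simp add: mult_right_mono)
qed

lemma convolution_Lq_bound:
  fixes g :: "real \<Rightarrow> 'b::{banach, second_countable_topology}"
  assumes g: "integrable circle_measure g"
    and K: "\<And>s. \<bar>K s\<bar> \<le> c * ((1 - r) powr (\<beta> - 1) * norm (1 - of_real r * cis s) powr (- \<beta>))"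
    and q: "1 \<le> q" "(\<integral>\<^sup>+t. ennreal (norm (g t) powr q) \<partial>circle_measure) < \<infinity>"
  shows "(\<integral>\<^sup>+\<theta>. ennreal (norm (\<integral>t. K (\<theta> - t) *\<^sub>R g t \<partial>circle_measure) powr q) \<partial>circle_measure) \<le>
    ennreal (schur_const \<beta> c powr q) * (\<integral>\<^sup>+t. ennreal (norm (g t) powr q) \<partial>circle_measure)"
proof -
  let ?k = "dominating_kernel \<beta> c r"
  have [measurable]: "(\<lambda>x. x) \<in> borel_measurable circle_measure" "?k \<in> borel_measurable borel"
    using borel_measurable_continuous_onI[OF continuous_on_dominating_kernel]
    by (auto intro!: continuous_imp_measurable_on_sets_lebesgue continuous_intros)
  have "(\<integral>\<^sup>+\<theta>. ennreal (norm (\<integral>t. K (\<theta> - t) *\<^sub>R g t \<partial>circle_measure) powr q) \<partial>circle_measure) \<le>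
      (\<integral>\<^sup>+\<theta>. ennreal ((\<integral>t. ?k (\<theta> - t) * norm (g t) \<partial>circle_measure) powr q) \<partial>circle_measure)"
    using q by (intro nn_integral_mono ennreal_leI powr_mono2 norm_convolution_le[OF g K]) auto
  also have "\<dots> \<le> ennreal (schur_const \<beta> c powr q) * (\<integral>\<^sup>+t. ennreal (norm (g t) powr q) \<partial>circle_measure)"
  proof (rule schur_test[OF finite_circle_measure])
    show "(\<lambda>(x, t). ?k (x - t)) \<in> borel_measurable (circle_measure \<Otimes>\<^sub>M circle_measure)" by measurable
    show "(\<integral>\<^sup>+t. ennreal (?k (x - t)) \<partial>circle_measure) \<le> ennreal (schur_const \<beta> c)" if "x \<in> space circle_measure" for x
      using that by (intro nn_integral_dominating_kernel) simp
    show "(\<integral>\<^sup>+x. ennreal (?k (x - t)) \<partial>circle_measure) \<le> ennreal (schur_const \<beta> c)" if "t \<in> space circle_measure" for t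
      unfolding dominating_kernel_commute[of \<beta> c r _ t] using that by (intro nn_integral_dominating_kernel) simp
  qed (use dominating_kernel_nonneg dominating_kernel_bounded schur_const_pos g q in auto)
  finally show ?thesis .
qed

lemma convolution_sup_bound:
  fixes g :: "real \<Rightarrow> 'b::{banach, second_countable_topology}"
  assumes g: "integrable circle_measure g" and B: "AE t in circle_measure. norm (g t) \<le> B"
    and K: "\<And>s. \<bar>K s\<bar> \<le> c * ((1 - r) powr (\<beta> - 1) * norm (1 - of_real r * cis s) powr (- \<beta>))"
    and \<theta>: "\<theta> \<in> {0..2 * pi}"
  shows "norm (\<integral>t. K (\<theta> - t) *\<^sub>R g t \<partial>circle_measure) \<le> schur_const \<beta> c * \<bar>B\<bar>"
proof -
  let ?k = "dominating_kernel \<beta> c r"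
  have ik: "integrable circle_measure (\<lambda>t. ?k (\<theta> - t))"
    using nn_integral_dominating_kernel[OF \<theta>] dominating_kernel_measurable dominating_kernel_nonneg
    by (intro integrableI_nonneg) (auto intro: le_less_trans)
  have "norm (\<integral>t. K (\<theta> - t) *\<^sub>R g t \<partial>circle_measure) \<le> (\<integral>t. ?k (\<theta> - t) * norm (g t) \<partial>circle_measure)"
    by (rule norm_convolution_le[OF g K])
  also have "\<dots> \<le> (\<integral>t. ?k (\<theta> - t) * \<bar>B\<bar> \<partial>circle_measure)"
  proof (rule integral_mono_AE[OF integrable_dominating_kernel[OF g]])
    show "integrable circle_measure (\<lambda>t. ?k (\<theta> - t) * \<bar>B\<bar>)" using ik by simp
    show "AE t in circle_measure. ?k (\<theta> - t) * norm (g t) \<le> ?k (\<theta> - t) * \<bar>B\<bar>"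
      using B by eventually_elim (use dominating_kernel_nonneg in \<open>auto intro!: mult_left_mono\<close>)
  qed
  also have "\<dots> = (\<integral>t. ?k (\<theta> - t) \<partial>circle_measure) * \<bar>B\<bar>" by simp
  also have "(\<integral>t. ?k (\<theta> - t) \<partial>circle_measure) = enn2real (\<integral>\<^sup>+t. ennreal (?k (\<theta> - t)) \<partial>circle_measure)"
    using dominating_kernel_nonneg dominating_kernel_measurable by (intro integral_eq_nn_integral) auto
  also have "\<dots> * \<bar>B\<bar> \<le> schur_const \<beta> c * \<bar>B\<bar>"
    using nn_integral_dominating_kernel[OF \<theta>] schur_const_pos by (intro mult_right_mono enn2real_leI) auto
  finally show ?thesis .
qed

end

text \<open>
  The interface to Schur's test: a family of kernels of the given size maps \<open>L\<^sup>p\<close> of the boundary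
  into functions with bounded means, for every \<open>p\<close> between \<open>1\<close> and \<open>\<infinity>\<close>.
\<close>
lemma bounded_means_convolution:
  fixes K :: "real \<Rightarrow> real \<Rightarrow> real" and g :: "real \<Rightarrow> complex"
  assumes "1 \<le> p" "Lp_function p g" and \<beta>: "\<beta> > 1" and c: "0 \<le> c"
    and K: "\<And>r s. 0 \<le> r \<Longrightarrow> r < 1 \<Longrightarrow>
        \<bar>K r s\<bar> \<le> c * ((1 - r) powr (\<beta> - 1) * norm (1 - of_real r * cis s) powr (- \<beta>))"
    and h: "\<And>r \<theta>. 0 \<le> r \<Longrightarrow> r < 1 \<Longrightarrow> \<theta> \<in> {0..2 * pi} \<Longrightarrow>
        h (of_real r * cis \<theta>) = (\<integral>t. K r (\<theta> - t) *\<^sub>R g t \<partial>circle_measure)"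
  shows "bounded_means p h"
proof -
  note g = Lp_function_integrable[OF assms(1,2)]
  from assms(1) show ?thesis
  proof (cases rule: ereal_exponent_cases)
    case 1
    then obtain B where B: "AE t in circle_measure. norm (g t) \<le> B"
      using assms(2) by (auto simp: Lp_function_def)
    have "norm (h z) \<le> schur_const \<beta> c * \<bar>B\<bar>" if "z \<in> unit_disc" for z
    proof -
      obtain \<theta> where \<theta>: "\<theta> \<in> {0..2 * pi}" "z = of_real (norm z) * cis \<theta>"
        by (rule polar_form_0_2pi)
      have r: "0 \<le> norm z" "norm z < 1" using that by auto
      show ?thesis
        using convolution_sup_bound[OF \<beta> c r g B K[OF r] \<theta>(1)] h[OF r \<theta>(1)] \<theta>(2) by simp
    qed
    then show ?thesis
      using 1 unfolding bounded_means_def by (auto intro!: exI[of _ "schur_const \<beta> c * \<bar>B\<bar>"])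
  next
    case (2 q)
    then have gq: "(\<integral>\<^sup>+t. ennreal (norm (g t) powr q) \<partial>circle_measure) < \<infinity>"
      using assms(2) by (auto simp: Lp_function_def)
    let ?R = "ennreal (schur_const \<beta> c powr q) * (\<integral>\<^sup>+t. ennreal (norm (g t) powr q) \<partial>circle_measure)"
    have "(\<integral>\<^sup>+\<theta>. ennreal (norm (h (of_real r * cis \<theta>)) powr q) \<partial>circle_measure) \<le> ?R" if "r \<in> {0..<1}" for r
    proof -
      have r: "0 \<le> r" "r < 1" using that by auto
      have "(\<integral>\<^sup>+\<theta>. ennreal (norm (h (of_real r * cis \<theta>)) powr q) \<partial>circle_measure) =
          (\<integral>\<^sup>+\<theta>. ennreal (norm (\<integral>t. K r (\<theta> - t) *\<^sub>R g t \<partial>circle_measure) powr q) \<partial>circle_measure)"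
        by (intro nn_integral_cong) (simp add: h[OF r])
      also have "\<dots> \<le> ?R"
        by (rule convolution_Lq_bound[OF \<beta> c r g K[OF r] _ gq]) (use 2 in auto)
      finally show ?thesis .
    qed
    moreover have "?R < \<infinity>" using gq by (simp add: ennreal_mult_less_top)
    then obtain B where "?R = ennreal B"
      by (metis ennreal_enn2real infinity_ennreal_def)
    ultimately have "\<forall>r\<in>{0..<1}. (\<integral>\<^sup>+\<theta>. ennreal (norm (h (of_real r * cis \<theta>)) powr q) \<partial>circle_measure) \<le> ennreal B"
      by simp
    then show ?thesis
      using 2 unfolding bounded_means_def by auto
  qed
qed

section \<open>Boundedness of the polar derivatives\<close>

lemma rcis_kernel_estimates:
  assumes "0 \<le> r" "r < 1"
  shows "1 - r \<le> norm (1 - of_real r * cis s)" "norm (1 - of_real r * cis s) \<le> 2"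
    "0 < 1 - r\<^sup>2" "1 - r\<^sup>2 \<le> 2 * (1 - r)" "\<bar>r * sin s\<bar> \<le> norm (1 - of_real r * cis s)"
    "((norm (1 - of_real r * cis s))\<^sup>2) powr (- (\<alpha> + 2) / 2) = norm (1 - of_real r * cis s) powr (- (\<alpha> + 2))"
proof -
  have nw: "norm (of_real r * cis s) = r" using assms by (simp add: norm_mult)
  show "1 - r \<le> norm (1 - of_real r * cis s)"
    using norm_triangle_ineq2[of 1 "of_real r * cis s"] nw by simp
  show "norm (1 - of_real r * cis s) \<le> 2"
    using norm_triangle_ineq4[of 1 "of_real r * cis s"] nw assms by simp
  show "0 < 1 - r\<^sup>2" using assms by (simp add: power_less_one_iff)
  have "1 - r\<^sup>2 = (1 + r) * (1 - r)" by (simp add: power2_eq_square algebra_simps)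
  also have "\<dots> \<le> 2 * (1 - r)" using assms by (intro mult_right_mono) auto
  finally show "1 - r\<^sup>2 \<le> 2 * (1 - r)" .
  show "\<bar>r * sin s\<bar> \<le> norm (1 - of_real r * cis s)"
    using abs_Im_le_cmod[of "1 - of_real r * cis s"] by simp
  show "((norm (1 - of_real r * cis s))\<^sup>2) powr (- (\<alpha> + 2) / 2) = norm (1 - of_real r * cis s) powr (- (\<alpha> + 2))"
  proof -
    have "((norm (1 - of_real r * cis s))\<^sup>2) powr (- (\<alpha> + 2) / 2) = norm (1 - of_real r * cis s) powr (2 * (- (\<alpha> + 2) / 2))"
      using norm_one_minus_pos[OF rcis_norm_lt1[OF assms, of s]] by (simp only: powr_powr powr_numeral[symmetric])
    also have "2 * (- (\<alpha> + 2) / 2) = - (\<alpha> + 2)" by simp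
    finally show ?thesis .
  qed
qed

lemma poisson_kernel_bound:
  assumes r: "0 \<le> r" "r < 1" and "-1 < \<alpha>"
  shows "\<bar>poisson_kernel \<alpha> (of_real r * cis s)\<bar> \<le>
    (\<bar>poisson_const \<alpha>\<bar> * 2 powr (\<alpha> + 1)) * ((1 - r) powr ((\<alpha> + 2) - 1) * norm (1 - of_real r * cis s) powr (- (\<alpha> + 2)))"
proof -
  let ?m = "norm (1 - of_real r * cis s)"
  note e = rcis_kernel_estimates(1,2,5)[OF r, of s] rcis_kernel_estimates(3,4)[OF r] rcis_kernel_estimates(6)[OF r, of s \<alpha>]
  have pw: "(2 * (1 - r)) powr c = 2 powr c * (1 - r) powr c" for c
    by (rule powr_mult)
  have "\<bar>poisson_kernel \<alpha> (of_real r * cis s)\<bar> = \<bar>poisson_const \<alpha>\<bar> * ((1 - r\<^sup>2) powr (\<alpha> + 1) * ?m powr (- (\<alpha> + 2)))"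
    using r by (simp add: poisson_kernel_def norm_mult abs_mult powr_minus_divide del: minus_add_distrib)
  also have "\<dots> \<le> \<bar>poisson_const \<alpha>\<bar> * ((2 * (1 - r)) powr (\<alpha> + 1) * ?m powr (- (\<alpha> + 2)))"
    using e assms by (intro mult_left_mono mult_right_mono powr_mono2) auto
  also have "\<dots> = (\<bar>poisson_const \<alpha>\<bar> * 2 powr (\<alpha> + 1)) * ((1 - r) powr ((\<alpha> + 2) - 1) * ?m powr (- (\<alpha> + 2)))"
    unfolding pw by (simp add: add.commute)
  finally show ?thesis .
qed

lemma radial_conjugate_bound:
  assumes r: "0 \<le> r" "r < 1" and "0 \<le> \<alpha>"
  shows "\<bar>radial_conjugate \<alpha> r s\<bar> \<le>
    (2 * \<bar>poisson_const \<alpha>\<bar> * 2 powr \<alpha>) * ((1 - r) powr ((\<alpha> + 1) - 1) * norm (1 - of_real r * cis s) powr (- (\<alpha> + 1)))"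
proof -
  let ?m = "norm (1 - of_real r * cis s)"
  note e = rcis_kernel_estimates(1,2,5)[OF r, of s] rcis_kernel_estimates(3,4)[OF r] rcis_kernel_estimates(6)[OF r, of s \<alpha>]
  have pw: "(2 * (1 - r)) powr c = 2 powr c * (1 - r) powr c" for c
    by (rule powr_mult)
  have m: "?m > 0" using norm_one_minus_pos[OF rcis_norm_lt1[OF r]] .
  have mm: "?m * ?m powr (- (\<alpha> + 2)) = ?m powr (- (\<alpha> + 1))"
    using powr_mult_base[of ?m "- (\<alpha> + 2)"] m by (simp add: algebra_simps)
  have "\<bar>radial_conjugate \<alpha> r s\<bar> = 2 * \<bar>poisson_const \<alpha>\<bar> * ((1 - r\<^sup>2) powr \<alpha> * (\<bar>r * sin s\<bar> * ?m powr (- (\<alpha> + 2))))"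
    unfolding radial_conjugate_def e(6) by (simp add: abs_mult mult.assoc)
  also have "\<dots> \<le> 2 * \<bar>poisson_const \<alpha>\<bar> * ((2 * (1 - r)) powr \<alpha> * (?m * ?m powr (- (\<alpha> + 2))))"
    using e assms by (intro mult_left_mono mult_mono mult_right_mono powr_mono2) auto
  also have "\<dots> = (2 * \<bar>poisson_const \<alpha>\<bar> * 2 powr \<alpha>) * ((1 - r) powr ((\<alpha> + 1) - 1) * ?m powr (- (\<alpha> + 1)))"
    unfolding mm pw by simp
  finally show ?thesis .
qed

text \<open>
  Since \<open>1 - r \<le> |1 - w| \<le> 2\<close>, the factor \<open>(1 - r\<^sup>2) - |1 - w|\<^sup>2\<close> is at most \<open>4 |1 - w|\<close> in absolute
  value and lowers the order of the singularity by one.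
\<close>
lemma radial_remainder_bound:
  assumes r: "0 \<le> r" "r < 1" and "0 \<le> \<alpha>"
  shows "\<bar>radial_remainder \<alpha> r s\<bar> \<le>
    (2 * \<bar>poisson_const \<alpha>\<bar> * \<alpha> * 2 powr \<alpha>) * ((1 - r) powr ((\<alpha> + 1) - 1) * norm (1 - of_real r * cis s) powr (- (\<alpha> + 1)))"
proof -
  let ?m = "norm (1 - of_real r * cis s)"
  note e = rcis_kernel_estimates(1,2,5)[OF r, of s] rcis_kernel_estimates(3,4)[OF r] rcis_kernel_estimates(6)[OF r, of s \<alpha>]
  have pw: "(2 * (1 - r)) powr c = 2 powr c * (1 - r) powr c" for c
    by (rule powr_mult)
  have m: "?m > 0" using norm_one_minus_pos[OF rcis_norm_lt1[OF r]] .
  have mm: "?m * ?m powr (- (\<alpha> + 2)) = ?m powr (- (\<alpha> + 1))"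
    using powr_mult_base[of ?m "- (\<alpha> + 2)"] m by (simp add: algebra_simps)
  have "?m\<^sup>2 \<le> 2 * ?m" unfolding power2_eq_square using e by (intro mult_right_mono) auto
  note m2 = this
  have aux: "\<bar>x - y\<bar> \<le> 4 * m" if "0 < x" "x \<le> 2 * D" "D \<le> m" "y \<le> 2 * m" "0 \<le> y" for x y m D :: real
    using that by linarith
  have d: "\<bar>(1 - r\<^sup>2) - ?m\<^sup>2\<bar> \<le> 4 * ?m"
    by (rule aux[OF e(4,5,1) m2]) simp
  have "\<bar>radial_remainder \<alpha> r s\<bar> = \<bar>poisson_const \<alpha>\<bar> * (\<alpha> / 2) * ((1 - r\<^sup>2) powr \<alpha> * (\<bar>(1 - r\<^sup>2) - ?m\<^sup>2\<bar> * ?m powr (- (\<alpha> + 2))))"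
    unfolding radial_remainder_def e(6) using assms by (simp add: abs_mult mult.assoc)
  also have "\<dots> \<le> \<bar>poisson_const \<alpha>\<bar> * (\<alpha> / 2) * ((2 * (1 - r)) powr \<alpha> * ((4 * ?m) * ?m powr (- (\<alpha> + 2))))"
    using e assms d by (intro mult_left_mono mult_mono mult_right_mono powr_mono2) auto
  also have "\<dots> = \<bar>poisson_const \<alpha>\<bar> * (\<alpha> / 2) * ((2 * (1 - r)) powr \<alpha> * (4 * (?m * ?m powr (- (\<alpha> + 2)))))"
    by simp
  also have "\<dots> = (2 * \<bar>poisson_const \<alpha>\<bar> * \<alpha> * 2 powr \<alpha>) * ((1 - r) powr ((\<alpha> + 1) - 1) * ?m powr (- (\<alpha> + 1)))"
    unfolding mm pw by simp
  finally show ?thesis .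
qed

lemma integrable_convolution:
  fixes g :: "real \<Rightarrow> complex" and \<kappa> :: "real \<Rightarrow> real"
  assumes g: "integrable circle_measure g" and \<kappa>: "continuous_on UNIV \<kappa>"
  shows "integrable circle_measure (\<lambda>t. \<kappa> (\<theta> - t) *\<^sub>R g t)"
proof -
  have "continuous_on {0..2 * pi} (\<lambda>t. \<theta> - t)" by (intro continuous_intros)
  then have "continuous_on {0..2 * pi} (\<lambda>t. complex_of_real (\<kappa> (\<theta> - t)))"
    by (intro continuous_intros continuous_on_compose2[OF \<kappa>]) auto
  from integrable_mult_continuous[OF g this] show ?thesis
    by (simp add: scaleR_conv_of_real mult.commute)
qed

lemma has_integral_imp_circle_integral:
  fixes h :: "real \<Rightarrow> complex"
  assumes "integrable circle_measure h" "(h has_integral I) {0..2 * pi}"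
  shows "integral\<^sup>L circle_measure h = I"
  using lebesgue_integral_eq_integral[OF assms(1)] integral_unique[OF assms(2)] by simp

context
  fixes \<phi> g :: "real \<Rightarrow> complex" and N :: "real set" and p :: ereal and \<alpha> :: real
  assumes ac: "abs_continuous_on 0 (2 * pi) \<phi>" and per: "\<phi> (2 * pi) = \<phi> 0"
    and N: "negligible N" "\<And>t. t \<in> {0<..<2 * pi} - N \<Longrightarrow> (\<phi> has_vector_derivative g t) (at t)"
    and p: "1 \<le> p" and g: "Lp_function p g" and \<alpha>: "-1 < \<alpha>"
begin

abbreviation "angular_deriv \<equiv> (\<lambda>z. poisson_average_deriv \<alpha> \<phi> z (\<i> * z))"
abbreviation "radial_deriv \<equiv> (\<lambda>z. poisson_average_deriv \<alpha> \<phi> z z)"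

lemma boundary_derivative_integrable: "integrable circle_measure g"
  by (rule Lp_function_integrable[OF p g])

lemma boundary_function_continuous: "continuous_on {0..2 * pi} \<phi>"
  by (rule abs_continuous_on_imp_continuous_on[OF ac])

lemma angular_derivative_bounded_means: "bounded_means p angular_deriv"
proof (rule bounded_means_convolution[OF p g, where \<beta> = "\<alpha> + 2"
      and c = "\<bar>poisson_const \<alpha>\<bar> * 2 powr (\<alpha> + 1) / (2 * pi)"
      and K = "\<lambda>r s. poisson_kernel \<alpha> (of_real r * cis s) / (2 * pi)"])
  show "1 < \<alpha> + 2" using \<alpha> by simp
  show "0 \<le> \<bar>poisson_const \<alpha>\<bar> * 2 powr (\<alpha> + 1) / (2 * pi)" by simp
  show "\<bar>poisson_kernel \<alpha> (of_real r * cis s) / (2 * pi)\<bar> \<le> (\<bar>poisson_const \<alpha>\<bar> * 2 powr (\<alpha> + 1) / (2 * pi)) *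
      ((1 - r) powr ((\<alpha> + 2) - 1) * norm (1 - of_real r * cis s) powr (- (\<alpha> + 2)))"
    if "0 \<le> r" "r < 1" for r s
    using divide_right_mono[OF poisson_kernel_bound[OF that \<alpha>, of s], of "2 * pi"] by (simp add: abs_divide)
  fix r \<theta> :: real assume r: "0 \<le> r" "r < 1"
  have int: "integrable circle_measure (\<lambda>t. poisson_kernel \<alpha> (of_real r * cis (\<theta> - t)) *\<^sub>R g t)"
    by (rule integrable_convolution[OF boundary_derivative_integrable, of "\<lambda>s. poisson_kernel \<alpha> (of_real r * cis s)"])
       (rule continuous_on_rcis_compose[OF continuous_on_poisson_kernel r])
  have sc: "(x / (2 * pi)) *\<^sub>R y = (1 / (2 * pi)) *\<^sub>R (x *\<^sub>R y)" for x and y :: complex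
    by simp
  have "(\<integral>t. (poisson_kernel \<alpha> (of_real r * cis (\<theta> - t)) / (2 * pi)) *\<^sub>R g t \<partial>circle_measure) =
     (\<integral>t. (1 / (2 * pi)) *\<^sub>R (poisson_kernel \<alpha> (of_real r * cis (\<theta> - t)) *\<^sub>R g t) \<partial>circle_measure)"
    by (intro Bochner_Integration.integral_cong refl sc)
  also have "\<dots> = (1 / (2 * pi)) *\<^sub>R (\<integral>t. poisson_kernel \<alpha> (of_real r * cis (\<theta> - t)) *\<^sub>R g t \<partial>circle_measure)"
    by (rule integral_scaleR_right)
  also have "\<dots> = angular_deriv (of_real r * cis \<theta>)"
    using has_integral_imp_circle_integral[OF int angular_derivative_representation[OF ac per N r]] by simp
  finally show "angular_deriv (of_real r * cis \<theta>) = (\<integral>t. (poisson_kernel \<alpha> (of_real r * cis (\<theta> - t)) / (2 * pi)) *\<^sub>R g t \<partial>circle_measure)"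
    by (rule sym)
qed

lemma continuous_on_poisson_average_deriv_diag:
  assumes "continuous_on unit_disc u"
  shows "continuous_on unit_disc (\<lambda>z. poisson_average_deriv \<alpha> \<phi> z (u z))"
proof -
  have eq: "poisson_average_deriv \<alpha> \<phi> z (u z) =
      Re (u z) *\<^sub>R poisson_average_deriv \<alpha> \<phi> z 1 + Im (u z) *\<^sub>R poisson_average_deriv \<alpha> \<phi> z \<i>" if "z \<in> unit_disc" for z
  proof -
    have z: "norm z < 1" using that by simp
    note P = partials_of_poisson_average[of "poisson_average \<alpha> \<phi>" \<alpha> \<phi> z, OF refl boundary_function_continuous z]
    show ?thesis using P(4)[of "u z"] unfolding P(1,2) .
  qed
  have "continuous_on unit_disc (\<lambda>z. Re (u z) *\<^sub>R poisson_average_deriv \<alpha> \<phi> z 1 + Im (u z) *\<^sub>R poisson_average_deriv \<alpha> \<phi> z \<i>)"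
    by (intro continuous_intros assms continuous_on_poisson_average_deriv boundary_function_continuous)
  then show ?thesis by (rule continuous_on_eq) (rule eq[symmetric])
qed

lemma boundary_function_Lp: "Lp_function p \<phi>"
proof -
  have m: "\<phi> \<in> borel_measurable circle_measure"
    by (intro continuous_imp_measurable_on_sets_lebesgue boundary_function_continuous) simp
  have "bounded (\<phi> ` {0..2 * pi})"
    using boundary_function_continuous by (simp add: compact_continuous_image compact_imp_bounded)
  then obtain B where B: "\<forall>t\<in>{0..2 * pi}. norm (\<phi> t) \<le> B"
    unfolding bounded_iff by auto
  from p show ?thesis
  proof (cases rule: ereal_exponent_cases)
    case 1
    have "AE t in circle_measure. norm (\<phi> t) \<le> B" using B by (intro AE_I2) auto
    with 1 m show ?thesis unfolding Lp_function_def by auto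
  next
    case (2 q)
    have "(\<integral>\<^sup>+t. ennreal (norm (\<phi> t) powr q) \<partial>circle_measure) \<le> (\<integral>\<^sup>+t. ennreal (B powr q) \<partial>circle_measure)"
      using 2 B by (intro nn_integral_mono ennreal_leI powr_mono2) auto
    also have "\<dots> < \<infinity>"
      using finite_measure.emeasure_finite[OF finite_circle_measure, of "space circle_measure"]
      by (auto simp: ennreal_mult_less_top less_top)
    finally show ?thesis using 2 m by (simp add: Lp_function_def)
  qed
qed

text \<open>
  The remainder term is harmless for every \<open>\<alpha> \<ge> 0\<close>, so only the convolution of \<open>g\<close> with the conjugate kernel has to be
  controlled, by Schur's test or by M. Riesz's theorem. Its continuity comes for
  free: it is the difference of the radial derivative and the remainder term, both of which
  are continuous in \<open>z\<close>.
\<close>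
lemma radial_derivative_bounded_means:
  assumes conj: "\<And>a. continuous_on unit_disc a \<Longrightarrow>
      (\<And>r \<theta>. 0 \<le> r \<Longrightarrow> r < 1 \<Longrightarrow> \<theta> \<in> {0..2 * pi} \<Longrightarrow> a (of_real r * cis \<theta>) = (\<integral>t. (radial_conjugate \<alpha> r (\<theta> - t)) *\<^sub>R g t \<partial>circle_measure)) \<Longrightarrow>
      bounded_means p a" and "0 \<le> \<alpha>"
  shows "bounded_means p radial_deriv"
proof -
  define \<rho> where "\<rho> w = poisson_const \<alpha> * (\<alpha> / 2) * (1 - (norm w)\<^sup>2) powr \<alpha> *
     ((1 - (norm w)\<^sup>2) - (norm (1 - w))\<^sup>2) * ((norm (1 - w))\<^sup>2) powr (- (\<alpha> + 2) / 2)" for w :: complex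
  have \<rho>: "\<rho> (of_real r * cis s) = radial_remainder \<alpha> r s" if "0 \<le> r" for r s
    using that by (simp add: \<rho>_def radial_remainder_def norm_mult)
  have c\<rho>: "continuous_on unit_disc \<rho>"
    unfolding \<rho>_def[abs_def]
    by (intro continuous_intros) (use norm_one_minus_pos one_minus_norm_power_pos in \<open>force+\<close>)
  define b where "b z = integral {0..2 * pi} (\<lambda>t. \<rho> (z * cis (- t)) *\<^sub>R \<phi> t)" for z
  have "continuous_on (unit_disc \<times> cbox 0 (2 * pi)) (\<lambda>(z, t). \<rho> (z * cis (- t)) *\<^sub>R \<phi> t)"
    unfolding case_prod_beta
    by (intro continuous_intros continuous_on_compose2[OF c\<rho>] continuous_on_compose2[OF boundary_function_continuous]) (auto simp: norm_mult)
  from integral_continuous_on_param[OF this] have cb: "continuous_on unit_disc b"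
    unfolding b_def[abs_def] by simp
  have brep: "b (of_real r * cis \<theta>) = (\<integral>t. radial_remainder \<alpha> r (\<theta> - t) *\<^sub>R \<phi> t \<partial>circle_measure)"
    and bint: "integrable circle_measure (\<lambda>t. radial_remainder \<alpha> r (\<theta> - t) *\<^sub>R \<phi> t)"
    if r: "0 \<le> r" "r < 1" for r \<theta>
  proof -
    show int: "integrable circle_measure (\<lambda>t. radial_remainder \<alpha> r (\<theta> - t) *\<^sub>R \<phi> t)"
      by (rule integrable_convolution[OF Lp_function_integrable[OF p boundary_function_Lp] continuous_radial_remainder[OF r]])
    have "b (of_real r * cis \<theta>) = integral {0..2 * pi} (\<lambda>t. radial_remainder \<alpha> r (\<theta> - t) *\<^sub>R \<phi> t)"
      unfolding b_def using r by (simp add: \<rho>[symmetric] mult.assoc cis_mult)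
    then show "b (of_real r * cis \<theta>) = (\<integral>t. radial_remainder \<alpha> r (\<theta> - t) *\<^sub>R \<phi> t \<partial>circle_measure)"
      using lebesgue_integral_eq_integral[OF int] by simp
  qed
  have bb: "bounded_means p b"
  proof (cases "\<alpha> = 0")
    case True
    then have "radial_remainder \<alpha> r s = 0" for r s by (simp add: radial_remainder_def)
    then show ?thesis
      by (intro bounded_means_convolution[OF p boundary_function_Lp, of 2 0 "radial_remainder \<alpha>"] brep) auto
  next
    case False
    show ?thesis
    proof (rule bounded_means_convolution[OF p boundary_function_Lp, where \<beta> = "\<alpha> + 1"
        and c = "2 * \<bar>poisson_const \<alpha>\<bar> * \<alpha> * 2 powr \<alpha>" and K = "radial_remainder \<alpha>"])
      show "\<bar>radial_remainder \<alpha> r s\<bar> \<le> 2 * \<bar>poisson_const \<alpha>\<bar> * \<alpha> * 2 powr \<alpha> *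
          ((1 - r) powr ((\<alpha> + 1) - 1) * norm (1 - of_real r * cis s) powr (- (\<alpha> + 1)))"
        if "0 \<le> r" "r < 1" for r s
        by (rule radial_remainder_bound[OF that \<open>0 \<le> \<alpha>\<close>])
    qed (use False \<open>0 \<le> \<alpha>\<close> in \<open>auto intro: brep\<close>)
  qed
  define a where "a z = (2 * pi) *\<^sub>R radial_deriv z - b z" for z
  have ca: "continuous_on unit_disc a"
    unfolding a_def[abs_def] by (intro continuous_intros cb continuous_on_poisson_average_deriv_diag)
  have ba: "bounded_means p a"
  proof (rule conj[OF ca])
    fix r \<theta> :: real assume r: "0 \<le> r" "r < 1"
    have int: "integrable circle_measure (\<lambda>t. radial_conjugate \<alpha> r (\<theta> - t) *\<^sub>R g t)"
      by (rule integrable_convolution[OF boundary_derivative_integrable continuous_radial_conjugate[OF r]])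
    have "integral\<^sup>L circle_measure (\<lambda>t. radial_conjugate \<alpha> r (\<theta> - t) *\<^sub>R g t + radial_remainder \<alpha> r (\<theta> - t) *\<^sub>R \<phi> t)
       = (2 * pi) *\<^sub>R radial_deriv (of_real r * cis \<theta>)"
      by (intro has_integral_imp_circle_integral radial_derivative_representation[OF ac per N r]
          Bochner_Integration.integrable_add int bint[OF r])
    note e = this[unfolded Bochner_Integration.integral_add[OF int bint[OF r]], symmetric]
    show "a (of_real r * cis \<theta>) = (\<integral>t. (radial_conjugate \<alpha> r (\<theta> - t)) *\<^sub>R g t \<partial>circle_measure)"
      unfolding a_def brep[OF r] e by (rule add_diff_cancel_right')
  qed
  have "norm (radial_deriv z) \<le> 1 * (norm (a z) + norm (b z) + 1)" for z
  proof -
    have "1 * norm (radial_deriv z) \<le> (2 * pi) * norm (radial_deriv z)"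
      using pi_gt3 by (intro mult_right_mono) auto
    also have "\<dots> = norm (a z + b z)" by (simp add: a_def)
    also have "\<dots> \<le> 1 * (norm (a z) + norm (b z) + 1)" using norm_triangle_ineq[of "a z" "b z"] by simp
    finally show ?thesis by simp
  qed
  then show ?thesis
    by (intro bounded_means_dominated[OF p ba ca bb cb, of 1]) auto
qed

lemma radial_derivative_bounded_means_pos:
  assumes "0 < \<alpha>"
  shows "bounded_means p radial_deriv"
proof (rule radial_derivative_bounded_means)
  fix a :: "complex \<Rightarrow> complex"
  assume "\<And>r \<theta>. 0 \<le> r \<Longrightarrow> r < 1 \<Longrightarrow> \<theta> \<in> {0..2 * pi} \<Longrightarrow>
    a (of_real r * cis \<theta>) = (\<integral>t. radial_conjugate \<alpha> r (\<theta> - t) *\<^sub>R g t \<partial>circle_measure)"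
  then show "bounded_means p a"
    using assms by (intro bounded_means_convolution[OF p g _ _ radial_conjugate_bound]) auto
qed (use assms in auto)

end

section \<open>Herglotz integrals\<close>

definition cauchy_transform :: "(real \<Rightarrow> complex) \<Rightarrow> complex \<Rightarrow> complex" where
  "cauchy_transform h z = (\<integral>t. h t / (1 - z * cis (- t)) \<partial>circle_measure)"

definition herglotz :: "(real \<Rightarrow> complex) \<Rightarrow> complex \<Rightarrow> complex" where
  "herglotz h z = (\<integral>t. h t * ((1 + z * cis (- t)) / (1 - z * cis (- t))) \<partial>circle_measure) / (2 * pi)"

lemma one_minus_mult_cis_nonzero: "norm z < 1 \<Longrightarrow> 1 - z * cis t \<noteq> 0"
  using norm_one_minus_pos[of "z * cis t"] by (simp add: norm_mult)

text \<open>
  Expanding \<open>1 / (1 - z e\<^sup>-\<^sup>i\<^sup>t)\<close> into a geometric series shows that the Cauchy transform of a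
  merely integrable density is holomorphic.
\<close>
lemma cauchy_transform_sums:
  assumes h: "integrable circle_measure h" and z: "norm z < 1"
  shows "(\<lambda>n. (\<integral>t. h t * cis (- t) ^ n \<partial>circle_measure) * z ^ n) sums cauchy_transform h z"
proof -
  let ?f = "\<lambda>n t. h t * (z * cis (- t)) ^ n"
  have int: "integrable circle_measure (?f n)" for n
    by (intro integrable_mult_continuous h continuous_intros)
  have nf: "norm (?f n t) = norm (h t) * norm z ^ n" for n t
    by (simp add: norm_mult norm_power)
  have "(\<lambda>n. integral\<^sup>L circle_measure (?f n)) sums (\<integral>t. (\<Sum>n. ?f n t) \<partial>circle_measure)"
  proof (rule sums_integral[OF int])
    show "AE t in circle_measure. summable (\<lambda>n. norm (?f n t))"
      unfolding nf using z by (intro always_eventually allI summable_mult summable_geometric) simp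
    show "summable (\<lambda>n. \<integral>t. norm (?f n t) \<partial>circle_measure)"
      unfolding nf using z by (simp add: summable_mult summable_geometric)
  qed
  moreover have "(\<Sum>n. ?f n t) = h t / (1 - z * cis (- t))" for t
  proof -
    have n1: "norm (z * cis (- t)) < 1" using z by (simp add: norm_mult)
    show ?thesis
      using suminf_mult[OF summable_geometric[OF n1], of "h t"] suminf_geometric[OF n1] by simp
  qed
  moreover have "integral\<^sup>L circle_measure (?f n) = (\<integral>t. h t * cis (- t) ^ n \<partial>circle_measure) * z ^ n" for n
  proof -
    have eq: "?f n t = (h t * cis (- t) ^ n) * z ^ n" for t by (simp add: power_mult_distrib mult_ac)
    show ?thesis unfolding eq by (rule integral_mult_left_zero)
  qed
  ultimately show ?thesis by (simp add: cauchy_transform_def)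
qed

lemma herglotz_eq_cauchy_transform:
  assumes h: "integrable circle_measure h" and z: "norm z < 1"
  shows "herglotz h z = (2 * cauchy_transform h z - integral\<^sup>L circle_measure h) / (2 * pi)"
proof -
  have i: "integrable circle_measure (\<lambda>t. h t * (1 / (1 - z * cis (- t))))"
    by (intro integrable_mult_continuous h continuous_intros) (use one_minus_mult_cis_nonzero[OF z] in auto)
  have "(\<integral>t. h t * ((1 + z * cis (- t)) / (1 - z * cis (- t))) \<partial>circle_measure) =
      (\<integral>t. 2 * (h t * (1 / (1 - z * cis (- t)))) - h t \<partial>circle_measure)"
    using one_minus_mult_cis_nonzero[OF z] by (intro Bochner_Integration.integral_cong) (auto simp: field_simps)
  also have "\<dots> = 2 * (\<integral>t. h t * (1 / (1 - z * cis (- t))) \<partial>circle_measure) - integral\<^sup>L circle_measure h"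
  proof -
    have "(\<integral>t. 2 * k t - h t \<partial>circle_measure) = 2 * integral\<^sup>L circle_measure k - integral\<^sup>L circle_measure h"
      if "integrable circle_measure k" for k :: "real \<Rightarrow> complex"
      using that h by simp
    from this[OF i] show ?thesis .
  qed
  finally show ?thesis by (simp add: herglotz_def cauchy_transform_def)
qed

lemma herglotz_holomorphic:
  assumes h: "integrable circle_measure h"
  shows "herglotz h holomorphic_on unit_disc"
proof -
  have "cauchy_transform h holomorphic_on ball 0 1"
    by (rule power_series_holomorphic[of 0 1 "\<lambda>n. \<integral>t. h t * cis (- t) ^ n \<partial>circle_measure"])
       (use cauchy_transform_sums[OF h] in auto)
  then have "(\<lambda>z. (2 * cauchy_transform h z - integral\<^sup>L circle_measure h) / (2 * pi)) holomorphic_on unit_disc"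
    by (intro holomorphic_intros) auto
  then show ?thesis
    by (rule holomorphic_transform) (use herglotz_eq_cauchy_transform[OF h] in auto)
qed

lemma herglotz_0: "herglotz h 0 = integral\<^sup>L circle_measure h / (2 * pi)"
  by (simp add: herglotz_def)

lemma herglotz_diff:
  assumes "integrable circle_measure h" "integrable circle_measure k" "norm z < 1"
  shows "herglotz (\<lambda>t. h t - k t) z = herglotz h z - herglotz k z"
proof -
  have "integrable circle_measure (\<lambda>t. u t * ((1 + z * cis (- t)) / (1 - z * cis (- t))))"
    if "integrable circle_measure u" for u
    by (intro integrable_mult_continuous that continuous_intros) (use one_minus_mult_cis_nonzero[OF assms(3)] in auto)
  then show ?thesis
    using assms by (simp add: herglotz_def left_diff_distrib diff_divide_distrib)
qed

lemma Re_Im_cayley: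
  assumes "norm w < 1"
  shows "Re ((1 + w) / (1 - w)) = (1 - (norm w)\<^sup>2) / (norm (1 - w))\<^sup>2"
    "Im ((1 + w) / (1 - w)) = 2 * Im w / (norm (1 - w))\<^sup>2"
proof -
  have "(1 + w) / (1 - w) = ((1 + w) * cnj (1 - w)) / of_real ((norm (1 - w))\<^sup>2)"
    using complex_div_cnj[of "1 + w" "1 - w"] by simp
  then show "Re ((1 + w) / (1 - w)) = (1 - (norm w)\<^sup>2) / (norm (1 - w))\<^sup>2"
    "Im ((1 + w) / (1 - w)) = 2 * Im w / (norm (1 - w))\<^sup>2"
    unfolding cmod_power2[of w]
    by (simp_all only: Re_divide_of_real Im_divide_of_real) (simp_all add: power2_eq_square algebra_simps)
qed

text \<open>
  Real and imaginary part are the convolutions of the density with the Poisson kernel and with its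
  conjugate.
\<close>
lemma herglotz_Re_Im:
  fixes u :: "real \<Rightarrow> real"
  assumes u: "integrable circle_measure u" and r: "0 \<le> r" "r < 1"
  shows "Re (herglotz (\<lambda>t. of_real (u t)) (of_real r * cis \<theta>)) =
      (\<integral>t. ((1 - r\<^sup>2) / (2 * pi * (norm (1 - of_real r * cis (\<theta> - t)))\<^sup>2)) *\<^sub>R u t \<partial>circle_measure)"
    "2 * pi * Im (herglotz (\<lambda>t. of_real (u t)) (of_real r * cis \<theta>)) =
      (\<integral>t. radial_conjugate 0 r (\<theta> - t) * u t \<partial>circle_measure)"
proof -
  let ?w = "\<lambda>t. of_real r * cis (\<theta> - t)"
  have w: "of_real r * cis \<theta> * cis (- t) = ?w t" for t by (simp add: mult.assoc cis_mult)
  let ?f = "\<lambda>t. complex_of_real (u t) * ((1 + ?w t) / (1 - ?w t))"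
  have i: "integrable circle_measure ?f"
    using norm_one_minus_pos[OF rcis_norm_lt1[OF r]]
    by (intro integrable_mult_continuous continuous_intros) (use u in auto)
  have H: "herglotz (\<lambda>t. of_real (u t)) (of_real r * cis \<theta>) = integral\<^sup>L circle_measure ?f / of_real (2 * pi)"
    by (simp add: herglotz_def w)
  have nw: "norm (?w t) = r" for t using r by (simp add: norm_mult)
  have ReI: "Re (complex_of_real a * c) = a * Re c" "Im (complex_of_real a * c) = a * Im c" for a c by simp_all
  have "Re (herglotz (\<lambda>t. of_real (u t)) (of_real r * cis \<theta>)) = (\<integral>t. Re (?f t) \<partial>circle_measure) / (2 * pi)"
    unfolding H Re_divide_of_real using integral_Re[OF i] by simp
  also have "\<dots> = (\<integral>t. Re (?f t) / (2 * pi) \<partial>circle_measure)" by simp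
  also have "\<dots> = (\<integral>t. ((1 - r\<^sup>2) / (2 * pi * (norm (1 - of_real r * cis (\<theta> - t)))\<^sup>2)) *\<^sub>R u t \<partial>circle_measure)"
    unfolding ReI Re_Im_cayley(1)[OF rcis_norm_lt1[OF r]] nw
    by (intro Bochner_Integration.integral_cong) (simp_all add: mult.commute)
  finally show "Re (herglotz (\<lambda>t. of_real (u t)) (of_real r * cis \<theta>)) =
      (\<integral>t. ((1 - r\<^sup>2) / (2 * pi * (norm (1 - of_real r * cis (\<theta> - t)))\<^sup>2)) *\<^sub>R u t \<partial>circle_measure)" .
  have C0: "poisson_const 0 = 1" by (simp add: poisson_const_def)
  have d: "(1 - r\<^sup>2) powr 0 = 1" using one_minus_norm_power_pos[OF rcis_norm_lt1[OF r, of 0]] nw[of \<theta>] by simp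
  have conj: "radial_conjugate 0 r s = Im ((1 + of_real r * cis s) / (1 - of_real r * cis s))" for s
    unfolding Re_Im_cayley(2)[OF rcis_norm_lt1[OF r]] radial_conjugate_def C0 d
    using norm_one_minus_pos[OF rcis_norm_lt1[OF r, of s]] by (simp add: powr_minus_divide)
  have "2 * pi * Im (herglotz (\<lambda>t. of_real (u t)) (of_real r * cis \<theta>)) = (\<integral>t. Im (?f t) \<partial>circle_measure)"
    unfolding H Im_divide_of_real using integral_Im[OF i] by simp
  also have "\<dots> = (\<integral>t. radial_conjugate 0 r (\<theta> - t) * u t \<partial>circle_measure)"
    unfolding conj ReI by (intro Bochner_Integration.integral_cong) simp_all
  finally show "2 * pi * Im (herglotz (\<lambda>t. of_real (u t)) (of_real r * cis \<theta>)) =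
      (\<integral>t. radial_conjugate 0 r (\<theta> - t) * u t \<partial>circle_measure)" .
qed

lemma Re_complex_powr:
  assumes "\<zeta> \<noteq> 0"
  shows "Re (\<zeta> powr of_real q) = norm \<zeta> powr q * cos (q * Arg \<zeta>)"
proof -
  have "Re (\<zeta> powr of_real q) = exp (q * ln (norm \<zeta>)) * cos (q * Im (Ln \<zeta>))"
    using assms by (simp add: powr_def Re_exp)
  then show ?thesis
    using assms by (simp add: powr_def Arg_def)
qed

text \<open>
  In polar coordinates \<open>\<zeta> = |\<zeta>| e\<^sup>i\<^sup>\<theta>\<close> the claim reads \<open>1 \<le> A (cos \<theta>)\<^sup>q + b cos (q \<theta>)\<close> for \<open>|\<theta>| < pi/2\<close>. Near the boundary
  rays the second term is at least \<open>1\<close> for a suitable \<open>b\<close> of the sign of \<open>cos (q pi/2)\<close>, and away from them \<open>cos \<theta>\<close> is bounded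
  below, so that a large \<open>A\<close> makes up for a negative second term.
\<close>
lemma sector_inequality:
  fixes q :: real
  assumes q: "1 < q" and c: "cos (q * pi / 2) \<noteq> 0"
  obtains A b where "0 \<le> A"
    "\<And>\<zeta>::complex. 0 < Re \<zeta> \<Longrightarrow> norm \<zeta> powr q \<le> A * Re \<zeta> powr q + b * Re (\<zeta> powr of_real q)"
proof -
  define s m where "s = sgn (cos (q * pi / 2))" and "m = \<bar>cos (q * pi / 2)\<bar> / 2"
  have m: "m > 0" using c by (simp add: m_def)
  have sc: "s * cos (q * pi / 2) = 2 * m" by (simp add: s_def m_def abs_sgn mult.commute)
  have s1: "\<bar>s\<bar> = 1" using c by (simp add: s_def abs_sgn_eq)
  have "isCont (\<lambda>x. cos (q * x)) (pi / 2)" by (intro continuous_intros)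
  then obtain d where d: "d > 0" "\<And>x. \<bar>x - pi / 2\<bar> < d \<Longrightarrow> \<bar>cos (q * x) - cos (q * (pi / 2))\<bar> < m"
    using m unfolding continuous_at_eps_delta dist_real_def by blast
  \<comment> \<open>For \<open>\<gamma> \<le> |\<theta>| < pi/2\<close> the number \<open>cos (q \<theta>)\<close> keeps at least half of its boundary value, whose modulus is \<open>2 m\<close>.\<close>
  define \<gamma> where "\<gamma> = pi / 2 - min d (pi / 2) / 2"
  have \<gamma>: "0 < \<gamma>" "\<gamma> < pi / 2" "pi / 2 - \<gamma> < d"
    using d(1) pi_gt_zero by (auto simp: \<gamma>_def min_def field_simps)
  have cg: "cos \<gamma> > 0" using \<gamma> by (intro cos_gt_zero_pi) auto
  define A where "A = (1 + 1 / m) / cos \<gamma> powr q"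
  have A0: "A \<ge> 0" using m by (simp add: A_def)
  have key: "1 \<le> A * cos \<theta> powr q + s / m * cos (q * \<theta>)" if \<theta>: "\<bar>\<theta>\<bar> < pi / 2" for \<theta>
  proof (cases "\<bar>\<theta>\<bar> < \<gamma>")
    case True
    have "cos \<gamma> \<le> cos \<bar>\<theta>\<bar>" using True \<gamma> by (intro cos_monotone_0_pi_le) auto
    then have "cos \<gamma> powr q \<le> cos \<theta> powr q" using cg q by (intro powr_mono2) (auto simp: abs_if split: if_splits)
    then have "A * cos \<gamma> powr q \<le> A * cos \<theta> powr q" by (intro mult_left_mono A0)
    moreover have "A * cos \<gamma> powr q = 1 + 1 / m" using cg by (simp add: A_def)
    moreover have "\<bar>s / m * cos (q * \<theta>)\<bar> \<le> 1 / m * 1"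
      using m s1 unfolding abs_mult abs_divide by (intro mult_mono) auto
    moreover have "1 \<le> X + Y" if "1 + c \<le> X" "\<bar>Y\<bar> \<le> c" for X Y c :: real using that by linarith
    ultimately show ?thesis by simp
  next
    case False
    have "\<bar>\<bar>\<theta>\<bar> - pi / 2\<bar> < d" using False \<theta> \<gamma> by auto
    then have "\<bar>cos (q * \<bar>\<theta>\<bar>) - cos (q * pi / 2)\<bar> < m" using d(2)[of "\<bar>\<theta>\<bar>"] by simp
    moreover have "cos (q * \<bar>\<theta>\<bar>) = cos (q * \<theta>)" by (cases "\<theta> \<ge> 0") auto
    ultimately have "\<bar>s * (cos (q * \<theta>) - cos (q * pi / 2))\<bar> < m" using s1 by (simp add: abs_mult)
    then have "m \<le> s * cos (q * \<theta>)" using sc by (simp add: right_diff_distrib abs_less_iff)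
    then have "1 \<le> s / m * cos (q * \<theta>)" using m by (simp add: field_simps)
    moreover have "0 \<le> A * cos \<theta> powr q" using A0 by simp
    ultimately show ?thesis by linarith
  qed
  show ?thesis
  proof (rule that[OF A0])
    fix \<zeta> :: complex assume \<zeta>: "0 < Re \<zeta>"
    then have \<zeta>0: "\<zeta> \<noteq> 0" by auto
    have arg: "\<bar>Arg \<zeta>\<bar> < pi / 2" using Arg_Re_pos[of \<zeta>] \<zeta> by blast
    have "Re \<zeta> = norm \<zeta> * cos (Arg \<zeta>)"
      using arg_cong[OF rcis_cmod_Arg[of \<zeta>], of Re] by (simp add: rcis_def)
    then have Re: "Re \<zeta> powr q = norm \<zeta> powr q * cos (Arg \<zeta>) powr q"
      by (simp add: powr_mult)
    have "norm \<zeta> powr q * 1 \<le> norm \<zeta> powr q * (A * cos (Arg \<zeta>) powr q + s / m * cos (q * Arg \<zeta>))"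
      by (intro mult_left_mono key arg) simp
    also have "\<dots> = A * Re \<zeta> powr q + s / m * Re (\<zeta> powr of_real q)"
      unfolding Re Re_complex_powr[OF \<zeta>0] by (simp add: algebra_simps)
    finally show "norm \<zeta> powr q \<le> A * Re \<zeta> powr q + s / m * Re (\<zeta> powr of_real q)" by simp
  qed
qed

lemma cauchy_formula_circle:
  fixes f :: "complex \<Rightarrow> complex"
  assumes f: "f holomorphic_on ball 0 R" and r: "0 < r" "r < R" and w: "norm w < r"
  shows "((\<lambda>t. f (of_real r * cis t) * (of_real r * cis t) / (of_real r * cis t - w)) has_integral 2 * pi * f w) {0..2 * pi}"
proof -
  have "((\<lambda>u. f u / (u - w)) has_contour_integral (2 * of_real pi * \<i> * f w)) (circlepath 0 r)"
  proof (rule Cauchy_integral_circlepath)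
    show "continuous_on (cball 0 r) f"
      by (rule holomorphic_on_imp_continuous_on, rule holomorphic_on_subset[OF f]) (use r in auto)
    show "f holomorphic_on ball 0 r" by (rule holomorphic_on_subset[OF f]) (use r in auto)
  qed (use w in simp)
  then have "((\<lambda>t. f (of_real r * cis t) / (of_real r * cis t - w) * of_real r * \<i> * cis t) has_integral
      2 * of_real pi * \<i> * f w) {0..2 * pi}"
    unfolding circlepath_def by (subst (asm) has_contour_integral_part_circlepath_iff) auto
  from has_integral_mult_right[OF this, of "- \<i>"] show ?thesis
    by (simp add: field_simps)
qed

lemma circle_integral_continuous:
  fixes h :: "real \<Rightarrow> 'b::euclidean_space"
  assumes "continuous_on {0..2 * pi} h" "(h has_integral I) {0..2 * pi}"
  shows "integrable circle_measure h" "integral\<^sup>L circle_measure h = I"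
proof -
  show i: "integrable circle_measure h"
    by (rule continuous_imp_integrable_real[OF assms(1)])
  show "integral\<^sup>L circle_measure h = I"
    using lebesgue_integral_eq_integral[OF i] integral_unique[OF assms(2)] by simp
qed

lemma holomorphic_rcis_continuous:
  fixes f :: "complex \<Rightarrow> complex"
  assumes "f holomorphic_on ball 0 R" "0 \<le> r" "r < R"
  shows "continuous_on A (\<lambda>t. f (of_real r * cis t))"
  by (rule continuous_on_compose2[OF holomorphic_on_imp_continuous_on[OF assms(1)]])
     (use assms in \<open>auto intro!: continuous_intros simp: norm_mult\<close>)

lemma measure_circle: "measure circle_measure (space circle_measure) = 2 * pi"
  by (simp add: measure_restrict_space)

lemma circle_mean_value:
  fixes f :: "complex \<Rightarrow> complex"
  assumes f: "f holomorphic_on ball 0 R" and r: "0 \<le> r" "r < R"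
  shows "(\<integral>t. f (of_real r * cis t) \<partial>circle_measure) = 2 * pi * f 0"
proof (cases "r = 0")
  case True
  then show ?thesis using measure_circle by (simp add: scaleR_conv_of_real)
next
  case False
  then have r0: "0 < r" using r by simp
  have "((\<lambda>t. f (of_real r * cis t)) has_integral 2 * pi * f 0) {0..2 * pi}"
    using cauchy_formula_circle[OF f r0 r(2), of 0] r0 by simp
  then show ?thesis
    by (intro circle_integral_continuous(2) holomorphic_rcis_continuous[OF f r])
qed

section \<open>M. Riesz's theorem\<close>

text \<open>
  M. Riesz's theorem for nonnegative densities, with a constant independent of the density and the
  radius. The summand \<open>1\<close> pays for shifting the Herglotz integral by a constant,
  which keeps its values away from the imaginary axis.
\<close>
definition riesz_bound :: "real \<Rightarrow> bool" where
  "riesz_bound q \<longleftrightarrow> (\<exists>C\<ge>0. \<forall>u::real \<Rightarrow> real. (\<forall>t. 0 \<le> u t) \<longrightarrow> u \<in> borel_measurable circle_measure \<longrightarrow>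
     integrable circle_measure (\<lambda>t. u t powr q) \<longrightarrow>
     (\<forall>r\<in>{0..<1}. (\<integral>\<theta>. norm (herglotz (\<lambda>t. of_real (u t)) (of_real r * cis \<theta>)) powr q \<partial>circle_measure)
        \<le> C * (1 + (\<integral>t. u t powr q \<partial>circle_measure))))"

lemma continuous_norm_powr_integrable:
  fixes h :: "real \<Rightarrow> 'b::real_normed_vector"
  assumes "continuous_on {0..2 * pi} h" "0 < q"
  shows "integrable circle_measure (\<lambda>t. norm (h t) powr q)"
  by (rule continuous_imp_integrable_real, rule continuous_on_powr') (use assms in \<open>auto intro!: continuous_intros\<close>)

context
  fixes u :: "real \<Rightarrow> real" and q :: real
  assumes u0: "\<And>t. 0 \<le> u t" and um: "u \<in> borel_measurable circle_measure"
    and uq: "integrable circle_measure (\<lambda>t. u t powr q)" and q: "1 \<le> q"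
begin

lemma Lq_integrable: "integrable circle_measure u"
proof (rule Lp_function_integrable[of "ereal q"])
  have "(\<integral>\<^sup>+t. ennreal (u t powr q) \<partial>circle_measure) < \<infinity>"
    using nn_integral_eq_integral[OF uq] by simp
  then show "Lp_function (ereal q) u" using um u0 by (simp add: Lp_function_def)
qed (use q in simp)

lemma herglotz_Lq_holomorphic: "herglotz (\<lambda>t. of_real (u t)) holomorphic_on unit_disc"
  using Lq_integrable by (intro herglotz_holomorphic) auto

lemma norm_herglotz_0_powr_le:
  "norm (herglotz (\<lambda>t. of_real (u t)) 0) powr q \<le> (\<integral>t. u t powr q \<partial>circle_measure) / (2 * pi)"
proof -
  have I: "integral\<^sup>L circle_measure (\<lambda>t. complex_of_real (u t)) = of_real (integral\<^sup>L circle_measure u)"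
    by (rule integral_complex_of_real)
  have "norm (herglotz (\<lambda>t. of_real (u t)) 0) = \<bar>integral\<^sup>L circle_measure u\<bar> / (2 * pi)"
    unfolding herglotz_0 I by (simp add: norm_divide)
  also have "\<dots> = (\<integral>t. 1 / (2 * pi) * u t \<partial>circle_measure)"
    using u0 by (simp add: integral_nonneg_AE)
  finally have e: "norm (herglotz (\<lambda>t. of_real (u t)) 0) = (\<integral>t. 1 / (2 * pi) * u t \<partial>circle_measure)" .
  have "(\<integral>t. 1 / (2 * pi) * u t \<partial>circle_measure) powr q \<le> 1 powr (q - 1) * (\<integral>t. 1 / (2 * pi) * u t powr q \<partial>circle_measure)"
  proof (rule weighted_power_mean(2)[OF _ _ um u0 _ q])
    show "integrable circle_measure (\<lambda>t. 1 / (2 * pi))"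
      using finite_measure.integrable_const[OF finite_circle_measure] .
    show "integral\<^sup>L circle_measure (\<lambda>t. 1 / (2 * pi)) \<le> 1"
      using measure_circle by simp
  qed (use uq in auto)
  then show ?thesis unfolding e by simp
qed

lemma Re_herglotz_nonneg:
  assumes r: "0 \<le> r" "r < 1"
  shows "0 \<le> Re (herglotz (\<lambda>t. of_real (u t)) (of_real r * cis \<theta>))"
proof -
  have "r\<^sup>2 \<le> 1" using r by (simp add: power_le_one)
  then show ?thesis
    unfolding herglotz_Re_Im(1)[OF Lq_integrable r] using u0 by (intro integral_nonneg_AE) auto
qed

lemma Re_herglotz_Lq_bound:
  assumes r: "0 \<le> r" "r < 1"
  shows "(\<integral>\<theta>. Re (herglotz (\<lambda>t. of_real (u t)) (of_real r * cis \<theta>)) powr q \<partial>circle_measure) \<le>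
    schur_const 2 1 powr q * (\<integral>t. u t powr q \<partial>circle_measure)"
proof -
  let ?K = "\<lambda>s. (1 - r\<^sup>2) / (2 * pi * (norm (1 - of_real r * cis s))\<^sup>2)"
  have K: "\<bar>?K s\<bar> \<le> 1 * ((1 - r) powr (2 - 1) * norm (1 - of_real r * cis s) powr (- 2))" for s
  proof -
    have m: "norm (1 - of_real r * cis s) > 0" by (rule norm_one_minus_pos[OF rcis_norm_lt1[OF r]])
    have d: "0 \<le> 1 - r\<^sup>2" using r by (simp add: power_le_one)
    have "(1 - r\<^sup>2) = (1 - r) * (1 + r)" by (simp add: power2_eq_square algebra_simps)
    also have "\<dots> \<le> (1 - r) * (2 * pi)" using r pi_gt3 by (intro mult_left_mono) auto
    finally have "(1 - r\<^sup>2) / (2 * pi) \<le> 1 - r" by (simp add: divide_le_eq)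
    then have "(1 - r\<^sup>2) / (2 * pi) / (norm (1 - of_real r * cis s))\<^sup>2 \<le> (1 - r) / (norm (1 - of_real r * cis s))\<^sup>2"
      by (intro divide_right_mono) auto
    moreover have "\<bar>?K s\<bar> = (1 - r\<^sup>2) / (2 * pi) / (norm (1 - of_real r * cis s))\<^sup>2"
      using d by (simp add: abs_mult)
    moreover have "(1 - r) / (norm (1 - of_real r * cis s))\<^sup>2 = 1 * ((1 - r) powr (2 - 1) * norm (1 - of_real r * cis s) powr (- 2))"
      using m r by (simp add: powr_minus_divide)
    ultimately show ?thesis by linarith
  qed
  let ?P = "\<lambda>\<theta>. Re (herglotz (\<lambda>t. of_real (u t)) (of_real r * cis \<theta>))"
  have nn: "(\<integral>\<^sup>+t. ennreal (u t powr q) \<partial>circle_measure) = ennreal (\<integral>t. u t powr q \<partial>circle_measure)"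
    by (rule nn_integral_eq_integral[OF uq]) simp
  have P: "norm (\<integral>t. ?K (\<theta> - t) *\<^sub>R u t \<partial>circle_measure) = ?P \<theta>" for \<theta>
    using Re_herglotz_nonneg[OF r, of \<theta>] unfolding herglotz_Re_Im(1)[OF Lq_integrable r] by simp
  have "(\<integral>\<^sup>+\<theta>. ennreal (?P \<theta> powr q) \<partial>circle_measure) \<le>
      ennreal (schur_const 2 1 powr q) * (\<integral>\<^sup>+t. ennreal (norm (u t) powr q) \<partial>circle_measure)"
    unfolding P[symmetric]
    by (rule convolution_Lq_bound[OF _ _ r Lq_integrable K q]) (use nn u0 in auto)
  also have "\<dots> = ennreal (schur_const 2 1 powr q * (\<integral>t. u t powr q \<partial>circle_measure))"
    using u0 nn by (simp add: ennreal_mult')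
  finally have le: "(\<integral>\<^sup>+\<theta>. ennreal (?P \<theta> powr q) \<partial>circle_measure) \<le> \<dots>" .
  have "continuous_on {0..2 * pi} ?P"
    by (intro continuous_intros holomorphic_rcis_continuous[OF herglotz_Lq_holomorphic r])
  then have "?P \<in> borel_measurable circle_measure"
    by (rule continuous_imp_measurable_on_sets_lebesgue) simp
  then have "(\<integral>\<theta>. ?P \<theta> powr q \<partial>circle_measure) = enn2real (\<integral>\<^sup>+\<theta>. ennreal (?P \<theta> powr q) \<partial>circle_measure)"
    by (intro integral_eq_nn_integral) auto
  also have "\<dots> \<le> schur_const 2 1 powr q * (\<integral>t. u t powr q \<partial>circle_measure)"
    by (rule enn2real_leI[OF _ le]) (auto intro!: mult_nonneg_nonneg integral_nonneg_AE)
  finally show ?thesis .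
qed

end

lemma integrable_const_circle: "integrable circle_measure (\<lambda>t. c :: 'b::{banach, second_countable_topology})"
  by (rule finite_measure.integrable_const[OF finite_circle_measure])

text \<open>
  The function \<open>f = H + 1\<close>, with \<open>H\<close> the Herglotz integral, has real part at least \<open>1\<close>, so that \<open>f\<^sup>q\<close> is holomorphic and its mean over the
  circle is \<open>f(0)\<^sup>q\<close>. Integrating the sector inequality bounds the mean of \<open>|f|\<^sup>q\<close> by that of \<open>(Re f)\<^sup>q\<close>, to which Schur's test
  applies, and by \<open>|f(0)|\<^sup>q\<close>.
\<close>
lemma riesz_bound_base:
  fixes q :: real
  assumes q: "1 < q" and c: "cos (q * pi / 2) \<noteq> 0"
  shows "riesz_bound q"
proof -
  obtain A b where A: "0 \<le> A" and Ab:
    "\<And>\<zeta>::complex. 0 < Re \<zeta> \<Longrightarrow> norm \<zeta> powr q \<le> A * Re \<zeta> powr q + b * Re (\<zeta> powr of_real q)"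
    using sector_inequality[OF assms] by metis
  define S where "S = schur_const 2 1 powr q"
  define T where "T = (2::real) powr q"
  define C where "C = T * (2 * pi + A * (T * (2 * pi + S)) + \<bar>b\<bar> * (2 * pi) * (T * 2))"
  have S0: "S \<ge> 0" and T0: "T \<ge> 0" by (auto simp: S_def T_def)
  then have C0: "C \<ge> 0" using A by (simp add: C_def)
  have "(\<integral>\<theta>. norm (herglotz (\<lambda>t. of_real (u t)) (of_real r * cis \<theta>)) powr q \<partial>circle_measure)
      \<le> C * (1 + (\<integral>t. u t powr q \<partial>circle_measure))"
    if u: "\<forall>t. 0 \<le> u t" "u \<in> borel_measurable circle_measure" "integrable circle_measure (\<lambda>t. u t powr q)"
      and "r \<in> {0..<1}" for u :: "real \<Rightarrow> real" and r
  proof -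
    have r: "0 \<le> r" "r < 1" using that by auto
    note uu = u(1)[rule_format] u(2,3) less_imp_le[OF q]
    let ?H = "herglotz (\<lambda>t. of_real (u t))"
    define U where "U = (\<integral>t. u t powr q \<partial>circle_measure)"
    have U0: "U \<ge> 0" unfolding U_def by (intro integral_nonneg_AE) auto
    \<comment> \<open>Adding 1 moves the range off the imaginary axis, which a vanishing density would reach.\<close>
    define f where "f z = ?H z + 1" for z
    have fh: "f holomorphic_on unit_disc"
      unfolding f_def by (intro holomorphic_intros herglotz_Lq_holomorphic[OF uu])
    have w1: "norm (of_real r * cis \<theta>) < 1" for \<theta> using rcis_norm_lt1[OF r] .
    have fpos: "0 < Re (f z)" if "norm z < 1" for z
    proof -
      have "0 \<le> Re (?H (of_real (norm z) * cis (Arg z)))"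
        using that by (intro Re_herglotz_nonneg[OF uu]) auto
      also have "of_real (norm z) * cis (Arg z) = z" using rcis_cmod_Arg[of z] by (simp add: rcis_def)
      finally show ?thesis by (simp add: f_def)
    qed
    have Hc: "continuous_on {0..2 * pi} (\<lambda>\<theta>. ?H (of_real r * cis \<theta>))"
      by (rule holomorphic_rcis_continuous[OF herglotz_Lq_holomorphic[OF uu] r])
    have fc: "continuous_on {0..2 * pi} (\<lambda>\<theta>. f (of_real r * cis \<theta>))"
      by (rule holomorphic_rcis_continuous[OF fh r])
    have q0: "0 < q" using q by simp
    have gh: "(\<lambda>z. f z powr of_real q) holomorphic_on unit_disc"
      using fpos by (intro holomorphic_intros fh) (auto simp: complex_nonpos_Reals_iff dest!: fpos)
    have mv: "(\<integral>\<theta>. f (of_real r * cis \<theta>) powr of_real q \<partial>circle_measure) = 2 * pi * f 0 powr of_real q"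
      by (rule circle_mean_value[OF gh r])
    have gi: "integrable circle_measure (\<lambda>\<theta>. f (of_real r * cis \<theta>) powr of_real q)"
      by (rule continuous_imp_integrable_real[OF holomorphic_rcis_continuous[OF gh r]])
    have Hi: "integrable circle_measure (\<lambda>\<theta>. norm (?H (of_real r * cis \<theta>)) powr q)"
      by (rule continuous_norm_powr_integrable[OF Hc q0])
    have fi: "integrable circle_measure (\<lambda>\<theta>. norm (f (of_real r * cis \<theta>)) powr q)"
      by (rule continuous_norm_powr_integrable[OF fc q0])
    have Rc: "continuous_on {0..2 * pi} (\<lambda>\<theta>. Re (?H (of_real r * cis \<theta>)))"
      by (intro continuous_intros Hc)
    have Ri: "integrable circle_measure (\<lambda>\<theta>. Re (?H (of_real r * cis \<theta>)) powr q)"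
      using continuous_norm_powr_integrable[OF Rc q0] Re_herglotz_nonneg[OF uu r] by simp
    have Rfc: "continuous_on {0..2 * pi} (\<lambda>\<theta>. Re (f (of_real r * cis \<theta>)))"
      by (intro continuous_intros fc)
    have Rfi: "integrable circle_measure (\<lambda>\<theta>. Re (f (of_real r * cis \<theta>)) powr q)"
      using continuous_norm_powr_integrable[OF Rfc q0] fpos[OF w1] by (simp add: abs_of_pos)
    have 1: "(\<integral>\<theta>. Re (f (of_real r * cis \<theta>)) powr q \<partial>circle_measure) \<le> T * (2 * pi + S * U)"
    proof -
      have "(\<integral>\<theta>. Re (f (of_real r * cis \<theta>)) powr q \<partial>circle_measure) \<le>
          (\<integral>\<theta>. T * (Re (?H (of_real r * cis \<theta>)) powr q + 1) \<partial>circle_measure)"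
      proof (rule integral_mono[OF Rfi])
        show "integrable circle_measure (\<lambda>\<theta>. T * (Re (?H (of_real r * cis \<theta>)) powr q + 1))"
          using Ri integrable_const_circle by (intro Bochner_Integration.integrable_mult_right Bochner_Integration.integrable_add)
        fix \<theta>
        show "Re (f (of_real r * cis \<theta>)) powr q \<le> T * (Re (?H (of_real r * cis \<theta>)) powr q + 1)"
          using powr_add_le[of "Re (?H (of_real r * cis \<theta>))" 1 q] Re_herglotz_nonneg[OF uu r] q0
          by (simp add: f_def T_def)
      qed
      also have "\<dots> = T * ((\<integral>\<theta>. Re (?H (of_real r * cis \<theta>)) powr q \<partial>circle_measure) + 2 * pi)"
        using Ri integrable_const_circle measure_circle by simp
      also have "\<dots> \<le> T * (S * U + 2 * pi)"
        using Re_herglotz_Lq_bound[OF uu r] T0 by (intro mult_left_mono add_right_mono) (auto simp: S_def U_def)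
      finally show ?thesis by (simp add: add.commute)
    qed
    have f0: "norm (f 0) powr q \<le> T * (1 + U)"
    proof -
      have "norm (f 0) powr q \<le> (norm (?H 0) + 1) powr q"
        unfolding f_def using q0 norm_triangle_ineq[of "?H 0" 1] by (intro powr_mono2) auto
      also have "\<dots> \<le> T * (norm (?H 0) powr q + 1)"
        using powr_add_le[of "norm (?H 0)" 1 q] q0 by (simp add: T_def)
      also have "\<dots> \<le> T * (U / (2 * pi) + 1)"
        using norm_herglotz_0_powr_le[OF uu] T0 by (intro mult_left_mono add_right_mono) (auto simp: U_def)
      also have "\<dots> \<le> T * (U + 1)"
      proof (intro mult_left_mono add_right_mono T0)
        have "U * 1 \<le> U * (2 * pi)" using U0 pi_gt3 by (intro mult_left_mono) auto
        then show "U / (2 * pi) \<le> U" by (simp add: divide_le_eq)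
      qed
      finally show ?thesis by (simp add: add.commute)
    qed
    have 2: "b * Re (2 * pi * f 0 powr of_real q) \<le> \<bar>b\<bar> * (2 * pi) * (T * (1 + U))"
    proof -
      have "b * Re (2 * pi * f 0 powr of_real q) \<le> \<bar>b * Re (2 * pi * f 0 powr of_real q)\<bar>" by simp
      also have "\<dots> \<le> \<bar>b\<bar> * norm (2 * pi * f 0 powr of_real q)"
        unfolding abs_mult by (intro mult_left_mono abs_Re_le_cmod) auto
      also have "norm (2 * pi * f 0 powr of_real q) = 2 * pi * norm (f 0) powr q"
        by (simp add: norm_mult norm_powr_real_powr')
      also have "\<bar>b\<bar> * (2 * pi * norm (f 0) powr q) \<le> \<bar>b\<bar> * (2 * pi * (T * (1 + U)))"
        using f0 by (intro mult_left_mono) auto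
      finally show ?thesis by (simp add: mult.assoc)
    qed
    have 3: "(\<integral>\<theta>. norm (f (of_real r * cis \<theta>)) powr q \<partial>circle_measure) \<le>
        A * (T * (2 * pi + S * U)) + \<bar>b\<bar> * (2 * pi) * (T * (1 + U))"
    proof -
      have "(\<integral>\<theta>. norm (f (of_real r * cis \<theta>)) powr q \<partial>circle_measure) \<le>
          (\<integral>\<theta>. A * Re (f (of_real r * cis \<theta>)) powr q + b * Re (f (of_real r * cis \<theta>) powr of_real q) \<partial>circle_measure)"
        using Rfi gi by (intro integral_mono[OF fi] Ab fpos w1) auto
      also have "\<dots> = A * (\<integral>\<theta>. Re (f (of_real r * cis \<theta>)) powr q \<partial>circle_measure) +
          b * (\<integral>\<theta>. Re (f (of_real r * cis \<theta>) powr of_real q) \<partial>circle_measure)"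
        using Rfi gi by simp
      also have "(\<integral>\<theta>. Re (f (of_real r * cis \<theta>) powr of_real q) \<partial>circle_measure) = Re (2 * pi * f 0 powr of_real q)"
        unfolding integral_Re[OF gi] mv by simp
      finally show ?thesis
        using mult_left_mono[OF 1 A] 2 by linarith
    qed
    have "(\<integral>\<theta>. norm (?H (of_real r * cis \<theta>)) powr q \<partial>circle_measure) \<le>
        (\<integral>\<theta>. T * (norm (f (of_real r * cis \<theta>)) powr q + 1) \<partial>circle_measure)"
    proof (rule integral_mono[OF Hi])
      show "integrable circle_measure (\<lambda>\<theta>. T * (norm (f (of_real r * cis \<theta>)) powr q + 1))"
        using fi integrable_const_circle by (intro Bochner_Integration.integrable_mult_right Bochner_Integration.integrable_add)
      fix \<theta>
      let ?z = "of_real r * cis \<theta>"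
      have "norm (?H ?z) powr q \<le> (norm (f ?z) + 1) powr q"
        using q0 norm_triangle_ineq4[of "f ?z" 1] by (intro powr_mono2) (auto simp: f_def)
      also have "\<dots> \<le> T * (norm (f ?z) powr q + 1)"
        using powr_add_le[of "norm (f ?z)" 1 q] q0 by (simp add: T_def)
      finally show "norm (?H ?z) powr q \<le> T * (norm (f ?z) powr q + 1)" .
    qed
    also have "\<dots> = T * ((\<integral>\<theta>. norm (f (of_real r * cis \<theta>)) powr q \<partial>circle_measure) + 2 * pi)"
      using fi integrable_const_circle measure_circle by simp
    also have "\<dots> \<le> T * (A * (T * (2 * pi + S * U)) + \<bar>b\<bar> * (2 * pi) * (T * (1 + U)) + 2 * pi)"
      using 3 T0 by (intro mult_left_mono add_right_mono) auto
    also have "\<dots> \<le> T * (A * (T * ((2 * pi + S) * (1 + U))) + \<bar>b\<bar> * (2 * pi) * (T * (2 * (1 + U))) + 2 * pi * (1 + U))"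
      using U0 S0 A T0 by (intro mult_left_mono add_mono) (auto simp: algebra_simps)
    also have "\<dots> = C * (1 + U)" by (simp add: C_def algebra_simps)
    finally show ?thesis by (simp add: U_def)
  qed
  then show ?thesis unfolding riesz_bound_def using C0 by blast
qed

text \<open>
  Writing \<open>2 Re f = f + cnj f\<close> in the Cauchy transform, the first summand reproduces \<open>f(z)\<close> by Cauchy's
  formula; the second is the conjugate of a mean of the holomorphic function \<open>f(w) / (1 - cnj z w)\<close> and contributes only \<open>cnj (f 0)\<close>.
\<close>
lemma schwarz_formula:
  assumes f: "f holomorphic_on ball 0 R" and R: "1 < R" and z: "norm z < 1"
  shows "f z = herglotz (\<lambda>t. of_real (Re (f (cis t)))) z + \<i> * of_real (Im (f 0))"
proof -
  have fc: "continuous_on A (\<lambda>t. f (cis t))" for A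
    using holomorphic_rcis_continuous[OF f, of 1 A] R by simp
  have fi: "integrable circle_measure (\<lambda>t. f (cis t))"
    by (rule continuous_imp_integrable_real[OF fc])
  have cfi: "integrable circle_measure (\<lambda>t. cnj (f (cis t)))"
    by (intro continuous_imp_integrable_real continuous_intros fc)
  have fz: "integrable circle_measure (\<lambda>t. f (cis t) * (1 / (1 - z * cis (- t))))"
    by (intro integrable_mult_continuous fi continuous_intros) (use one_minus_mult_cis_nonzero[OF z] in auto)
  have cfz: "integrable circle_measure (\<lambda>t. cnj (f (cis t)) * (1 / (1 - z * cis (- t))))"
    by (intro integrable_mult_continuous cfi continuous_intros) (use one_minus_mult_cis_nonzero[OF z] in auto)
  have mean: "integral\<^sup>L circle_measure (\<lambda>t. f (cis t)) = 2 * pi * f 0"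
    using circle_mean_value[OF f, of 1] R by simp
  have ne: "cis t \<noteq> z" for t using z by (metis norm_cis less_irrefl)
  have rot: "cis t / (cis t - z) = 1 / (1 - z * cis (- t))" for t
  proof -
    have "cis t * (1 - z * cis (- t)) = cis t - z"
      by (simp add: algebra_simps cis_mult)
    then show ?thesis using ne[of t] one_minus_mult_cis_nonzero[OF z, of "- t"]
      by (simp add: divide_simps mult.commute)
  qed
  have 1: "(\<integral>t. f (cis t) * (1 / (1 - z * cis (- t))) \<partial>circle_measure) = 2 * pi * f z"
  proof -
    have "((\<lambda>t. f (cis t) * (1 / (1 - z * cis (- t)))) has_integral 2 * pi * f z) {0..2 * pi}"
      using cauchy_formula_circle[OF f zero_less_one R z] by (simp flip: rot)
    then show ?thesis
      using lebesgue_integral_eq_integral[OF fz] integral_unique by simp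
  qed
  have 2: "(\<integral>t. cnj (f (cis t)) * (1 / (1 - z * cis (- t))) \<partial>circle_measure) = cnj (2 * pi * f 0)"
  proof -
    \<comment> \<open>The pole \<open>1 / cnj z\<close> lies outside the closed unit disc.\<close>
    define R' where "R' = (if z = 0 then R else min R (1 / norm z))"
    have R': "1 < R'" "R' \<le> R" using R z by (auto simp: R'_def)
    have nz: "1 - cnj z * w \<noteq> 0" if "w \<in> ball 0 R'" for w
    proof
      assume "1 - cnj z * w = 0"
      then have "norm z * norm w = 1" by (metis complex_mod_cnj eq_iff_diff_eq_0 norm_mult norm_one)
      moreover have "norm z * norm w < 1" if "z \<noteq> 0"
      proof -
        have "norm w < 1 / norm z" using \<open>w \<in> ball 0 R'\<close> that by (auto simp: R'_def)
        then show ?thesis using that by (simp add: field_simps)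
      qed
      ultimately show False by (cases "z = 0") auto
    qed
    have "(\<lambda>w. f w / (1 - cnj z * w)) holomorphic_on ball 0 R'"
      using nz R' by (intro holomorphic_intros holomorphic_on_subset[OF f]) auto
    from circle_mean_value[OF this, of 1] R'
    have m: "(\<integral>t. f (cis t) / (1 - cnj z * cis t) \<partial>circle_measure) = 2 * pi * f 0" by simp
    have "(\<integral>t. cnj (f (cis t)) * (1 / (1 - z * cis (- t))) \<partial>circle_measure) =
        (\<integral>t. cnj (f (cis t) / (1 - cnj z * cis t)) \<partial>circle_measure)"
      by (simp add: cis_cnj)
    also have "\<dots> = cnj (\<integral>t. f (cis t) / (1 - cnj z * cis t) \<partial>circle_measure)"
      by (rule Bochner_Integration.integral_cnj)
    also have "\<dots> = cnj (2 * pi * f 0)" by (simp only: m)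
    finally show ?thesis .
  qed
  let ?h = "\<lambda>t. complex_of_real (Re (f (cis t)))"
  have hre: "?h t = (f (cis t) + cnj (f (cis t))) / 2" for t
    by (simp add: complex_add_cnj)
  have hi: "integrable circle_measure ?h" unfolding hre using fi cfi by simp
  have I1: "integral\<^sup>L circle_measure ?h = of_real (2 * pi * Re (f 0))"
  proof -
    have "integral\<^sup>L circle_measure ?h = (2 * pi * f 0 + cnj (2 * pi * f 0)) / 2"
      unfolding hre using fi cfi mean Bochner_Integration.integral_cnj[of circle_measure "\<lambda>t. f (cis t)"] by simp
    then show ?thesis by (simp add: complex_eq_iff)
  qed
  have I2: "cauchy_transform ?h z = (2 * pi * f z + cnj (2 * pi * f 0)) / 2"
  proof -
    have "cauchy_transform ?h z = (\<integral>t. (f (cis t) * (1 / (1 - z * cis (- t))) + cnj (f (cis t)) * (1 / (1 - z * cis (- t)))) / 2 \<partial>circle_measure)"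
      unfolding cauchy_transform_def hre
      by (intro Bochner_Integration.integral_cong) (simp_all add: add_divide_distrib mult.commute)
    also have "\<dots> = ((\<integral>t. f (cis t) * (1 / (1 - z * cis (- t))) \<partial>circle_measure) + (\<integral>t. cnj (f (cis t)) * (1 / (1 - z * cis (- t))) \<partial>circle_measure)) / 2"
      unfolding integral_divide_zero Bochner_Integration.integral_add[OF fz cfz] ..
    finally show ?thesis unfolding 1 2 .
  qed
  have "herglotz ?h z = f z + cnj (f 0) - of_real (Re (f 0))"
    unfolding herglotz_eq_cauchy_transform[OF hi z] I1 I2 by (simp add: field_simps)
  then show ?thesis by (simp add: complex_eq_iff)
qed

text \<open>
  A function holomorphic across the unit circle is, up to a constant, the Herglotz integral of its
  real part. Splitting the real part into positive and negative part removes the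
  sign condition. The bound is obtained on smaller circles, where the Herglotz integrals
  are holomorphic, and extends to the unit circle by continuity.
\<close>
lemma riesz_transfer:
  assumes R: "riesz_bound q" and q: "1 < q"
  obtains C where "0 \<le> C" "\<And>f R. 1 < R \<Longrightarrow> f holomorphic_on ball 0 R \<Longrightarrow>
    (\<integral>\<theta>. norm (f (cis \<theta>)) powr q \<partial>circle_measure) \<le>
      C * (1 + (\<integral>\<theta>. \<bar>Re (f (cis \<theta>))\<bar> powr q \<partial>circle_measure) + norm (f 0) powr q)"
proof -
  obtain C0 where C0: "C0 \<ge> 0" and C0b: "\<And>u r. (\<And>t. 0 \<le> u t) \<Longrightarrow> u \<in> borel_measurable circle_measure \<Longrightarrow>
     integrable circle_measure (\<lambda>t. u t powr q) \<Longrightarrow> r \<in> {0..<1} \<Longrightarrow>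
     (\<integral>\<theta>. norm (herglotz (\<lambda>t. of_real (u t)) (of_real r * cis \<theta>)) powr q \<partial>circle_measure)
        \<le> C0 * (1 + (\<integral>t. u t powr q \<partial>circle_measure))"
    using R unfolding riesz_bound_def by blast
  define T where "T = (2::real) powr q"
  have T: "T \<ge> 1" using q by (simp add: T_def ge_one_powr_ge_zero)
  define C where "C = T * (T * (2 * C0) + 2 * pi)"
  have C: "C \<ge> 0" using C0 T by (simp add: C_def)
  show ?thesis
  proof (rule that[OF C])
    fix f :: "complex \<Rightarrow> complex" and R :: real
    assume R: "1 < R" and f: "f holomorphic_on ball 0 R"
    have q0: "0 < q" using q by simp
    have fc: "continuous_on A (\<lambda>t. f (cis t))" for A
      using holomorphic_rcis_continuous[OF f, of 1 A] R by simp
    define u where "u t = max 0 (Re (f (cis t)))" for t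
    define v where "v t = max 0 (- Re (f (cis t)))" for t
    have uc: "continuous_on A u" and vc: "continuous_on A v" for A
      unfolding u_def[abs_def] v_def[abs_def] by (intro continuous_intros fc)+
    have u0: "0 \<le> u t" and v0: "0 \<le> v t" for t by (auto simp: u_def v_def)
    have um: "u \<in> borel_measurable circle_measure" and vm: "v \<in> borel_measurable circle_measure"
      by (rule continuous_imp_measurable_on_sets_lebesgue[OF uc] continuous_imp_measurable_on_sets_lebesgue[OF vc]; simp)+
    have uq: "integrable circle_measure (\<lambda>t. u t powr q)" and vq: "integrable circle_measure (\<lambda>t. v t powr q)"
      using continuous_norm_powr_integrable[OF uc q0] continuous_norm_powr_integrable[OF vc q0] u0 v0 by simp_all
    have Rq: "integrable circle_measure (\<lambda>t. \<bar>Re (f (cis t))\<bar> powr q)"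
      using continuous_norm_powr_integrable[of "\<lambda>t. Re (f (cis t))" q] q0
      by (simp add: continuous_on_Re fc)
    define W where "W = (\<integral>t. \<bar>Re (f (cis t))\<bar> powr q \<partial>circle_measure)"
    have uW: "(\<integral>t. u t powr q \<partial>circle_measure) \<le> W"
      unfolding W_def by (rule integral_mono[OF uq Rq]) (use q0 in \<open>auto intro!: powr_mono2 simp: u_def\<close>)
    have vW: "(\<integral>t. v t powr q \<partial>circle_measure) \<le> W"
      unfolding W_def by (rule integral_mono[OF vq Rq]) (use q0 in \<open>auto intro!: powr_mono2 simp: v_def\<close>)
    have W0: "W \<ge> 0" unfolding W_def by (intro integral_nonneg_AE) auto
    let ?Hu = "herglotz (\<lambda>t. of_real (u t))" and ?Hv = "herglotz (\<lambda>t. of_real (v t))"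
    have ui: "integrable circle_measure (\<lambda>t. complex_of_real (u t))" and vi: "integrable circle_measure (\<lambda>t. complex_of_real (v t))"
      by (intro continuous_imp_integrable_real continuous_intros uc vc)+
    have decomp: "f z = ?Hu z - ?Hv z + \<i> * of_real (Im (f 0))" if "norm z < 1" for z
    proof -
      have "complex_of_real (Re (f (cis t))) = of_real (u t) - of_real (v t)" for t
        by (simp add: u_def v_def max_def flip: of_real_diff)
      then show ?thesis
        using schwarz_formula[OF f R that] herglotz_diff[OF ui vi that] by simp
    qed
    have pt: "norm (f z) powr q \<le> T * (T * (norm (?Hu z) powr q + norm (?Hv z) powr q) + norm (f 0) powr q)"
      if "norm z < 1" for z
    proof -
      have "norm (f z) \<le> (norm (?Hu z) + norm (?Hv z)) + norm (f 0)"
        unfolding decomp[OF that]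
        by (intro order_trans[OF norm_triangle_ineq] add_mono norm_triangle_ineq4)
           (simp add: norm_mult abs_Im_le_cmod)
      then have "norm (f z) powr q \<le> ((norm (?Hu z) + norm (?Hv z)) + norm (f 0)) powr q"
        using q0 by (intro powr_mono2) auto
      also have "\<dots> \<le> T * ((norm (?Hu z) + norm (?Hv z)) powr q + norm (f 0) powr q)"
        unfolding T_def using q0 by (intro powr_add_le) auto
      also have "\<dots> \<le> T * (T * (norm (?Hu z) powr q + norm (?Hv z) powr q) + norm (f 0) powr q)"
        using T q0 powr_add_le[of "norm (?Hu z)" "norm (?Hv z)" q] unfolding T_def
        by (intro mult_left_mono add_right_mono) auto
      finally show ?thesis .
    qed
    let ?B = "C * (1 + W + norm (f 0) powr q)"
    let ?G = "\<lambda>\<rho>. \<integral>\<theta>. norm (f (of_real \<rho> * cis \<theta>)) powr q \<partial>circle_measure"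
    have inside: "?G \<rho> \<le> ?B" if "\<rho> \<in> {0..<1}" for \<rho>
    proof -
      have r: "0 \<le> \<rho>" "\<rho> < 1" using that by auto
      have Hi: "integrable circle_measure (\<lambda>\<theta>. norm (?Hu (of_real \<rho> * cis \<theta>)) powr q)"
        "integrable circle_measure (\<lambda>\<theta>. norm (?Hv (of_real \<rho> * cis \<theta>)) powr q)"
        by (intro continuous_norm_powr_integrable q0 holomorphic_rcis_continuous[OF herglotz_holomorphic] ui vi r)+
      have fi: "integrable circle_measure (\<lambda>\<theta>. norm (f (of_real \<rho> * cis \<theta>)) powr q)"
        by (intro continuous_norm_powr_integrable q0 holomorphic_rcis_continuous[OF f]) (use r R in auto)
      have "?G \<rho> \<le> (\<integral>\<theta>. T * (T * (norm (?Hu (of_real \<rho> * cis \<theta>)) powr q + norm (?Hv (of_real \<rho> * cis \<theta>)) powr q) + norm (f 0) powr q) \<partial>circle_measure)"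
        using Hi integrable_const_circle by (intro integral_mono[OF fi] pt rcis_norm_lt1 r) simp
      also have "\<dots> = T * (T * ((\<integral>\<theta>. norm (?Hu (of_real \<rho> * cis \<theta>)) powr q \<partial>circle_measure) + (\<integral>\<theta>. norm (?Hv (of_real \<rho> * cis \<theta>)) powr q \<partial>circle_measure)) + 2 * pi * norm (f 0) powr q)"
        using Hi integrable_const_circle measure_circle by simp
      also have "\<dots> \<le> T * (T * (C0 * (1 + W) + C0 * (1 + W)) + 2 * pi * norm (f 0) powr q)"
      proof -
        have "(\<integral>\<theta>. norm (?Hu (of_real \<rho> * cis \<theta>)) powr q \<partial>circle_measure) \<le> C0 * (1 + W)"
          using C0b[OF u0 um uq that] mult_left_mono[OF add_left_mono[OF uW, of 1] C0] by linarith
        moreover have "(\<integral>\<theta>. norm (?Hv (of_real \<rho> * cis \<theta>)) powr q \<partial>circle_measure) \<le> C0 * (1 + W)"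
          using C0b[OF v0 vm vq that] mult_left_mono[OF add_left_mono[OF vW, of 1] C0] by linarith
        ultimately show ?thesis using T by (intro mult_left_mono add_right_mono add_mono) auto
      qed
      also have "\<dots> = T * (T * (2 * C0)) * (1 + W) + T * (2 * pi) * norm (f 0) powr q"
        by (simp add: algebra_simps)
      also have "\<dots> \<le> C * (1 + W) + C * norm (f 0) powr q"
        using T C0 W0 by (intro add_mono mult_right_mono) (auto simp: C_def algebra_simps)
      also have "\<dots> = ?B" by (simp add: algebra_simps)
      finally show ?thesis .
    qed
    have Gc: "continuous_on {0..1} ?G"
    proof -
      have c: "continuous_on ({0..1} \<times> cbox 0 (2 * pi)) (\<lambda>(\<rho>, \<theta>). norm (f (of_real \<rho> * cis \<theta>)) powr q)"
        unfolding case_prod_beta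
      proof (rule continuous_on_powr')
        show "continuous_on ({0..1} \<times> cbox 0 (2 * pi)) (\<lambda>x. norm (f (of_real (fst x) * cis (snd x))))"
          using R by (intro continuous_on_norm continuous_on_compose2[OF holomorphic_on_imp_continuous_on[OF f]] continuous_intros)
            (auto simp: norm_mult)
      qed (use q0 in \<open>auto intro!: continuous_intros\<close>)
      have "?G \<rho> = integral (cbox 0 (2 * pi)) (\<lambda>\<theta>. norm (f (of_real \<rho> * cis \<theta>)) powr q)" if "\<rho> \<in> {0..1}" for \<rho>
      proof -
        have "integrable circle_measure (\<lambda>\<theta>. norm (f (of_real \<rho> * cis \<theta>)) powr q)"
          by (intro continuous_norm_powr_integrable q0 holomorphic_rcis_continuous[OF f]) (use that R in auto)
        then show ?thesis by (simp add: lebesgue_integral_eq_integral)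
      qed
      with continuous_on_eq[OF integral_continuous_on_param[OF c]] show ?thesis by simp
    qed
    have "?G 1 \<le> ?B"
    proof -
      have "continuous_on (closure {0..<1::real}) ?G" using Gc by simp
      moreover have "(1::real) \<in> closure {0..<1::real}" by simp
      ultimately show ?thesis using inside by (rule continuous_le_on_closure)
    qed
    then show "(\<integral>\<theta>. norm (f (cis \<theta>)) powr q \<partial>circle_measure) \<le>
      C * (1 + (\<integral>\<theta>. \<bar>Re (f (cis \<theta>))\<bar> powr q \<partial>circle_measure) + norm (f 0) powr q)"
      by (simp add: W_def)
  qed
qed

text \<open>
  If \<open>H = a + i b\<close>, then \<open>- i H\<^sup>2\<close> has modulus \<open>|H|\<^sup>2\<close> and real part \<open>2 a b\<close>, so the bound for the exponent \<open>q\<close> controls the mean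
  of \<open>|H|\<^sup>2\<^sup>q\<close> by that of \<open>(2 a |H|)\<^sup>q\<close>. Young's inequality splits the latter into a small multiple of \<open>|H|\<^sup>2\<^sup>q\<close>, which is absorbed, and
  a multiple of \<open>a\<^sup>2\<^sup>q\<close>, which Schur's test controls.
\<close>
lemma riesz_bound_double:
  assumes R: "riesz_bound q" and q: "1 < q"
  shows "riesz_bound (2 * q)"
proof -
  obtain C where C: "0 \<le> C" and Cb: "\<And>f R. 1 < R \<Longrightarrow> f holomorphic_on ball 0 R \<Longrightarrow>
    (\<integral>\<theta>. norm (f (cis \<theta>)) powr q \<partial>circle_measure) \<le>
      C * (1 + (\<integral>\<theta>. \<bar>Re (f (cis \<theta>))\<bar> powr q \<partial>circle_measure) + norm (f 0) powr q)"
    using riesz_transfer[OF assms] by metis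
  define S where "S = schur_const 2 1 powr (2 * q)"
  define L where "L = (C + 1) / 2 * (4 powr q)"
  define B where "B = 2 * C * (1 + L * S + 1)"
  have S0: "S \<ge> 0" and L0: "L \<ge> 0" using C by (auto simp: S_def L_def)
  then have B0: "B \<ge> 0" using C by (simp add: B_def)
  have q0: "0 < q" "1 \<le> 2 * q" using q by auto
  have "(\<integral>\<theta>. norm (herglotz (\<lambda>t. of_real (u t)) (of_real r * cis \<theta>)) powr (2 * q) \<partial>circle_measure)
      \<le> B * (1 + (\<integral>t. u t powr (2 * q) \<partial>circle_measure))"
    if u: "\<forall>t. 0 \<le> u t" "u \<in> borel_measurable circle_measure" "integrable circle_measure (\<lambda>t. u t powr (2 * q))"
      and "r \<in> {0..<1}" for u :: "real \<Rightarrow> real" and r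
  proof -
    have r: "0 \<le> r" "r < 1" using that by auto
    note uu = u(1)[rule_format] u(2,3) q0(2)
    let ?H = "herglotz (\<lambda>t. of_real (u t))"
    define U where "U = (\<integral>t. u t powr (2 * q) \<partial>circle_measure)"
    have U0: "U \<ge> 0" unfolding U_def by (intro integral_nonneg_AE) auto
    define X where "X = (\<integral>\<theta>. norm (?H (of_real r * cis \<theta>)) powr (2 * q) \<partial>circle_measure)"
    \<comment> \<open>Any \<open>R > 1\<close> with \<open>r R < 1\<close> makes \<open>H (r z)\<close> holomorphic across the unit circle.\<close>
    define R where "R = 2 / (1 + r)"
    have R1: "1 < R" using r by (simp add: R_def field_simps)
    have rR: "norm (of_real r * z) < 1" if "norm z < R" for z :: complex
    proof -
      have "norm (of_real r * z) = r * norm z" using r by (simp add: norm_mult)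
      also have "\<dots> \<le> r * R" using that r by (intro mult_left_mono) auto
      also have "\<dots> < 1" using r by (simp add: R_def field_simps)
      finally show ?thesis .
    qed
    define F where "F z = - \<i> * (?H (of_real r * z))\<^sup>2" for z
    have "(\<lambda>z. ?H (of_real r * z)) holomorphic_on ball 0 R"
      using rR by (intro holomorphic_on_compose_gen[OF _ herglotz_Lq_holomorphic[OF uu], unfolded o_def] holomorphic_intros) auto
    then have Fh: "F holomorphic_on ball 0 R"
      unfolding F_def[abs_def] by (intro holomorphic_intros)
    have sq: "norm (a\<^sup>2) powr q = norm a powr (2 * q)" for a :: complex
      by (simp add: norm_power powr_powr flip: powr_numeral)
    have nF: "norm (F (cis \<theta>)) powr q = norm (?H (of_real r * cis \<theta>)) powr (2 * q)" for \<theta>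
      unfolding F_def norm_mult norm_minus_cancel norm_ii mult_1 by (rule sq)
    have F0: "norm (F 0) powr q \<le> U"
    proof -
      have "norm (F 0) powr q = norm (?H 0) powr (2 * q)"
        unfolding F_def norm_mult norm_minus_cancel norm_ii mult_1 sq by simp
      also have "\<dots> \<le> U / (2 * pi)" unfolding U_def by (rule norm_herglotz_0_powr_le[OF uu])
      also have "\<dots> \<le> U"
      proof -
        have "U * 1 \<le> U * (2 * pi)" using U0 pi_gt3 by (intro mult_left_mono) auto
        then show ?thesis by (simp add: divide_le_eq)
      qed
      finally show ?thesis .
    qed
    have Hc: "continuous_on {0..2 * pi} (\<lambda>\<theta>. ?H (of_real r * cis \<theta>))"
      by (rule holomorphic_rcis_continuous[OF herglotz_Lq_holomorphic[OF uu] r])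
    have Hi: "integrable circle_measure (\<lambda>\<theta>. norm (?H (of_real r * cis \<theta>)) powr (2 * q))"
      using continuous_norm_powr_integrable[OF Hc] q0 by simp
    have Rc: "continuous_on {0..2 * pi} (\<lambda>\<theta>. Re (?H (of_real r * cis \<theta>)))"
      by (intro continuous_intros Hc)
    have Ri: "integrable circle_measure (\<lambda>\<theta>. Re (?H (of_real r * cis \<theta>)) powr (2 * q))"
      using continuous_norm_powr_integrable[OF Rc, of "2 * q"] Re_herglotz_nonneg[OF uu r] q0 by simp
    have RFi: "integrable circle_measure (\<lambda>\<theta>. \<bar>Re (F (cis \<theta>))\<bar> powr q)"
    proof -
      have "continuous_on {0..2 * pi} (\<lambda>\<theta>. F (cis \<theta>))"
        using holomorphic_rcis_continuous[OF Fh, of 1] R1 by simp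
      then show ?thesis
        using continuous_norm_powr_integrable[of "\<lambda>\<theta>. Re (F (cis \<theta>))" q] q0 by (simp add: continuous_on_Re)
    qed
    have pt: "\<bar>Re (F (cis \<theta>))\<bar> powr q \<le>
        norm (?H (of_real r * cis \<theta>)) powr (2 * q) / (2 * (C + 1)) + L * Re (?H (of_real r * cis \<theta>)) powr (2 * q)" for \<theta>
    proof -
      let ?h = "?H (of_real r * cis \<theta>)"
      have a0: "0 \<le> Re ?h" by (rule Re_herglotz_nonneg[OF uu r])
      have "\<bar>Re (F (cis \<theta>))\<bar> = 2 * Re ?h * \<bar>Im ?h\<bar>"
        using a0 by (simp add: F_def power2_eq_square abs_mult)
      also have "\<dots> \<le> 2 * Re ?h * norm ?h"
        using a0 by (intro mult_left_mono abs_Im_le_cmod) auto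
      finally have "\<bar>Re (F (cis \<theta>))\<bar> powr q \<le> (2 * Re ?h * norm ?h) powr q"
        using q0 by (intro powr_mono2) auto
      also have "\<dots> = (2 * Re ?h) powr q * norm ?h powr q"
        by (rule powr_mult)
      \<comment> \<open>The weight \<open>C + 1\<close> is chosen so that the first term, multiplied by \<open>C\<close> below, stays under half of the mean to be bounded.\<close>
      also have "\<dots> \<le> (norm ?h powr q)\<^sup>2 / (2 * (C + 1)) + (C + 1) / 2 * ((2 * Re ?h) powr q)\<^sup>2"
      proof -
        have ym: "y * x \<le> x\<^sup>2 / (2 * c) + c / 2 * y\<^sup>2" if "0 < c" for x y c :: real
        proof -
          have "0 \<le> (x - c * y)\<^sup>2 / (2 * c)" using that by simp
          also have "\<dots> = x\<^sup>2 / (2 * c) + c / 2 * y\<^sup>2 - y * x"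
            using that by (simp add: power2_eq_square field_simps)
          finally show ?thesis by simp
        qed
        show ?thesis by (rule ym) (use C in simp)
      qed
      also have "(norm ?h powr q)\<^sup>2 = norm ?h powr (2 * q)"
        by (simp add: power2_eq_square flip: powr_add)
      also have "((2 * Re ?h) powr q)\<^sup>2 = 4 powr q * Re ?h powr (2 * q)"
      proof -
        have "((2 * Re ?h) powr q)\<^sup>2 = (2 powr q * 2 powr q) * (Re ?h powr q * Re ?h powr q)"
          by (simp add: powr_mult power2_eq_square)
        also have "2 powr q * 2 powr q = (4::real) powr q"
          using powr_mult[of 2 2 q] by simp
        also have "Re ?h powr q * Re ?h powr q = Re ?h powr (2 * q)"
          by (simp flip: powr_add)
        finally show ?thesis .
      qed
      finally show ?thesis by (simp add: L_def)
    qed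
    have W: "(\<integral>\<theta>. \<bar>Re (F (cis \<theta>))\<bar> powr q \<partial>circle_measure) \<le> X / (2 * (C + 1)) + L * (S * U)"
    proof -
      have "(\<integral>\<theta>. \<bar>Re (F (cis \<theta>))\<bar> powr q \<partial>circle_measure) \<le>
        (\<integral>\<theta>. norm (?H (of_real r * cis \<theta>)) powr (2 * q) / (2 * (C + 1)) + L * Re (?H (of_real r * cis \<theta>)) powr (2 * q) \<partial>circle_measure)"
        using Hi Ri by (intro integral_mono[OF RFi] pt) auto
      also have "\<dots> = X / (2 * (C + 1)) + L * (\<integral>\<theta>. Re (?H (of_real r * cis \<theta>)) powr (2 * q) \<partial>circle_measure)"
        using Hi Ri by (simp add: X_def)
      also have "\<dots> \<le> X / (2 * (C + 1)) + L * (S * U)"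
        using Re_herglotz_Lq_bound[OF uu r] L0 by (intro add_left_mono mult_left_mono) (auto simp: S_def U_def)
      finally show ?thesis .
    qed
    have X0: "X \<ge> 0" unfolding X_def by (intro integral_nonneg_AE) auto
    have "X = (\<integral>\<theta>. norm (F (cis \<theta>)) powr q \<partial>circle_measure)" unfolding nF X_def ..
    also have "\<dots> \<le> C * (1 + (\<integral>\<theta>. \<bar>Re (F (cis \<theta>))\<bar> powr q \<partial>circle_measure) + norm (F 0) powr q)"
      by (rule Cb[OF R1 Fh])
    also have "\<dots> \<le> C * (1 + (X / (2 * (C + 1)) + L * (S * U)) + U)"
      using W F0 C by (intro mult_left_mono add_mono) auto
    also have "\<dots> = C / (C + 1) * (X / 2) + C * (1 + L * S * U + U)"
      using C by (simp add: field_simps)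
    also have "\<dots> \<le> 1 * (X / 2) + C * (1 + L * S * U + U)"
      using C X0 by (intro add_right_mono mult_right_mono) auto
    \<comment> \<open>The term \<open>X / 2\<close> moves to the left-hand side because \<open>X\<close> is finite.\<close>
    finally have "X \<le> 2 * C * (1 + L * S * U + U)" by simp
    also have "\<dots> \<le> 2 * C * ((1 + L * S + 1) * (1 + U))"
      using C U0 L0 S0 by (intro mult_left_mono) (auto simp: algebra_simps)
    also have "\<dots> = B * (1 + U)" by (simp add: B_def)
    finally show ?thesis by (simp add: X_def U_def)
  qed
  then show ?thesis unfolding riesz_bound_def using B0 by blast
qed

text \<open>
  The cosine vanishes exactly if \<open>q\<close> is an odd integer. Then \<open>q > 2\<close>, and the cosine belonging to \<open>q/2\<close> is
  nonzero because its square is \<open>1/2\<close>.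
\<close>
theorem riesz_bound_all:
  assumes "1 < q"
  shows "riesz_bound q"
proof (cases "cos (q * pi / 2) = 0")
  case False
  then show ?thesis using riesz_bound_base assms by blast
next
  case True
  have "2 < q"
  proof (rule ccontr)
    assume "\<not> 2 < q"
    then have "cos (pi / 2) > cos (q * pi / 2)"
      using assms by (intro cos_monotone_0_pi) auto
    with True show False by simp
  qed
  have "cos (q / 2 * pi / 2) \<noteq> 0"
  proof
    assume "cos (q / 2 * pi / 2) = 0"
    then have "cos (2 * (q / 2 * pi / 2)) = - 1" by (simp only: cos_double_cos) simp
    with True show False by (simp add: mult.commute)
  qed
  then have "riesz_bound (q / 2)" using riesz_bound_base[of "q / 2"] \<open>2 < q\<close> by simp
  then show ?thesis using riesz_bound_double[of "q / 2"] \<open>2 < q\<close> by simp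
qed

lemma herglotz_bounded_means:
  fixes u :: "real \<Rightarrow> real"
  assumes p: "1 < p" and u0: "\<And>t. 0 \<le> u t" and u: "Lp_function (ereal p) u"
  shows "bounded_means (ereal p) (herglotz (\<lambda>t. of_real (u t)))"
    "continuous_on unit_disc (herglotz (\<lambda>t. of_real (u t)))"
proof -
  let ?H = "herglotz (\<lambda>t. of_real (u t))"
  have ui: "integrable circle_measure u"
    by (rule Lp_function_integrable[OF _ u]) (use p in simp)
  then have hol: "?H holomorphic_on unit_disc" by (intro herglotz_holomorphic) auto
  then show "continuous_on unit_disc ?H" by (rule holomorphic_on_imp_continuous_on)
  have um: "u \<in> borel_measurable circle_measure" using ui by auto
  have up: "integrable circle_measure (\<lambda>t. u t powr p)"
    using u u0 um by (intro integrableI_nonneg) (auto simp: Lp_function_def)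
  obtain C where C: "\<forall>r\<in>{0..<1}. (\<integral>\<theta>. norm (?H (of_real r * cis \<theta>)) powr p \<partial>circle_measure)
        \<le> C * (1 + (\<integral>t. u t powr p \<partial>circle_measure))"
    using riesz_bound_all[OF p] u0 um up unfolding riesz_bound_def by blast
  have "(\<integral>\<^sup>+\<theta>. ennreal (norm (?H (of_real r * cis \<theta>)) powr p) \<partial>circle_measure) \<le>
      ennreal (C * (1 + (\<integral>t. u t powr p \<partial>circle_measure)))" if "r \<in> {0..<1}" for r
  proof -
    have "integrable circle_measure (\<lambda>\<theta>. norm (?H (of_real r * cis \<theta>)) powr p)"
      by (intro continuous_norm_powr_integrable holomorphic_rcis_continuous[OF hol]) (use that p in auto)
    then have "(\<integral>\<^sup>+\<theta>. ennreal (norm (?H (of_real r * cis \<theta>)) powr p) \<partial>circle_measure) =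
        ennreal (\<integral>\<theta>. norm (?H (of_real r * cis \<theta>)) powr p \<partial>circle_measure)"
      by (intro nn_integral_eq_integral) auto
    also have "\<dots> \<le> ennreal (C * (1 + (\<integral>t. u t powr p \<partial>circle_measure)))"
      by (intro ennreal_leI C[rule_format] that)
    finally show ?thesis .
  qed
  then have "\<forall>r\<in>{0..<1}. (\<integral>\<^sup>+\<theta>. ennreal (norm (?H (of_real r * cis \<theta>)) powr p) \<partial>circle_measure) \<le>
      ennreal (C * (1 + (\<integral>t. u t powr p \<partial>circle_measure)))" by blast
  then show "bounded_means (ereal p) ?H"
    unfolding bounded_means_def by auto
qed

text \<open>
  The density is a combination of the four nonnegative densities \<open>max 0 (Re (c g))\<close> with \<open>c\<close> a
  fourth root of unity, and each conjugate function is dominated by the corresponding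
  Herglotz integral.
\<close>
lemma conjugate_bounded_means:
  fixes g :: "real \<Rightarrow> complex"
  assumes p: "1 < p" and g: "Lp_function (ereal p) g" and "continuous_on unit_disc a"
    and a: "\<And>r \<theta>. 0 \<le> r \<Longrightarrow> r < 1 \<Longrightarrow> \<theta> \<in> {0..2 * pi} \<Longrightarrow>
      a (of_real r * cis \<theta>) = (\<integral>t. radial_conjugate 0 r (\<theta> - t) *\<^sub>R g t \<partial>circle_measure)"
  shows "bounded_means (ereal p) a"
proof -
  have p1: "1 \<le> ereal p" using p by simp
  define u where "u c t = max 0 (Re (c * g t))" for c :: complex and t
  have gm: "g \<in> borel_measurable circle_measure" and
    gp: "(\<integral>\<^sup>+t. ennreal (norm (g t) powr p) \<partial>circle_measure) < \<infinity>"
    using g by (auto simp: Lp_function_def)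
  have gi: "integrable circle_measure g" by (rule Lp_function_integrable[OF p1 g])
  have u0: "0 \<le> u c t" for c t by (simp add: u_def)
  have uLp: "Lp_function (ereal p) (u c)" if "norm c = 1" for c
  proof -
    have "u c t \<le> norm (g t)" for t
    proof -
      have "u c t \<le> \<bar>Re (c * g t)\<bar>" by (simp add: u_def)
      also have "\<dots> \<le> norm (g t)" using abs_Re_le_cmod[of "c * g t"] that by (simp add: norm_mult)
      finally show ?thesis .
    qed
    then have "(\<integral>\<^sup>+t. ennreal (norm (u c t) powr p) \<partial>circle_measure) \<le> (\<integral>\<^sup>+t. ennreal (norm (g t) powr p) \<partial>circle_measure)"
      using u0 p by (intro nn_integral_mono ennreal_leI powr_mono2) auto
    then have "(\<integral>\<^sup>+t. ennreal (norm (u c t) powr p) \<partial>circle_measure) < \<infinity>" using gp by (rule le_less_trans)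
    moreover have "u c \<in> borel_measurable circle_measure" unfolding u_def[abs_def] using gm by measurable
    ultimately show ?thesis by (simp add: Lp_function_def)
  qed
  have ui: "integrable circle_measure (u c)" if "norm c = 1" for c
    by (rule Lp_function_integrable[OF p1 uLp[OF that]])
  define H where "H c = herglotz (\<lambda>t. of_real (u c t))" for c
  have H: "bounded_means (ereal p) (H c)" "continuous_on unit_disc (H c)" if "norm c = 1" for c
    unfolding H_def using herglotz_bounded_means[OF p u0 uLp[OF that]] by auto
  have gdec: "g t = of_real (u 1 t) - of_real (u (-1) t) + \<i> * of_real (u (- \<i>) t) - \<i> * of_real (u \<i> t)" for t
    by (simp add: complex_eq_iff u_def max_def)
  define h1 where "h1 z = complex_of_real (norm (H 1 z) + norm (H (-1) z))" for z
  define h2 where "h2 z = complex_of_real (norm (H (- \<i>) z) + norm (H \<i> z))" for z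
  have h1: "bounded_means (ereal p) h1" "continuous_on unit_disc h1"
  proof -
    show "bounded_means (ereal p) h1"
      by (rule bounded_means_dominated[OF p1 H H, of 1 "-1" 1]) (auto simp: h1_def norm_of_real simp del: of_real_add)
    show "continuous_on unit_disc h1" unfolding h1_def[abs_def] by (intro continuous_intros H) auto
  qed
  have h2: "bounded_means (ereal p) h2" "continuous_on unit_disc h2"
  proof -
    show "bounded_means (ereal p) h2"
      by (rule bounded_means_dominated[OF p1 H H, of "- \<i>" \<i> 1]) (auto simp: h2_def norm_of_real simp del: of_real_add)
    show "continuous_on unit_disc h2" unfolding h2_def[abs_def] by (intro continuous_intros H) auto
  qed
  have dom: "norm (a z) \<le> (2 * pi) * (norm (h1 z) + norm (h2 z) + 1)" if z: "z \<in> unit_disc" for z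
  proof -
    obtain \<theta> where \<theta>: "\<theta> \<in> {0..2 * pi}" "z = of_real (norm z) * cis \<theta>"
      by (rule polar_form_0_2pi)
    define r where "r = norm z"
    have r: "0 \<le> r" "r < 1" using z by (auto simp: r_def)
    have zr: "z = of_real r * cis \<theta>" using \<theta> by (simp add: r_def)
    let ?Q = "\<lambda>t. radial_conjugate 0 r (\<theta> - t)"
    define I where "I c = (\<integral>t. ?Q t * u c t \<partial>circle_measure)" for c
    have Ib: "\<bar>I c\<bar> \<le> 2 * pi * norm (H c z)" if "norm c = 1" for c
    proof -
      have "I c = 2 * pi * Im (H c z)"
        unfolding I_def H_def zr using herglotz_Re_Im(2)[OF ui[OF that] r] by simp
      then show ?thesis using abs_Im_le_cmod[of "H c z"] by (simp add: abs_mult)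
    qed
    have Ii: "integrable circle_measure (\<lambda>t. ?Q t *\<^sub>R complex_of_real (u c t))"
      and Ie: "(\<integral>t. ?Q t *\<^sub>R complex_of_real (u c t) \<partial>circle_measure) = of_real (I c)" if "norm c = 1" for c
    proof -
      show "integrable circle_measure (\<lambda>t. ?Q t *\<^sub>R complex_of_real (u c t))"
        by (rule integrable_convolution[OF _ continuous_radial_conjugate[OF r]]) (use ui[OF that] in auto)
      show "(\<integral>t. ?Q t *\<^sub>R complex_of_real (u c t) \<partial>circle_measure) = of_real (I c)"
        unfolding I_def by (simp add: scaleR_conv_of_real flip: of_real_mult)
    qed
    have n: "norm (1::complex) = 1" "norm (-1::complex) = 1" "norm (\<i>) = 1" "norm (- \<i>) = 1" by auto
    have lin: "(\<integral>t. A1 t - A2 t + \<i> * A3 t - \<i> * A4 t \<partial>circle_measure) =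
        integral\<^sup>L circle_measure A1 - integral\<^sup>L circle_measure A2 + \<i> * integral\<^sup>L circle_measure A3 - \<i> * integral\<^sup>L circle_measure A4"
      if "integrable circle_measure A1" "integrable circle_measure A2" "integrable circle_measure A3" "integrable circle_measure A4"
      for A1 A2 A3 A4 :: "real \<Rightarrow> complex"
      using that by simp
    have "a z = (\<integral>t. ?Q t *\<^sub>R g t \<partial>circle_measure)"
      unfolding zr by (rule a[OF r \<theta>(1)])
    also have "\<dots> = (\<integral>t. ?Q t *\<^sub>R complex_of_real (u 1 t) - ?Q t *\<^sub>R complex_of_real (u (-1) t)
        + \<i> * (?Q t *\<^sub>R complex_of_real (u (- \<i>) t)) - \<i> * (?Q t *\<^sub>R complex_of_real (u \<i> t)) \<partial>circle_measure)"
      by (subst gdec) (simp add: scaleR_conv_of_real algebra_simps)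
    also have "\<dots> = of_real (I 1) - of_real (I (-1)) + \<i> * of_real (I (- \<i>)) - \<i> * of_real (I \<i>)"
      unfolding lin[OF Ii[OF n(1)] Ii[OF n(2)] Ii[OF n(4)] Ii[OF n(3)]] Ie[OF n(1)] Ie[OF n(2)] Ie[OF n(3)] Ie[OF n(4)] ..
    finally have az: "a z = of_real (I 1) - of_real (I (-1)) + \<i> * of_real (I (- \<i>)) - \<i> * of_real (I \<i>)" .
    have "norm (a z) \<le> \<bar>I 1\<bar> + \<bar>I (-1)\<bar> + \<bar>I (- \<i>)\<bar> + \<bar>I \<i>\<bar>"
      unfolding az
      by (intro order_trans[OF norm_triangle_ineq4] order_trans[OF norm_triangle_ineq] add_mono)
         (auto simp: norm_mult)
    also have "\<dots> \<le> 2 * pi * norm (H 1 z) + 2 * pi * norm (H (-1) z) + 2 * pi * norm (H (- \<i>) z) + 2 * pi * norm (H \<i> z)"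
      by (intro add_mono Ib n)
    also have "\<dots> = (2 * pi) * (norm (h1 z) + norm (h2 z))"
      unfolding h1_def h2_def norm_of_real by (simp add: algebra_simps)
    also have "\<dots> \<le> (2 * pi) * (norm (h1 z) + norm (h2 z) + 1)" by (intro mult_left_mono) auto
    finally show ?thesis .
  qed
  show ?thesis
    by (rule bounded_means_dominated[OF p1 h1 h2 _ dom]) auto
qed

section \<open>From polar derivatives to partial derivatives\<close>

text \<open>
  Near the origin the partial derivatives are bounded by compactness, so a domination by functions
  with bounded means is only needed for \<open>|z| \<ge> 1/2\<close>.
\<close>
lemma partials_bounded_means:
  assumes p: "1 \<le> p"
    and a: "bounded_means p a" "continuous_on unit_disc a" and b: "bounded_means p b" "continuous_on unit_disc b"
    and fx: "continuous_on unit_disc (partial_x f)" and fy: "continuous_on unit_disc (partial_y f)"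
    and C: "0 \<le> C" and dom: "\<And>z. norm z < 1 \<Longrightarrow> 1 / 2 \<le> norm z \<Longrightarrow>
        norm (partial_x f z) + norm (partial_y f z) \<le> C * (norm (a z) + norm (b z) + 1)"
  shows "bounded_means p (partial_r f)" "bounded_means p (partial_z f)" "bounded_means p (partial_zbar f)"
proof -
  let ?s = "\<lambda>z. norm (partial_x f z) + norm (partial_y f z)"
  have "continuous_on (cball 0 (1 / 2)) ?s"
    by (intro continuous_intros continuous_on_subset[OF fx] continuous_on_subset[OF fy]) auto
  then have "bounded (?s ` cball 0 (1 / 2))"
    by (intro compact_imp_bounded compact_continuous_image) auto
  then obtain B where B: "\<forall>z\<in>cball 0 (1 / 2). \<bar>?s z\<bar> \<le> B"
    unfolding bounded_real by auto
  have B0: "0 \<le> B" by (rule order_trans[OF abs_ge_zero B[rule_format, of 0]]) simp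
  have *: "bounded_means p h" if h: "\<And>z. norm (h z) \<le> ?s z" for h
  proof (rule bounded_means_dominated[OF p a b])
    show "0 \<le> C + B" using B0 C by simp
    fix z :: complex assume z: "z \<in> unit_disc"
    have "?s z \<le> (C + B) * (norm (a z) + norm (b z) + 1)"
    proof (cases "1 / 2 \<le> norm z")
      case True
      have "?s z \<le> C * (norm (a z) + norm (b z) + 1)" using dom z True by simp
      also have "\<dots> \<le> (C + B) * (norm (a z) + norm (b z) + 1)" using B0 by (intro mult_right_mono) auto
      finally show ?thesis .
    next
      case False
      then have "?s z \<le> B * 1" using B[rule_format, of z] by simp
      also have "\<dots> \<le> (C + B) * (norm (a z) + norm (b z) + 1)" using B0 C by (intro mult_mono) auto
      finally show ?thesis .
    qed
    then show "norm (h z) \<le> (C + B) * (norm (a z) + norm (b z) + 1)"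
      using h[of z] by (rule order_trans[rotated])
  qed
  have zb: "norm (partial_z f z) \<le> ?s z / 2" "norm (partial_zbar f z) \<le> ?s z / 2" for z
  proof -
    have "norm (partial_x f z - \<i> * partial_y f z) \<le> ?s z"
      using norm_triangle_ineq4[of "partial_x f z" "\<i> * partial_y f z"] by (simp add: norm_mult)
    then show "norm (partial_z f z) \<le> ?s z / 2" by (simp add: partial_z_def norm_divide)
    have "norm (partial_x f z + \<i> * partial_y f z) \<le> ?s z"
      using norm_triangle_ineq[of "partial_x f z" "\<i> * partial_y f z"] by (simp add: norm_mult)
    then show "norm (partial_zbar f z) \<le> ?s z / 2" by (simp add: partial_zbar_def norm_divide)
  qed
  have s0: "0 \<le> ?s z" for z by simp
  show "bounded_means p (partial_z f)" "bounded_means p (partial_zbar f)"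
    by (rule *, rule order_trans[OF zb(1)], use s0 in simp) (rule *, rule order_trans[OF zb(2)], use s0 in simp)
  have halves: "x \<le> t" if "x \<le> y + w" "y \<le> t / 2" "w \<le> t / 2" for x y w t :: real
    using that by simp
  show "bounded_means p (partial_r f)"
  proof (rule *)
    fix z
    have "norm (partial_r f z) \<le> norm (partial_z f z) + norm (partial_zbar f z)"
      unfolding partial_r_def by (rule order_trans[OF norm_triangle_ineq]) (simp add: norm_mult)
    then show "norm (partial_r f z) \<le> ?s z" using zb[of z] halves by blast
  qed
qed

text \<open>
  The partial derivatives are continuous, so the elliptic inequality, which is assumed almost everywhere,
  holds at every point of the disc.
\<close>
lemma elliptic_mapping_partial_bound:
  assumes e: "elliptic_mapping K K' f"
    and fx: "continuous_on unit_disc (partial_x f)" and fy: "continuous_on unit_disc (partial_y f)"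
    and z: "norm z < 1" "1 / 2 \<le> norm z"
  shows "norm (partial_x f z) + norm (partial_y f z) \<le> 2 * (2 * K * norm (partial_theta f z) + sqrt K')"
proof -
  have K: "1 \<le> K" "0 \<le> K'" and
    ae: "AE z in lebesgue_on unit_disc. (op_norm_D f z)\<^sup>2 \<le> K * jacobian f z + K'"
    using e by (auto simp: elliptic_mapping_def)
  let ?G = "\<lambda>z. (op_norm_D f z)\<^sup>2 - (K * jacobian f z + K')"
  have c: "continuous_on unit_disc ?G"
    unfolding op_norm_D_def jacobian_def partial_z_def partial_zbar_def
    by (intro continuous_intros fx fy) auto
  \<comment> \<open>The exceptional set is open by continuity and a null set by assumption, hence empty.\<close>
  define V where "V = {z \<in> unit_disc. 0 < ?G z}"
  have "open V"
    unfolding V_def using continuous_open_preimage[OF c open_ball open_greaterThan[of 0]]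
    by (simp add: vimage_def Int_def)
  moreover have "negligible V"
  proof -
    have "AE z in lebesgue. z \<in> unit_disc \<longrightarrow> ?G z \<le> 0"
      using ae by (subst (asm) AE_restrict_space_iff) auto
    then obtain N where N: "N \<in> null_sets lebesgue" "{z \<in> space lebesgue. \<not> (z \<in> unit_disc \<longrightarrow> ?G z \<le> 0)} \<subseteq> N"
      unfolding eventually_ae_filter by blast
    moreover have "V \<subseteq> {z \<in> space lebesgue. \<not> (z \<in> unit_disc \<longrightarrow> ?G z \<le> 0)}" by (auto simp: V_def)
    ultimately show ?thesis by (meson negligible_iff_null_sets negligible_subset order_trans)
  qed
  ultimately have "V = {}" using open_not_negligible by blast
  then have G: "(op_norm_D f z)\<^sup>2 \<le> K * jacobian f z + K'"
    using z by (force simp: V_def)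
  define p where "p = norm (partial_z f z)"
  define q where "q = norm (partial_zbar f z)"
  have pq: "p \<ge> 0" "q \<ge> 0" by (auto simp: p_def q_def)
  have G': "(p + q)\<^sup>2 \<le> K * (p\<^sup>2 - q\<^sup>2) + K'"
    using G by (simp add: op_norm_D_def jacobian_def p_def q_def)
  define l where "l = \<bar>p - q\<bar>"
  have D: "p + q \<le> K * l + sqrt K'"
  proof (rule ccontr)
    assume "\<not> p + q \<le> K * l + sqrt K'"
    then have lt: "K * l + sqrt K' < p + q" by simp
    have l0: "0 \<le> K * l" using K by (simp add: l_def)
    have s0: "0 \<le> sqrt K'" using K by simp
    have "p\<^sup>2 - q\<^sup>2 = (p + q) * (p - q)" by (simp add: power2_eq_square algebra_simps)
    also have "\<dots> \<le> (p + q) * l" using pq by (intro mult_left_mono) (auto simp: l_def)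
    finally have "K * (p\<^sup>2 - q\<^sup>2) \<le> K * ((p + q) * l)" using K by (intro mult_left_mono) auto
    then have "(p + q)\<^sup>2 \<le> (p + q) * (K * l) + K'" using G' by (simp add: algebra_simps)
    then have le: "(p + q) * (p + q - K * l) \<le> K'" by (simp add: power2_eq_square algebra_simps)
    have "sqrt K' * sqrt K' \<le> sqrt K' * (p + q - K * l)" using lt s0 by (intro mult_left_mono) auto
    also have "\<dots> < (p + q) * (p + q - K * l)"
    proof (rule mult_strict_right_mono)
      show "sqrt K' < p + q" using lt l0 by simp
      show "0 < p + q - K * l" using lt s0 by (simp del: real_sqrt_ge_0_iff)
    qed
    finally show False using le K by simp
  qed
  have l: "l \<le> 2 * norm (partial_theta f z)"
  proof -
    have "norm z * l = \<bar>norm (z * partial_z f z) - norm (cnj z * partial_zbar f z)\<bar>"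
      by (simp add: l_def p_def q_def norm_mult abs_mult flip: right_diff_distrib)
    also have "\<dots> \<le> norm (z * partial_z f z - cnj z * partial_zbar f z)"
      by (rule norm_triangle_ineq3)
    also have "\<dots> = norm (partial_theta f z)" by (simp add: partial_theta_def norm_mult)
    finally have "norm z * l \<le> norm (partial_theta f z)" .
    moreover have "1 / 2 * l \<le> norm z * l" using z by (intro mult_right_mono) (auto simp: l_def)
    ultimately show ?thesis by simp
  qed
  have xy: "partial_x f z = partial_z f z + partial_zbar f z" "partial_y f z = \<i> * (partial_z f z - partial_zbar f z)"
    by (simp_all add: partial_z_def partial_zbar_def complex_eq_iff field_simps)
  have "norm (partial_x f z) \<le> p + q" "norm (partial_y f z) \<le> p + q"
    unfolding xy p_def q_def norm_mult norm_ii mult_1 by (rule norm_triangle_ineq norm_triangle_ineq4)+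
  moreover have "K * l \<le> 2 * K * norm (partial_theta f z)"
    using mult_left_mono[OF l, of K] K by simp
  moreover have "x + y \<le> 2 * (k + w)" if "x \<le> s" "y \<le> s" "u \<le> k" "s \<le> u + w" for x y k u w s :: real
    using that by simp
  ultimately show ?thesis using D by blast
qed

section \<open>The Hardy type norms of the derivatives\<close>

lemma lesssim_finite:
  assumes "X < \<infinity>"
  shows "lesssim X Y"
proof -
  have "X = ennreal (enn2real X)" using assms by simp
  then have "X \<le> ennreal 1 * Y + ennreal (enn2real X)" by (metis add_increasing zero_le order_refl)
  then show ?thesis unfolding lesssim_def by (metis enn2real_nonneg order_refl)
qed

text \<open>
  Only the branch of the argument needs care: for \<open>t > pi\<close> the argument of \<open>e\<^sup>i\<^sup>t\<close> is \<open>t - 2 pi\<close>.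
\<close>
lemma circle_deriv_eq:
  assumes t: "t \<in> {0<..<2 * pi}" and D: "((\<lambda>\<theta>. F (cis \<theta>)) has_vector_derivative D) (at t)"
  shows "circle_deriv F (cis t) = D"
proof (cases "t \<le> pi")
  case True
  then have "Arg (cis t) = t" using t by (intro cis_Arg_unique) (auto simp: sgn_eq)
  then show ?thesis unfolding circle_deriv_def using D by (simp add: vector_derivative_at)
next
  case False
  have per: "cis (t - 2 * pi) = cis t" for t by (simp add: complex_eq_iff cos_diff sin_diff)
  have "Arg (cis t) = t - 2 * pi" using t False by (intro cis_Arg_unique) (auto simp: per sgn_eq)
  moreover have "((\<lambda>\<theta>. F (cis \<theta>)) has_vector_derivative D) (at (t - 2 * pi))"
  proof -
    have "((\<lambda>x. x + 2 * pi) has_vector_derivative 1) (at (t - 2 * pi))"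
      by (auto intro!: derivative_eq_intros simp flip: has_real_derivative_iff_has_vector_derivative)
    from vector_diff_chain_at[OF this, of "\<lambda>\<theta>. F (cis \<theta>)" D] D
    show ?thesis using per[of "x + 2 * pi" for x] by (simp add: o_def)
  qed
  ultimately show ?thesis unfolding circle_deriv_def by (simp add: vector_derivative_at)
qed

lemma circle_Lp_imp_Lp_function:
  assumes "1 \<le> p" "G \<in> circle_Lp p"
  shows "Lp_function p (\<lambda>t. G (cis t))"
  using assms(1)
proof (cases rule: ereal_exponent_cases)
  case 1
  have m: "(\<lambda>t. G (cis t)) \<in> borel_measurable circle_measure"
    and fin: "esssup circle_measure (\<lambda>\<theta>. ennreal (norm (G (cis \<theta>)))) < \<infinity>"
    using assms(2) 1 by (auto simp: circle_Lp_def circle_Lp_norm_def)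
  obtain B where B: "esssup circle_measure (\<lambda>\<theta>. ennreal (norm (G (cis \<theta>)))) = ennreal B" "0 \<le> B"
    using fin by (cases "esssup circle_measure (\<lambda>\<theta>. ennreal (norm (G (cis \<theta>))))") auto
  have "AE t in circle_measure. norm (G (cis t)) \<le> B"
    using esssup_AE[where M = circle_measure and f = "\<lambda>\<theta>. ennreal (norm (G (cis \<theta>)))"] unfolding B
    by eventually_elim (use B(2) in simp)
  then show ?thesis using 1 m by (auto simp: Lp_function_def)
next
  case (2 q)
  then show ?thesis
    using assms(2)
    by (auto simp: circle_Lp_def circle_Lp_norm_def circle_mean_def Lp_function_def ennreal_powr_finite_iff
        ennreal_mult_less_top)
qed

theorem theorem1p1:
  fixes \<alpha> :: real and p :: ereal and F f :: "complex \<Rightarrow> complex"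
  assumes "-1 < \<alpha>" and "1 \<le> p"
    and "circle_abs_continuous F"
    and "circle_deriv F \<in> circle_Lp p"
    and "\<And>z. z \<in> unit_disc \<Longrightarrow> f z = poisson_integral \<alpha> F z"
  shows
    "((\<alpha>, p) \<in> Param \<longrightarrow>
        lesssim (hardy_norm p (partial_theta f)) (circle_Lp_norm p (circle_deriv F))) \<and>
     ((\<alpha>, p) \<in> Param1 \<longrightarrow>
        lesssim
          (hardy_norm p (partial_r f) + hardy_norm p (partial_z f) + hardy_norm p (partial_zbar f))
          (circle_Lp_norm \<infinity> F + circle_Lp_norm p (circle_deriv F))) \<and>
     (\<alpha> = 0 \<and> 1 < p \<and> p < \<infinity> \<longrightarrow>
        lesssim
          (hardy_norm p (partial_r f) + hardy_norm p (partial_z f) + hardy_norm p (partial_zbar f))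
          (circle_Lp_norm p (circle_deriv F))) \<and>
     (\<forall>K K'. (\<alpha>, p) \<in> Param2 \<union> Param3 \<and> elliptic_mapping K K' f \<longrightarrow>
        lesssim
          (hardy_norm p (partial_r f) + hardy_norm p (partial_z f) + hardy_norm p (partial_zbar f))
          (circle_Lp_norm p (circle_deriv F)))"
proof -
  define \<phi> where "\<phi> t = F (cis t)" for t
  define g where "g t = circle_deriv F (cis t)" for t
  have ac: "abs_continuous_on 0 (2 * pi) \<phi>"
    using assms(3) by (simp add: circle_abs_continuous_def \<phi>_def[abs_def])
  have per: "\<phi> (2 * pi) = \<phi> 0" by (simp add: \<phi>_def)
  have gLp: "Lp_function p g"
    unfolding g_def[abs_def] by (rule circle_Lp_imp_Lp_function[OF assms(2,4)])
  obtain \<phi>' N where N: "negligible N"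
    "\<And>t. t \<in> {0<..<2 * pi} - N \<Longrightarrow> (\<phi> has_vector_derivative \<phi>' t) (at t)"
    by (rule abs_continuous_ftc[OF ac]) auto
  have Ng: "(\<phi> has_vector_derivative g t) (at t)" if "t \<in> {0<..<2 * pi} - N" for t
    using N(2)[OF that] circle_deriv_eq[of t F "\<phi>' t"] that unfolding \<phi>_def[abs_def] g_def by simp
  have \<phi>c: "continuous_on {0..2 * pi} \<phi>" by (rule abs_continuous_on_imp_continuous_on[OF ac])
  have f: "f w = poisson_average \<alpha> \<phi> w" if "w \<in> unit_disc" for w
    unfolding assms(5)[OF that] \<phi>_def[abs_def]
    by (rule poisson_integral_eq_average) (use \<phi>c that in \<open>auto simp: \<phi>_def[abs_def]\<close>)
  have P: "partial_x f z = poisson_average_deriv \<alpha> \<phi> z 1" "partial_y f z = poisson_average_deriv \<alpha> \<phi> z \<i>"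
    "partial_theta f z = poisson_average_deriv \<alpha> \<phi> z (\<i> * z)" if "norm z < 1" for z
    using that by (intro partials_of_poisson_average[OF f \<phi>c]; simp)+
  have P4: "poisson_average_deriv \<alpha> \<phi> z h = Re h *\<^sub>R partial_x f z + Im h *\<^sub>R partial_y f z" if "norm z < 1" for z h
    using that by (intro partials_of_poisson_average(4)[OF f \<phi>c]; simp)
  let ?ang = "\<lambda>z. poisson_average_deriv \<alpha> \<phi> z (\<i> * z)" and ?rad = "\<lambda>z. poisson_average_deriv \<alpha> \<phi> z z"
  have fx: "continuous_on unit_disc (partial_x f)"
    by (rule continuous_on_eq[OF continuous_on_poisson_average_deriv[OF \<phi>c, of \<alpha> 1]]) (simp add: P(1))
  have fy: "continuous_on unit_disc (partial_y f)"
    by (rule continuous_on_eq[OF continuous_on_poisson_average_deriv[OF \<phi>c, of \<alpha> \<i>]]) (simp add: P(2))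
  have ca: "continuous_on unit_disc ?ang"
    by (intro continuous_on_poisson_average_deriv_diag[OF ac per N(1) Ng assms(2) gLp assms(1)] continuous_intros)
  have cr: "continuous_on unit_disc ?rad"
    by (intro continuous_on_poisson_average_deriv_diag[OF ac per N(1) Ng assms(2) gLp assms(1)] continuous_intros)
  have ba: "bounded_means p ?ang"
    by (rule angular_derivative_bounded_means[OF ac per N(1) Ng assms(2) gLp assms(1)])
  have theta: "partial_theta f z = ?ang z" if "z \<in> unit_disc" for z
    using P(3) that by simp
  have bt: "bounded_means p (partial_theta f)"
    by (rule bounded_means_dominated[OF assms(2) ba ca ba ca, of 1]) (auto simp: theta)
  have concl: "lesssim (hardy_norm p (partial_r f) + hardy_norm p (partial_z f) + hardy_norm p (partial_zbar f)) Y"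
    if "bounded_means p (partial_r f)" "bounded_means p (partial_z f)" "bounded_means p (partial_zbar f)" for Y
    using hardy_norm_finite[OF assms(2)] that by (intro lesssim_finite) (simp add: less_top[symmetric])
  have part1: "lesssim (hardy_norm p (partial_theta f)) Y" for Y
    by (intro lesssim_finite hardy_norm_finite[OF assms(2) bt])
  have radial: "lesssim (hardy_norm p (partial_r f) + hardy_norm p (partial_z f) + hardy_norm p (partial_zbar f)) Y"
    if br: "bounded_means p ?rad" for Y
  proof -
    have "norm (partial_x f z) + norm (partial_y f z) \<le> 4 * (norm (?ang z) + norm (?rad z) + 1)"
      if z: "norm z < 1" "1 / 2 \<le> norm z" for z
    proof -
      have z0: "z \<noteq> 0" using z by auto
      have e: "norm (poisson_average_deriv \<alpha> \<phi> z h) \<le> 2 * (norm (?ang z) + norm (?rad z))" if h: "norm h = 1" for h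
      proof -
        define c where "c = h / z"
        have hz: "h = c * z" using z0 by (simp add: c_def)
        have "norm c = 1 / norm z" by (simp add: c_def norm_divide h)
        also have "\<dots> \<le> 2" using z z0 by (simp add: field_simps)
        finally have nc: "norm c \<le> 2" .
        have "poisson_average_deriv \<alpha> \<phi> z h = Re c *\<^sub>R ?rad z + Im c *\<^sub>R ?ang z"
          unfolding P4[OF z(1)] hz by (simp add: algebra_simps scaleR_conv_of_real)
        then have "norm (poisson_average_deriv \<alpha> \<phi> z h) \<le> \<bar>Re c\<bar> * norm (?rad z) + \<bar>Im c\<bar> * norm (?ang z)"
          using norm_triangle_ineq[of "Re c *\<^sub>R ?rad z" "Im c *\<^sub>R ?ang z"] by simp
        also have "\<dots> \<le> 2 * norm (?rad z) + 2 * norm (?ang z)"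
          using abs_Re_le_cmod[of c] abs_Im_le_cmod[of c] nc by (intro add_mono mult_right_mono) auto
        finally show ?thesis by simp
      qed
      show ?thesis using e[of 1] e[of \<i>] by (simp add: P(1,2) z)
    qed
    then show ?thesis
      by (intro concl partials_bounded_means[OF assms(2) ba ca br cr fx fy, of 4]) auto
  qed
  have part2: "lesssim (hardy_norm p (partial_r f) + hardy_norm p (partial_z f) + hardy_norm p (partial_zbar f)) Y"
    if "(\<alpha>, p) \<in> Param1" for Y
  proof (cases "0 < \<alpha>")
    case True
    then show ?thesis
      by (intro radial radial_derivative_bounded_means_pos[OF ac per N(1) Ng assms(2) gLp assms(1)])
  next
    case False
    with that have 0: "\<alpha> = 0" "1 < p" "p < \<infinity>" by (auto simp: Param1_def)
    then obtain q where q: "p = ereal q" "1 < q" by (cases p) auto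
    have "bounded_means p ?rad"
    proof (rule radial_derivative_bounded_means[OF ac per N(1) Ng assms(2) gLp assms(1)])
      fix a :: "complex \<Rightarrow> complex"
      assume "continuous_on unit_disc a" "\<And>r \<theta>. 0 \<le> r \<Longrightarrow> r < 1 \<Longrightarrow> \<theta> \<in> {0..2 * pi} \<Longrightarrow>
         a (of_real r * cis \<theta>) = (\<integral>t. radial_conjugate \<alpha> r (\<theta> - t) *\<^sub>R g t \<partial>circle_measure)"
      then show "bounded_means p a"
        unfolding 0(1) q(1) using conjugate_bounded_means[OF q(2) gLp[unfolded q(1)]] by blast
    qed (use 0 in auto)
    then show ?thesis by (rule radial)
  qed
  have part3: "lesssim (hardy_norm p (partial_r f) + hardy_norm p (partial_z f) + hardy_norm p (partial_zbar f)) Y"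
    if e: "elliptic_mapping K K' f" for K K' Y
  proof -
    have K: "1 \<le> K" "0 \<le> K'" using e by (auto simp: elliptic_mapping_def)
    define C where "C = 4 * K + 2 * sqrt K'"
    have C: "0 \<le> C" using K by (simp add: C_def)
    have "norm (partial_x f z) + norm (partial_y f z) \<le> C * (norm (?ang z) + norm (?ang z) + 1)"
      if z: "norm z < 1" "1 / 2 \<le> norm z" for z
    proof -
      let ?t = "norm (?ang z)"
      have "norm (partial_x f z) + norm (partial_y f z) \<le> 4 * K * ?t + 2 * sqrt K' * 1"
        using elliptic_mapping_partial_bound[OF e fx fy z] theta[of z] z by simp
      also have "\<dots> \<le> 4 * K * (?t + ?t + 1) + 2 * sqrt K' * (?t + ?t + 1)"
        using K by (intro add_mono mult_left_mono) auto
      also have "\<dots> = C * (?t + ?t + 1)" by (simp add: C_def algebra_simps)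
      finally show ?thesis .
    qed
    then show ?thesis
      by (intro concl partials_bounded_means[OF assms(2) ba ca ba ca fx fy C]) auto
  qed
  have "(\<alpha>, p) \<in> Param1" if "\<alpha> = 0 \<and> 1 < p \<and> p < \<infinity>"
    using that by (simp add: Param1_def)
  then show ?thesis using part1 part2 part3 by blast
qed

end
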